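(* Consider the magnetization $M_n$ of the four-spin interaction mean-field model with parameters $\beta>0$, $h\in\mathbb R$, with $A$, $g$, $R_1,\dots,R_4$ as in the context. All limits are as $n\to\infty$. (i) If $(\beta,h)\in R_1$, then $M_n/n\to0$ in law; for every sufficiently small $\delta>0$ there is $c>0$ with $\mu_n(|M_n/n|>\delta)\le e^{-cn}$ for all large $n$; and $d_{\mathrm W}\big(M_n/\sqrt n,\,N(0,4/|A''(1/2)|)\big)=O(n^{-1/2})$. (ii) If $(\beta,h)\in R_2$, let $S=\{a_-,a_+\}$ be the set of maximizers of $A$; if (iii) $(\beta,h)\in R_3$, let $S=\{a_-,1/2,a_+\}$ be the set of maximizers of $A$. In both cases $M_n$ is concentrated around the points $2a-1$, $a\in S$, that is: for every sufficiently small $\delta>0$ there is $c>0$ with $\mu_n(|M_n/n-(2a-1)|>\delta\text{ for all }a\in S)\le e^{-cn}$ for all large $n$, and $M_n/n$ converges in law to $\sum_{a\in S}p_a\delta_{2a-1}$, where $p_a=w_a/\sum_{b\in S}w_b$ with $w_a=(a(1-a))^{-1/2}\int_{\mathbb R}\exp(\frac12A''(a)x^2)\,dx$. Moreover the conditional central limit theorems hold: for each $a\in S$ and every sufficiently small $\delta>0$, $$d_{\mathrm W}\Big(\mathcal L\Big(\frac{M_n-n(2a-1)}{\sqrt n}\,\Big|\,|M_n/n-(2a-1)|\le\delta\Big),\,N\Big(0,\frac{4}{|A''(a)|}\Big)\Big)=O(n^{-1/2}).$$ (iv) If $(\beta,h)\in R_4$, then $d_{\mathrm W}(n^{-3/4}M_n,Y)=O(n^{-1/4})$,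 where $Y$ has density proportional to $\exp\Big(\frac{A^{(4)}(1/2)\,x^4}{2^4\,4!}\Big)$. (v) If $(\beta,h)=(1/12,1/2)$, then $d_{\mathrm W}(n^{-5/6}M_n,Y)=O(n^{-1/4})$, where $Y$ has density proportional to $\exp\Big(\frac{A^{(6)}(1/2)\,x^6}{2^6\,6!}\Big)$.
   Context: For $\omega\in\{1,-1\}^n$ let $\bar\omega_+=|\{i:\omega_i=1\}|/n$ and $M_n=\omega_1+\dots+\omega_n$. The four-spin model is $\mu_n(\omega)\propto\exp(nf_{\beta,h}(\bar\omega_+))$ on $\{1,-1\}^n$, with $f_{\beta,h}(a)=\beta(2a-1)^4+h(2a-1)^2$. Let $I(a)=-a\log a-(1-a)\log(1-a)$ on $[0,1]$ ($0\log0=0$) and $A=f_{\beta,h}+I$. A maximizer $a$ of $A$ is $2m$-regular if $A^{(k)}(a)=0$ for $1\le k\le2m-1$ and $A^{(2m)}(a)<0$. There is a function $g:(0,\infty)\to\mathbb R$ with $g(\beta)=1/2$ for $\beta\le1/12$ such that: on $R_1=\{h<g(\beta)\}$, $A$ has the unique maximizer $1/2$, which is 2-regular; on $R_2=\{h>g(\beta)\}$, $A$ has exactly two maximizers $0<a_-<1/2<a_+<1$, both 2-regular; on $R_3=\{h=g(\beta),\beta>1/12\}$, $A$ has exactly three maximizers $a_-<1/2<a_+$, in $(0,1)$, all 2-regular; on $R_4=\{0<\beta<1/12,h=1/2\}$, $A$ has the unique maximizer $1/2$, which is 4-regular; at $(\beta,h)=(1/12,1/2)$, $A$ has the unique maximizer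 $1/2$, which is 6-regular. $d_{\mathrm W}(X,Y)=\sup_{\|h'\|_\infty\le1}|\mathbb Eh(X)-\mathbb Eh(Y)|$; $N(0,\sigma^2)$ is the centered normal law with variance $\sigma^2$. Constants in $O(\cdot)$ do not depend on $n$. *)

theory Defs
  imports "HOL-Probability.Probability"
begin

section \<open>The four-spin model\<close>

definition four_f :: "real \<Rightarrow> real \<Rightarrow> real \<Rightarrow> real" where
  "four_f \<beta> h a = \<beta> * (2 * a - 1) ^ 4 + h * (2 * a - 1) ^ 2"

text \<open>The convention \<open>0 log 0 = 0\<close> holds automatically. Only values on \<open>[0,1]\<close>, and derivatives
  at interior points of \<open>[0,1]\<close>, are ever used.\<close>
definition entropy_I :: "real \<Rightarrow> real" where
  "entropy_I a = - a * ln a - (1 - a) * ln (1 - a)"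

definition four_A :: "real \<Rightarrow> real \<Rightarrow> real \<Rightarrow> real" where
  "four_A \<beta> h a = four_f \<beta> h a + entropy_I a"

definition four_A_deriv :: "nat \<Rightarrow> real \<Rightarrow> real \<Rightarrow> real \<Rightarrow> real" where
  "four_A_deriv k \<beta> h = (deriv ^^ k) (four_A \<beta> h)"

definition spin_configs :: "nat \<Rightarrow> (nat \<Rightarrow> real) set" where
  "spin_configs n = ({..<n} \<rightarrow>\<^sub>E {1, -1})"

definition plus_fraction :: "nat \<Rightarrow> (nat \<Rightarrow> real) \<Rightarrow> real" where
  "plus_fraction n \<omega> = real (card {i \<in> {..<n}. \<omega> i = 1}) / real n"

definition magnetization :: "nat \<Rightarrow> (nat \<Rightarrow> real) \<Rightarrow> real" where
  "magnetization n \<omega> = (\<Sum>i<n. \<omega> i)"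

definition four_spin_weight :: "real \<Rightarrow> real \<Rightarrow> nat \<Rightarrow> (nat \<Rightarrow> real) \<Rightarrow> real" where
  "four_spin_weight \<beta> h n \<omega> = exp (real n * four_f \<beta> h (plus_fraction n \<omega>))"

definition four_spin_measure :: "real \<Rightarrow> real \<Rightarrow> nat \<Rightarrow> (nat \<Rightarrow> real) measure" where
  "four_spin_measure \<beta> h n = point_measure (spin_configs n)
     (\<lambda>\<omega>. ennreal (four_spin_weight \<beta> h n \<omega> / (\<Sum>\<eta>\<in>spin_configs n. four_spin_weight \<beta> h n \<eta>)))"

section \<open>Maximizers and the phase diagram\<close>

definition maximizers :: "real \<Rightarrow> real \<Rightarrow> real set" where
  "maximizers \<beta> h = {a \<in> {0..1}. \<forall>b\<in>{0..1}. four_A \<beta> h b \<le> four_A \<beta> h a}"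

text \<open>\<open>regular_maximizer m \<beta> h a\<close>: \<open>a\<close> is a \<open>2m\<close>-regular maximizer of \<open>A\<close>.\<close>
definition regular_maximizer :: "nat \<Rightarrow> real \<Rightarrow> real \<Rightarrow> real \<Rightarrow> bool" where
  "regular_maximizer m \<beta> h a \<longleftrightarrow>
     a \<in> maximizers \<beta> h \<and>
     (\<forall>k\<in>{1..2 * m - 1}. four_A_deriv k \<beta> h a = 0) \<and>
     four_A_deriv (2 * m) \<beta> h a < 0"

text \<open>The function \<open>g\<close> lives on \<open>(0,\<infinity>)\<close>; its values elsewhere never matter, as every
  region is contained in the half-plane \<open>\<beta> > 0\<close>. Regions are sets of pairs \<open>(\<beta>, h)\<close>.\<close>
definition R1 :: "(real \<Rightarrow> real) \<Rightarrow> (real \<times> real) set" where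
  "R1 g = {(\<beta>, h). 0 < \<beta> \<and> h < g \<beta>}"

definition R2 :: "(real \<Rightarrow> real) \<Rightarrow> (real \<times> real) set" where
  "R2 g = {(\<beta>, h). 0 < \<beta> \<and> h > g \<beta>}"

definition R3 :: "(real \<Rightarrow> real) \<Rightarrow> (real \<times> real) set" where
  "R3 g = {(\<beta>, h). h = g \<beta> \<and> \<beta> > 1 / 12}"

definition R4 :: "(real \<times> real) set" where
  "R4 = {(\<beta>, h). 0 < \<beta> \<and> \<beta> < 1 / 12 \<and> h = 1 / 2}"

text \<open>The defining properties of the function \<open>g\<close>; they determine \<open>g\<close> on \<open>(0,\<infinity>)\<close>.\<close>
definition phase_boundary :: "(real \<Rightarrow> real) \<Rightarrow> bool" where
  "phase_boundary g \<longleftrightarrow>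
     (\<forall>\<beta>. 0 < \<beta> \<and> \<beta> \<le> 1 / 12 \<longrightarrow> g \<beta> = 1 / 2) \<and>
     (\<forall>(\<beta>, h) \<in> R1 g. maximizers \<beta> h = {1 / 2} \<and> regular_maximizer 1 \<beta> h (1 / 2)) \<and>
     (\<forall>(\<beta>, h) \<in> R2 g. \<exists>am ap. 0 < am \<and> am < 1 / 2 \<and> 1 / 2 < ap \<and> ap < 1 \<and>
        maximizers \<beta> h = {am, ap} \<and> (\<forall>a\<in>{am, ap}. regular_maximizer 1 \<beta> h a)) \<and>
     (\<forall>(\<beta>, h) \<in> R3 g. \<exists>am ap. 0 < am \<and> am < 1 / 2 \<and> 1 / 2 < ap \<and> ap < 1 \<and>
        maximizers \<beta> h = {am, 1 / 2, ap} \<and> (\<forall>a\<in>{am, 1 / 2, ap}. regular_maximizer 1 \<beta> h a)) \<and>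
     (\<forall>(\<beta>, h) \<in> R4. maximizers \<beta> h = {1 / 2} \<and> regular_maximizer 2 \<beta> h (1 / 2)) \<and>
     maximizers (1 / 12) (1 / 2) = {1 / 2} \<and> regular_maximizer 3 (1 / 12) (1 / 2) (1 / 2)"

section \<open>Laws and distances\<close>

text \<open>The value is extended, so that a bound on it entails finiteness. For laws with finite first
  moment the supremum may equally be taken over all 1-Lipschitz test functions, see
  \<open>wasserstein_eq_lipschitz\<close>.\<close>
definition wasserstein :: "real measure \<Rightarrow> real measure \<Rightarrow> ennreal" where
  "wasserstein P Q =
     (SUP \<phi>\<in>{\<phi> :: real \<Rightarrow> real. \<forall>x. \<phi> differentiable (at x) \<and> \<bar>deriv \<phi> x\<bar> \<le> 1}.
        ennreal \<bar>(\<integral>x. \<phi> x \<partial>P) - (\<integral>x. \<phi> x \<partial>Q)\<bar>)"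

lemma lipschitz_approx_differentiable:
  fixes \<phi> :: "real \<Rightarrow> real"
  assumes lip: "1-lipschitz_on UNIV \<phi>" and e: "e > 0"
  obtains \<psi> where "\<And>x. \<psi> differentiable (at x) \<and> \<bar>deriv \<psi> x\<bar> \<le> 1" "\<And>x. \<bar>\<psi> x - \<phi> x\<bar> \<le> e"
proof -
  have L: "\<bar>\<phi> x - \<phi> y\<bar> \<le> \<bar>x - y\<bar>" for x y
    using lipschitz_onD[OF lip, of x y] by (simp add: dist_real_def)
  have "continuous_on UNIV \<phi>" using lip by (rule lipschitz_on_continuous_on)
  then have "isCont \<phi> x" for x by (simp add: continuous_on_eq_continuous_at)
  then have "\<exists>F. \<forall>x::real. - \<infinity> < ereal x \<longrightarrow> ereal x < \<infinity> \<longrightarrow> (F has_vector_derivative \<phi> x) (at x)"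
    by (intro einterval_antiderivative) auto
  then obtain F where F: "(F has_real_derivative \<phi> x) (at x)" for x
    by (auto simp: has_real_derivative_iff_has_vector_derivative)
  define \<psi> where "\<psi> x = (F (x + e) - F x) / e" for x
  have D: "(\<psi> has_real_derivative (\<phi> (x + e) - \<phi> x) / e) (at x)" for x
    unfolding \<psi>_def using e
    by (auto intro!: derivative_eq_intros F DERIV_chain'[where f = "\<lambda>x. x + e" and g = F])
  have 1: "\<psi> differentiable (at x) \<and> \<bar>deriv \<psi> x\<bar> \<le> 1" for x
    using D[of x] L[of "x + e" x] e
    by (auto simp: DERIV_imp_deriv real_differentiable_def abs_divide divide_le_eq_1)
  have 2: "\<bar>\<psi> x - \<phi> x\<bar> \<le> e" for x
  proof -
    obtain z where z: "x < z" "z < x + e" "F (x + e) - F x = (x + e - x) * \<phi> z"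
      using MVT2[of x "x + e" F \<phi>] F e by auto
    then have "\<psi> x = \<phi> z" using e by (simp add: \<psi>_def)
    then show ?thesis using L[of z x] z by simp
  qed
  show thesis using that 1 2 by blast
qed

lemma differentiable_bound_lipschitz:
  fixes \<phi> :: "real \<Rightarrow> real"
  assumes "\<And>x. \<phi> differentiable (at x) \<and> \<bar>deriv \<phi> x\<bar> \<le> 1"
  shows "1-lipschitz_on UNIV \<phi>"
proof (rule lipschitz_onI)
  fix x y :: real
  have "(\<phi> has_field_derivative deriv \<phi> z) (at z within UNIV)" for z
    using assms[of z] by (simp add: DERIV_deriv_iff_real_differentiable)
  then have "norm (\<phi> x - \<phi> y) \<le> 1 * norm (x - y)"
    using assms by (intro field_differentiable_bound[where S = UNIV and f' = "deriv \<phi>"]) auto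
  then show "dist (\<phi> x) (\<phi> y) \<le> 1 * dist x y" by (simp add: dist_real_def)
qed simp

lemma lipschitz_integrable:
  fixes \<phi> :: "real \<Rightarrow> real"
  assumes "prob_space P" "sets P = sets borel" "integrable P (\<lambda>x. x)" "1-lipschitz_on UNIV \<phi>"
  shows "integrable P \<phi>"
proof -
  interpret prob_space P by fact
  have "\<phi> \<in> borel_measurable borel"
    using lipschitz_on_continuous_on[OF assms(4)] by (rule borel_measurable_continuous_onI)
  then have m: "\<phi> \<in> borel_measurable P" using assms(2) by (simp cong: measurable_cong_sets)
  have "\<bar>\<phi> x\<bar> \<le> \<bar>x\<bar> + \<bar>\<phi> 0\<bar>" for x
    using lipschitz_onD[OF assms(4), of x 0] by (simp add: dist_real_def)
  then have b: "AE x in P. norm (\<phi> x) \<le> norm (\<bar>x\<bar> + \<bar>\<phi> 0\<bar>)" by (auto intro!: AE_I2)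
  have i: "integrable P (\<lambda>x. \<bar>x\<bar> + \<bar>\<phi> 0\<bar>)" using assms(3) by simp
  show ?thesis using i m b by (rule Bochner_Integration.integrable_bound)
qed

lemma wasserstein_eq_lipschitz:
  assumes P: "prob_space P" "sets P = sets borel" "integrable P (\<lambda>x. x)"
    and Q: "prob_space Q" "sets Q = sets borel" "integrable Q (\<lambda>x. x)"
  shows "wasserstein P Q =
    (SUP \<phi>\<in>{\<phi> :: real \<Rightarrow> real. 1-lipschitz_on UNIV \<phi>}. ennreal \<bar>(\<integral>x. \<phi> x \<partial>P) - (\<integral>x. \<phi> x \<partial>Q)\<bar>)"
    (is "_ = ?L")
proof (rule antisym)
  show "wasserstein P Q \<le> ?L"
    unfolding wasserstein_def
    by (rule SUP_subset_mono) (auto intro: differentiable_bound_lipschitz)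
next
  have close: "\<bar>(\<integral>x. \<phi> x \<partial>M) - (\<integral>x. \<psi> x \<partial>M)\<bar> \<le> e"
    if M: "prob_space M" "sets M = sets borel" "integrable M (\<lambda>x. x)"
      and "1-lipschitz_on UNIV \<phi>" "1-lipschitz_on UNIV \<psi>" "\<And>x. \<bar>\<psi> x - \<phi> x\<bar> \<le> e"
    for M and \<phi> \<psi> :: "real \<Rightarrow> real" and e :: real
  proof -
    interpret M: prob_space M by fact
    have i: "integrable M \<phi>" "integrable M \<psi>" using that by (auto intro: lipschitz_integrable)
    have "\<bar>\<integral>x. \<phi> x - \<psi> x \<partial>M\<bar> \<le> (\<integral>x. \<bar>\<phi> x - \<psi> x\<bar> \<partial>M)"
      by (rule integral_abs_bound)
    also have "\<dots> \<le> (\<integral>x. e \<partial>M)"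
      using i that(6) by (intro integral_mono) (auto simp: abs_minus_commute)
    finally show ?thesis using i by (simp add: M.prob_space)
  qed
  show "?L \<le> wasserstein P Q"
  proof (rule SUP_least)
    fix \<phi> :: "real \<Rightarrow> real" assume "\<phi> \<in> {\<phi>. 1-lipschitz_on UNIV \<phi>}"
    then have lip: "1-lipschitz_on UNIV \<phi>" by simp
    show "ennreal \<bar>(\<integral>x. \<phi> x \<partial>P) - (\<integral>x. \<phi> x \<partial>Q)\<bar> \<le> wasserstein P Q"
    proof (rule ennreal_le_epsilon)
      fix e :: real assume "0 < e"
      then obtain \<psi> where \<psi>: "\<And>x. \<psi> differentiable (at x) \<and> \<bar>deriv \<psi> x\<bar> \<le> 1"
          "\<And>x. \<bar>\<psi> x - \<phi> x\<bar> \<le> e / 2"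
        using lipschitz_approx_differentiable[OF lip, of "e / 2"] by auto
      note lp = differentiable_bound_lipschitz[OF \<psi>(1)]
      have "\<bar>(\<integral>x. \<phi> x \<partial>P) - (\<integral>x. \<phi> x \<partial>Q)\<bar> \<le> \<bar>(\<integral>x. \<psi> x \<partial>P) - (\<integral>x. \<psi> x \<partial>Q)\<bar> + e"
        using close[OF P lip lp \<psi>(2)] close[OF Q lip lp \<psi>(2)] by linarith
      then have "ennreal \<bar>(\<integral>x. \<phi> x \<partial>P) - (\<integral>x. \<phi> x \<partial>Q)\<bar>
          \<le> ennreal \<bar>(\<integral>x. \<psi> x \<partial>P) - (\<integral>x. \<psi> x \<partial>Q)\<bar> + ennreal e"
        using \<open>0 < e\<close> by (simp flip: ennreal_plus add: ennreal_leI)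
      also have "ennreal \<bar>(\<integral>x. \<psi> x \<partial>P) - (\<integral>x. \<psi> x \<partial>Q)\<bar> \<le> wasserstein P Q"
        unfolding wasserstein_def using \<psi>(1) by (intro SUP_upper) auto
      finally show "ennreal \<bar>(\<integral>x. \<phi> x \<partial>P) - (\<integral>x. \<phi> x \<partial>Q)\<bar> \<le> wasserstein P Q + ennreal e"
        by (simp add: add_right_mono)
    qed
  qed
qed

definition normal_law :: "real \<Rightarrow> real measure" where
  "normal_law v = density lborel (\<lambda>x. ennreal (normal_density 0 (sqrt v) x))"

text \<open>The law whose density is proportional to \<open>q\<close> (for nonnegative \<open>q\<close> with finite nonzero integral).\<close>
definition law_proportional_to :: "(real \<Rightarrow> real) \<Rightarrow> real measure" where
  "law_proportional_to q = density lborel (\<lambda>x. ennreal (q x / (\<integral>y. q y \<partial>lborel)))"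

definition magnetization_law :: "real \<Rightarrow> real \<Rightarrow> nat \<Rightarrow> real \<Rightarrow> real measure" where
  "magnetization_law \<beta> h n s = distr (four_spin_measure \<beta> h n) borel (\<lambda>\<omega>. magnetization n \<omega> / s)"

text \<open>The conditional law of \<open>(M\<^sub>n - n(2a-1)) / \<surd>n\<close> given \<open>\<bar>M\<^sub>n/n - (2a-1)\<bar> \<le> \<delta>\<close>. The conditioning
  event has positive probability for all large \<open>n\<close>.\<close>
definition conditional_fluctuation_law ::
    "real \<Rightarrow> real \<Rightarrow> real \<Rightarrow> real \<Rightarrow> nat \<Rightarrow> real measure" where
  "conditional_fluctuation_law \<beta> h a \<delta> n =
     distr (uniform_measure (four_spin_measure \<beta> h n)
              {\<omega> \<in> space (four_spin_measure \<beta> h n). \<bar>magnetization n \<omega> / real n - (2 * a - 1)\<bar> \<le> \<delta>})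
       borel (\<lambda>\<omega>. (magnetization n \<omega> - real n * (2 * a - 1)) / sqrt (real n))"

definition maximizer_weight :: "real \<Rightarrow> real \<Rightarrow> real \<Rightarrow> real" where
  "maximizer_weight \<beta> h a =
     (a * (1 - a)) powr (- 1 / 2) * (\<integral>x. exp (1 / 2 * four_A_deriv 2 \<beta> h a * x ^ 2) \<partial>lborel)"

text \<open>The mixture \<open>\<Sum>a\<in>S. p\<^sub>a \<delta>\<^bsub>2a-1\<^esub>\<close>, as the image of the weights \<open>p\<close> on \<open>S\<close>.\<close>
definition limit_mixture :: "real \<Rightarrow> real \<Rightarrow> real set \<Rightarrow> real measure" where
  "limit_mixture \<beta> h S =
     distr (point_measure S
              (\<lambda>a. ennreal (maximizer_weight \<beta> h a / (\<Sum>b\<in>S. maximizer_weight \<beta> h b))))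
       borel (\<lambda>a. 2 * a - 1)"

text \<open>``For every sufficiently small \<open>\<delta> > 0\<close>'' is rendered as eventually at the filter \<open>at_right 0\<close>.\<close>
definition exponentially_concentrated :: "real \<Rightarrow> real \<Rightarrow> real set \<Rightarrow> bool" where
  "exponentially_concentrated \<beta> h S \<longleftrightarrow>
     (\<forall>\<^sub>F \<delta> in at_right (0::real). \<exists>c>0. \<forall>\<^sub>F n in sequentially.
        \<P>(\<omega> in four_spin_measure \<beta> h n.
             \<forall>a\<in>S. \<bar>magnetization n \<omega> / real n - (2 * a - 1)\<bar> > \<delta>) \<le> exp (- c * real n))"

definition ennreal_bigo :: "(nat \<Rightarrow> ennreal) \<Rightarrow> (nat \<Rightarrow> real) \<Rightarrow> bool" where
  "ennreal_bigo d r \<longleftrightarrow> (\<exists>C::real. \<forall>\<^sub>F n in sequentially. d n \<le> ennreal (C * r n))"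

end

theory Submission
  imports Defs
begin

text \<open>
  The number \<open>k\<close> of plus spins has weight \<open>(n choose k) exp(n f(k/n))\<close>, which Stirling's formula turns
  into \<open>exp(n A(k/n))\<close> times a slowly varying factor. Around a \<open>2m\<close>-regular maximizer \<open>a\<close> put
  \<open>t = 2(k/n - a)\<close> and \<open>y = \<nu> t\<close> with \<open>\<nu>\<close> the \<open>2m\<close>-th root of \<open>n\<close>: Taylor's formula makes the weight
  \<open>exp(- \<kappa> y\<^sup>2\<^sup>m)\<close> up to a relative error of order \<open>\<nu>\<^sup>-\<^sup>q\<close>, where \<open>q = 1\<close> in general and \<open>q = 2\<close> at \<open>1/2\<close>,
  because there the odd derivatives vanish; for \<open>m = 3\<close> only the symmetric bound \<open>q = 2\<close> gives the
  rate \<open>n\<^sup>-\<^sup>1\<^sup>/\<^sup>4\<close>. Sums over the lattice of spacing \<open>2\<nu>/n\<close> are then compared with integrals, uniformly over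
  all test functions of slope at most 1. This yields the Wasserstein rates by normalization,
  and the masses of the individual peaks by taking the test function 1. Away from the maximizers,
  \<open>(n choose k) \<le> exp(n I(k/n))\<close> and compactness make the total weight exponentially small.
\<close>

section \<open>Laplace approximation of lattice sums\<close>

text \<open>Unbounded test functions shape the estimates. A function of slope at most 1 grows
  linearly, so every error must be controlled after multiplication by \<open>1 + |y|\<close>, and
  one constant must serve all test functions at once. Asking \<open>|\<phi> 0| <= 1\<close> rather
  than \<open>\<phi> 0 = 0\<close> keeps the constant 1 in the class, so numerator and normalizer
  obey the same estimate; additive constants cancel after normalization. The exponent of a weight
  carries three errors: the Taylor remainder \<open>n |t|^(2m+q)\<close>, the variation
  \<open>|t|^q\<close> of Stirling's prefactor, and Stirling's remainder \<open>1/n\<close>. With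
  \<open>t = y / \<nu>\<close> each is at most \<open>(1 + |y|)^(2m+q) / \<nu>^q\<close>. This is
  not small at the edge of the window, where y is of order \<nu>. The window is therefore taken so
  narrow that the Taylor error consumes at most half of \<open>\<kappa> y^(2m)\<close>; the
  surviving half pays for all polynomial factors. The mesh \<open>2\<nu>/n = 2/\<nu>^(2m-1)\<close>
  is fine enough because \<open>q < 2m\<close>; in particular m = 1 admits only q = 1.\<close>

lemma power_div_fact_le_exp:
  fixes x :: real
  assumes "x \<ge> 0"
  shows "x ^ n / fact n \<le> exp x"
proof -
  have "(\<Sum>i\<in>{n}. x ^ i /\<^sub>R fact i) \<le> (\<Sum>i. x ^ i /\<^sub>R fact i)"
    using assms exp_converges[of x] by (intro sum_le_suminf) (auto simp: sums_iff)
  then show ?thesis using exp_converges[of x] by (simp add: sums_iff field_simps)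
qed

text \<open>Since \<open>|x| - 1 <= x ^ (2 * m)\<close>, the decay is at least exponential in
  \<open>|x|\<close>, and one term of the exponential series absorbs any polynomial factor. The same
  Cauchy profile is used for every m and N.\<close>

lemma exp_even_power_decay:
  fixes \<mu> :: real
  assumes "\<mu> > 0" "m \<ge> 1"
  obtains B where "B > 0" "\<And>x::real. (1 + \<bar>x\<bar>) ^ N * exp (- \<mu> * x ^ (2 * m)) \<le> B / (1 + x\<^sup>2)"
proof -
  define B where "B = exp (2 * \<mu>) * fact (N + 2) / \<mu> ^ (N + 2)"
  have "(1 + \<bar>x\<bar>) ^ N * exp (- \<mu> * x ^ (2 * m)) \<le> B / (1 + x\<^sup>2)" for x :: real
  proof -
    define y where "y = 1 + \<bar>x\<bar>"
    have y: "y \<ge> 1" by (simp add: y_def)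
    have "\<bar>x\<bar> - 1 \<le> x ^ (2 * m)"
    proof (cases "\<bar>x\<bar> \<ge> 1")
      case True
      have "\<bar>x\<bar> ^ 1 \<le> \<bar>x\<bar> ^ (2 * m)" using True assms by (intro power_increasing) auto
      then show ?thesis by (simp add: power_even_abs)
    next
      case False
      have "0 \<le> x ^ (2 * m)" by simp
      with False show ?thesis by linarith
    qed
    then have "\<mu> * (y - 2) \<le> \<mu> * x ^ (2 * m)"
      using assms by (intro mult_left_mono) (auto simp: y_def)
    then have e: "exp (- \<mu> * x ^ (2 * m)) \<le> exp (2 * \<mu>) * exp (- (\<mu> * y))"
      by (simp flip: exp_add add: algebra_simps)
    \<comment> \<open>The order \<open>N + 2\<close> covers the given power \<open>N\<close> and the
      two extra powers that dominate \<open>1 + x^2\<close>.\<close>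
    have "(\<mu> * y) ^ (N + 2) / fact (N + 2) \<le> exp (\<mu> * y)"
      using assms y by (intro power_div_fact_le_exp) auto
    then have p: "y ^ (N + 2) * exp (- (\<mu> * y)) \<le> fact (N + 2) / \<mu> ^ (N + 2)"
      using assms by (simp add: exp_minus field_simps power_mult_distrib del: fact_Suc)
    have "(1 + x\<^sup>2) * ((1 + \<bar>x\<bar>) ^ N * exp (- \<mu> * x ^ (2 * m))) \<le> y ^ 2 * (y ^ N * exp (- \<mu> * x ^ (2 * m)))"
      unfolding y_def by (intro mult_mono) (auto simp: power2_eq_square algebra_simps)
    also have "\<dots> = y ^ (N + 2) * exp (- \<mu> * x ^ (2 * m))"
      by (simp add: power_add power2_eq_square)
    also have "\<dots> \<le> y ^ (N + 2) * (exp (2 * \<mu>) * exp (- (\<mu> * y)))"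
      using e y by (intro mult_left_mono) auto
    also have "\<dots> = exp (2 * \<mu>) * (y ^ (N + 2) * exp (- (\<mu> * y)))" by simp
    also have "\<dots> \<le> exp (2 * \<mu>) * (fact (N + 2) / \<mu> ^ (N + 2))"
      using p by (intro mult_left_mono) auto
    also have "\<dots> = B" by (simp add: B_def)
    finally show ?thesis
      by (simp add: pos_le_divide_eq add_pos_nonneg mult.commute)
  qed
  moreover have "B > 0" using assms by (simp add: B_def del: fact_Suc)
  ultimately show ?thesis using that by blast
qed

text \<open>All integrands below are dominated by \<open>B / (1 + x\<^sup>2)\<close>; measuring increments by its antiderivative
  makes the errors of a Riemann sum telescope.\<close>
lemma increment_le_arctan:
  fixes F :: "real \<Rightarrow> real"
  assumes F: "\<And>x. (F has_real_derivative F' x) (at x)" and b: "\<And>x. \<bar>F' x\<bar> \<le> B / (1 + x\<^sup>2)"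
    and "x \<le> y"
  shows "\<bar>F y - F x\<bar> \<le> B * (arctan y - arctan x)"
proof -
  have "B * arctan x - F x \<le> B * arctan y - F y"
  proof (rule DERIV_nonneg_imp_nondecreasing[OF \<open>x \<le> y\<close>])
    fix z show "\<exists>u. ((\<lambda>x. B * arctan x - F x) has_real_derivative u) (at z) \<and> 0 \<le> u"
      using b[of z] by (intro exI[of _ "B / (1 + z\<^sup>2) - F' z"])
        (auto intro!: derivative_eq_intros F simp: divide_inverse)
  qed
  moreover have "B * arctan x + F x \<le> B * arctan y + F y"
  proof (rule DERIV_nonneg_imp_nondecreasing[OF \<open>x \<le> y\<close>])
    fix z show "\<exists>u. ((\<lambda>x. B * arctan x + F x) has_real_derivative u) (at z) \<and> 0 \<le> u"
      using b[of z] by (intro exI[of _ "B / (1 + z\<^sup>2) + F' z"])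
        (auto intro!: derivative_eq_intros F simp: divide_inverse)
  qed
  ultimately show ?thesis by (simp add: abs_le_iff algebra_simps)
qed

lemma arctan_diff_le_pi: "arctan y - arctan x \<le> pi"
  using arctan_bounded[of x] arctan_bounded[of y] by linarith

lemma sum_telescope_Ico:
  fixes f :: "nat \<Rightarrow> 'a :: ab_group_add"
  assumes "i \<le> j"
  shows "(\<Sum>k\<in>{i..<j}. f (Suc k) - f k) = f j - f i"
  using sum_Suc_diff'[OF assms, of f] by simp

text \<open>On each cell the mean value theorem turns the increment of \<open>\<Phi>\<close> into
  \<open>\<eta> * F z\<close>, so the cell error is \<open>\<eta>\<close> times an oscillation of
  \<open>F\<close>. The arctangent increments telescope, hence the bound is independent of the
  number and position of the nodes.\<close>

lemma riemann_sum_antiderivative: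
  fixes F \<Phi> :: "real \<Rightarrow> real"
  assumes \<Phi>: "\<And>x. (\<Phi> has_real_derivative F x) (at x)"
    and F: "\<And>x y. x \<le> y \<Longrightarrow> \<bar>F y - F x\<bar> \<le> B * (arctan y - arctan x)"
    and "B \<ge> 0" "\<eta> > 0" "i \<le> j" and Suc: "\<And>k. u (Suc k) = u k + \<eta>"
  shows "\<bar>\<eta> * (\<Sum>k\<in>{i..<j}. F (u k)) - (\<Phi> (u j) - \<Phi> (u i))\<bar> \<le> \<eta> * B * pi"
proof -
  have cell: "\<bar>\<eta> * F (u k) - (\<Phi> (u (Suc k)) - \<Phi> (u k))\<bar> \<le> \<eta> * B * (arctan (u (Suc k)) - arctan (u k))" for k
  proof -
    obtain z where z: "u k < z" "z < u (Suc k)" "\<Phi> (u (Suc k)) - \<Phi> (u k) = \<eta> * F z"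
      using MVT2[of "u k" "u (Suc k)" \<Phi> F] \<Phi> \<open>\<eta> > 0\<close> by (auto simp: Suc)
    have "\<bar>F z - F (u k)\<bar> \<le> B * (arctan z - arctan (u k))" using F z by simp
    also have "\<dots> \<le> B * (arctan (u (Suc k)) - arctan (u k))"
      using z \<open>B \<ge> 0\<close> by (intro mult_left_mono) (auto simp: arctan_le_iff)
    finally have "\<eta> * \<bar>F z - F (u k)\<bar> \<le> \<eta> * (B * (arctan (u (Suc k)) - arctan (u k)))"
      using \<open>\<eta> > 0\<close> by (intro mult_left_mono) auto
    moreover have "\<eta> * \<bar>F z - F (u k)\<bar> = \<bar>\<eta> * F (u k) - (\<Phi> (u (Suc k)) - \<Phi> (u k))\<bar>"
      using \<open>\<eta> > 0\<close> z(3) by (simp add: abs_minus_commute flip: right_diff_distrib) (simp add: abs_mult)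
    ultimately show ?thesis by simp
  qed
  have "\<bar>\<eta> * (\<Sum>k\<in>{i..<j}. F (u k)) - (\<Phi> (u j) - \<Phi> (u i))\<bar>
      = \<bar>\<Sum>k\<in>{i..<j}. \<eta> * F (u k) - (\<Phi> (u (Suc k)) - \<Phi> (u k))\<bar>"
    using sum_telescope_Ico[OF \<open>i \<le> j\<close>, of "\<lambda>k. \<Phi> (u k)"]
    by (simp add: sum_subtractf sum_distrib_left)
  also have "\<dots> \<le> (\<Sum>k\<in>{i..<j}. \<eta> * B * (arctan (u (Suc k)) - arctan (u k)))"
    by (rule order_trans[OF sum_abs]) (intro sum_mono cell)
  also have "\<dots> = \<eta> * B * (arctan (u j) - arctan (u i))"
    by (simp only: sum_distrib_left[symmetric] sum_telescope_Ico[OF \<open>i \<le> j\<close>, of "\<lambda>k. arctan (u k)"])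
  also have "\<dots> \<le> \<eta> * B * pi"
    using assms arctan_diff_le_pi by (intro mult_left_mono) auto
  finally show ?thesis .
qed

text \<open>Each node is compared with the arctangent increment over the cell that follows it: with
  mesh at most 2 the Cauchy profile drops by at most a factor 9 across a cell. This is used to add
  up the pointwise errors of the weights.\<close>

lemma lattice_sum_inverse_square_le:
  assumes "0 < \<eta>" "\<eta> \<le> 2" "i \<le> j" and Suc: "\<And>k. u (Suc k) = u k + \<eta>"
  shows "\<eta> * (\<Sum>k\<in>{i..<j}. 1 / (1 + (u k)\<^sup>2)) \<le> 9 * pi"
proof -
  have cell: "\<eta> * (1 / (1 + (u k)\<^sup>2)) \<le> 9 * (arctan (u (Suc k)) - arctan (u k))" for k
  proof -
    obtain z where z: "u k < z" "z < u (Suc k)" "arctan (u (Suc k)) - arctan (u k) = \<eta> * inverse (1 + z\<^sup>2)"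
      using MVT2[of "u k" "u (Suc k)" arctan "\<lambda>x. inverse (1 + x\<^sup>2)"] DERIV_arctan assms by (auto simp: Suc)
    have "(z - u k)\<^sup>2 \<le> 2\<^sup>2" using z assms by (intro power_mono) (auto simp: Suc)
    then have "(z - u k)\<^sup>2 \<le> 4" by simp
    \<comment> \<open>The identity behind \<open>z^2 <= 2 u^2 + 2 (z - u)^2\<close>; with
      \<open>(z - u)^2 <= 4\<close> it gives \<open>z^2 <= 2 u^2 + 8\<close>, whence the factor
      9.\<close>
    moreover have "z\<^sup>2 = 2 * (u k)\<^sup>2 + 2 * (z - u k)\<^sup>2 - (z - 2 * u k)\<^sup>2"
      by (simp add: power2_eq_square algebra_simps)
    moreover have "0 \<le> (z - 2 * u k)\<^sup>2" by simp
    ultimately have "z\<^sup>2 \<le> 2 * (u k)\<^sup>2 + 8" by linarith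
    then have "1 + z\<^sup>2 \<le> 9 * (1 + (u k)\<^sup>2)" by (simp add: algebra_simps) (smt (verit) zero_le_power2)
    then have "1 / (1 + (u k)\<^sup>2) \<le> 9 * inverse (1 + z\<^sup>2)"
      by (simp add: divide_simps add_pos_nonneg) 
    then have "\<eta> * (1 / (1 + (u k)\<^sup>2)) \<le> \<eta> * (9 * inverse (1 + z\<^sup>2))"
      using assms by (intro mult_left_mono) auto
    then show ?thesis using z(3) by simp
  qed
  have "\<eta> * (\<Sum>k\<in>{i..<j}. 1 / (1 + (u k)\<^sup>2)) \<le> (\<Sum>k\<in>{i..<j}. 9 * (arctan (u (Suc k)) - arctan (u k)))"
    unfolding sum_distrib_left by (intro sum_mono cell)
  also have "\<dots> = 9 * (arctan (u j) - arctan (u i))"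
    by (simp only: sum_distrib_left[symmetric] sum_telescope_Ico[OF \<open>i \<le> j\<close>, of "\<lambda>k. arctan (u k)"])
  also have "\<dots> \<le> 9 * pi" by (intro mult_left_mono arctan_diff_le_pi) simp
  finally show ?thesis .
qed

lemma lborel_integrable_inverse_1_plus_square:
  "integrable lborel (\<lambda>x::real. 1 / (1 + x\<^sup>2))"
  using Sinc_Integral.integrable_inverse_1_plus_square
  by (simp add: set_integrable_def divide_inverse)

lemma lborel_integral_inverse_1_plus_square: "(\<integral>x. 1 / (1 + x\<^sup>2) \<partial>lborel) = pi"
  using LBINT_inverse_1_plus_square
  by (simp add: interval_lebesgue_integral_def set_lebesgue_integral_def divide_inverse)

section \<open>Test functions of slope at most 1 against the limit density\<close>

text \<open>The test class of \<open>wasserstein\<close>, named so that estimates can be stated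
  uniformly over it.\<close>

definition unit_slope :: "(real \<Rightarrow> real) \<Rightarrow> bool" where
  "unit_slope \<phi> \<longleftrightarrow> (\<forall>x. \<phi> differentiable (at x) \<and> \<bar>deriv \<phi> x\<bar> \<le> 1)"

lemma unit_slope_has_derivative:
  "unit_slope \<phi> \<Longrightarrow> (\<phi> has_real_derivative deriv \<phi> x) (at x)"
  by (simp add: unit_slope_def DERIV_deriv_iff_real_differentiable)

lemma unit_slope_growth:
  assumes "unit_slope \<phi>" "\<bar>\<phi> 0\<bar> \<le> 1"
  shows "\<bar>\<phi> x\<bar> \<le> 1 + \<bar>x\<bar>"
  using lipschitz_onD[OF differentiable_bound_lipschitz, of \<phi> x 0] assms
  by (simp add: unit_slope_def dist_real_def)

text \<open>One constant serves the whole class because only \<open>|\<phi> x| <= 1 + |x|\<close>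
  and \<open>|deriv \<phi> x| <= 1\<close> are used. The first bound, with its weight
  \<open>(1 + |x|) ^ q\<close>, is for cutting off tails with an error of order q; the second is the
  oscillation bound required by \<open>riemann_sum_antiderivative\<close>.\<close>

lemma unit_slope_damped_bounds:
  fixes \<kappa> :: real
  assumes "\<kappa> > 0" "m \<ge> 1"
  obtains B where "B > 0"
    "\<And>\<phi> x. unit_slope \<phi> \<Longrightarrow> \<bar>\<phi> 0\<bar> \<le> 1 \<Longrightarrow> (1 + \<bar>x\<bar>) ^ q * \<bar>\<phi> x * exp (- \<kappa> * x ^ (2 * m))\<bar> \<le> B / (1 + x\<^sup>2)"
    "\<And>\<phi> x y. unit_slope \<phi> \<Longrightarrow> \<bar>\<phi> 0\<bar> \<le> 1 \<Longrightarrow> x \<le> y \<Longrightarrow>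
       \<bar>\<phi> y * exp (- \<kappa> * y ^ (2 * m)) - \<phi> x * exp (- \<kappa> * x ^ (2 * m))\<bar> \<le> B * (arctan y - arctan x)"
proof -
  obtain B1 where B1: "B1 > 0" "\<And>x::real. (1 + \<bar>x\<bar>) ^ (q + 1) * exp (- \<kappa> * x ^ (2 * m)) \<le> B1 / (1 + x\<^sup>2)"
    using exp_even_power_decay[OF assms] by blast
  obtain B2 where B2: "B2 > 0" "\<And>x::real. (1 + \<bar>x\<bar>) ^ (2 * m) * exp (- \<kappa> * x ^ (2 * m)) \<le> B2 / (1 + x\<^sup>2)"
    using exp_even_power_decay[OF assms] by blast
  define B where "B = max B1 ((1 + 2 * m * \<kappa>) * B2)"
  have 1: "(1 + \<bar>x\<bar>) ^ q * \<bar>\<phi> x * exp (- \<kappa> * x ^ (2 * m))\<bar> \<le> B / (1 + x\<^sup>2)"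
    if "unit_slope \<phi>" "\<bar>\<phi> 0\<bar> \<le> 1" for \<phi> x
  proof -
    have "(1 + \<bar>x\<bar>) ^ q * \<bar>\<phi> x * exp (- \<kappa> * x ^ (2 * m))\<bar>
        \<le> (1 + \<bar>x\<bar>) ^ q * ((1 + \<bar>x\<bar>) * exp (- \<kappa> * x ^ (2 * m)))"
      using unit_slope_growth[OF that, of x] by (simp add: abs_mult mult_left_mono)
    also have "\<dots> = (1 + \<bar>x\<bar>) ^ (q + 1) * exp (- \<kappa> * x ^ (2 * m))" by simp
    also have "\<dots> \<le> B1 / (1 + x\<^sup>2)" by (rule B1)
    also have "\<dots> \<le> B / (1 + x\<^sup>2)" by (intro divide_right_mono) (auto simp: B_def)
    finally show ?thesis .
  qed
  have 2: "\<bar>\<phi> y * exp (- \<kappa> * y ^ (2 * m)) - \<phi> x * exp (- \<kappa> * x ^ (2 * m))\<bar> \<le> B * (arctan y - arctan x)"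
    if \<phi>: "unit_slope \<phi>" "\<bar>\<phi> 0\<bar> \<le> 1" and "x \<le> y" for \<phi> x y
  proof (rule increment_le_arctan[OF _ _ \<open>x \<le> y\<close>])
    fix z :: real
    let ?e = "exp (- \<kappa> * z ^ (2 * m))"
    let ?d = "deriv \<phi> z * ?e + \<phi> z * (?e * (- \<kappa> * (2 * m * z ^ (2 * m - 1))))"
    show "((\<lambda>x. \<phi> x * exp (- \<kappa> * x ^ (2 * m))) has_real_derivative ?d) (at z)"
      by (auto intro!: derivative_eq_intros unit_slope_has_derivative[OF \<phi>(1)])
    have "\<bar>?d\<bar> \<le> \<bar>deriv \<phi> z\<bar> * ?e + \<bar>\<phi> z\<bar> * ?e * (\<kappa> * (2 * m * \<bar>z\<bar> ^ (2 * m - 1)))"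
      using assms by (intro order_trans[OF abs_triangle_ineq]) (simp add: abs_mult power_abs)
    also have "\<dots> \<le> 1 * ?e + (1 + \<bar>z\<bar>) * ?e * (\<kappa> * (2 * m * \<bar>z\<bar> ^ (2 * m - 1)))"
      using \<phi> unit_slope_growth[OF \<phi>, of z] assms
      by (intro add_mono mult_right_mono) (auto simp: unit_slope_def)
    also have "\<dots> \<le> (1 + \<bar>z\<bar>) ^ (2 * m) * ?e + (1 + \<bar>z\<bar>) * ?e * (\<kappa> * (2 * m * (1 + \<bar>z\<bar>) ^ (2 * m - 1)))"
      using assms by (intro add_mono mult_mono mult_left_mono power_mono one_le_power) auto
    also have "\<dots> = (1 + 2 * m * \<kappa>) * ((1 + \<bar>z\<bar>) ^ (2 * m) * ?e)"
    proof -
      have "(1 + \<bar>z\<bar>) ^ (2 * m) = (1 + \<bar>z\<bar>) * (1 + \<bar>z\<bar>) ^ (2 * m - 1)"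
        using assms by (simp flip: power_Suc)
      then show ?thesis by (simp add: algebra_simps)
    qed
    also have "\<dots> \<le> (1 + 2 * m * \<kappa>) * (B2 / (1 + z\<^sup>2))"
      using B2 assms by (intro mult_left_mono) auto
    also have "\<dots> = (1 + 2 * m * \<kappa>) * B2 / (1 + z\<^sup>2)" by simp
    also have "\<dots> \<le> B / (1 + z\<^sup>2)"
      by (intro divide_right_mono) (auto simp: B_def)
    finally show "\<bar>?d\<bar> \<le> B / (1 + z\<^sup>2)" .
  qed
  have "B > 0" using B1(1) by (simp add: B_def)
  then show ?thesis using 1 2 by (rule that)
qed

lemma unit_slope_damped_integrable:
  fixes \<kappa> :: real
  assumes "\<kappa> > 0" "m \<ge> 1" "unit_slope \<phi>" "\<bar>\<phi> 0\<bar> \<le> 1"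
  shows "integrable lborel (\<lambda>x. \<phi> x * exp (- \<kappa> * x ^ (2 * m)))"
proof -
  obtain B where B: "B > 0"
    "\<And>\<phi> x. unit_slope \<phi> \<Longrightarrow> \<bar>\<phi> 0\<bar> \<le> 1 \<Longrightarrow> (1 + \<bar>x\<bar>) ^ 0 * \<bar>\<phi> x * exp (- \<kappa> * x ^ (2 * m))\<bar> \<le> B / (1 + x\<^sup>2)"
    "\<And>\<phi> x y. unit_slope \<phi> \<Longrightarrow> \<bar>\<phi> 0\<bar> \<le> 1 \<Longrightarrow> x \<le> y \<Longrightarrow>
       \<bar>\<phi> y * exp (- \<kappa> * y ^ (2 * m)) - \<phi> x * exp (- \<kappa> * x ^ (2 * m))\<bar> \<le> B * (arctan y - arctan x)"
    by (rule unit_slope_damped_bounds[OF assms(1,2), of 0]) (rule that)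
  have "continuous_on UNIV \<phi>"
    by (intro continuous_at_imp_continuous_on ballI DERIV_isCont[OF unit_slope_has_derivative[OF assms(3)]])
  then have [measurable]: "\<phi> \<in> borel_measurable borel" by (rule borel_measurable_continuous_onI)
  have "integrable lborel (\<lambda>x::real. B * (1 / (1 + x\<^sup>2)))"
    using lborel_integrable_inverse_1_plus_square by (rule integrable_mult_right)
  then show ?thesis
  proof (rule Bochner_Integration.integrable_bound)
    show "AE x in lborel. norm (\<phi> x * exp (- \<kappa> * x ^ (2 * m))) \<le> norm (B * (1 / (1 + x\<^sup>2)))"
      using B(1) B(2)[OF assms(3,4)] by (intro AE_I2) (simp add: add_pos_nonneg)
  qed simp
qed

text \<open>Outside the interval \<open>T <= 1 + |x|\<close>, so the polynomial weight in the
  hypothesis is worth at least \<open>T ^ q\<close>; the Cauchy profile that remains integrates to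
  \<open>pi\<close>.\<close>

lemma truncation_error:
  fixes F :: "real \<Rightarrow> real"
  assumes F: "integrable lborel F" and b: "\<And>x. (1 + \<bar>x\<bar>) ^ q * \<bar>F x\<bar> \<le> B / (1 + x\<^sup>2)"
    and "B \<ge> 0" "T > 0" "U \<le> - T" "T \<le> V"
  shows "\<bar>(\<integral>x. F x * indicator {U..V} x \<partial>lborel) - (\<integral>x. F x \<partial>lborel)\<bar> \<le> B * pi / T ^ q"
proof -
  have i: "integrable lborel (\<lambda>x. F x * indicator {U..V} x)"
    by (rule integrable_mult_indicator[of "{U..V}" lborel F, simplified mult.commute[of _ "F _"] real_scaleR_def])
       (use F in auto)
  have "\<bar>(\<integral>x. F x * indicator {U..V} x \<partial>lborel) - (\<integral>x. F x \<partial>lborel)\<bar>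
      = \<bar>\<integral>x. F x * indicator {U..V} x - F x \<partial>lborel\<bar>"
    using F i by simp
  also have "\<dots> \<le> (\<integral>x. \<bar>F x * indicator {U..V} x - F x\<bar> \<partial>lborel)"
    by (rule integral_abs_bound)
  also have "\<dots> \<le> (\<integral>x. (B / T ^ q) * (1 / (1 + x\<^sup>2)) \<partial>lborel)"
  proof (rule integral_mono)
    show "integrable lborel (\<lambda>x::real. (B / T ^ q) * (1 / (1 + x\<^sup>2)))"
      using lborel_integrable_inverse_1_plus_square by (rule integrable_mult_right)
    show "integrable lborel (\<lambda>x. \<bar>F x * indicator {U..V} x - F x\<bar>)" using F i by simp
    fix x :: real
    show "\<bar>F x * indicator {U..V} x - F x\<bar> \<le> B / T ^ q * (1 / (1 + x\<^sup>2))"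
    proof (cases "x \<in> {U..V}")
      case True
      then show ?thesis using assms by simp
    next
      case False
      then have "T \<le> 1 + \<bar>x\<bar>" using assms by auto
      then have "T ^ q * \<bar>F x\<bar> \<le> (1 + \<bar>x\<bar>) ^ q * \<bar>F x\<bar>"
        using assms by (intro mult_right_mono power_mono) auto
      also have "\<dots> \<le> B / (1 + x\<^sup>2)" by (rule b)
      finally have "\<bar>F x\<bar> \<le> B / (1 + x\<^sup>2) / T ^ q"
        using \<open>T > 0\<close> by (subst pos_le_divide_eq) (auto simp: mult.commute)
      then show ?thesis using False by (simp add: mult.commute)
    qed
  qed
  also have "\<dots> = B * pi / T ^ q"
    by (simp only: integral_mult_right_zero lborel_integral_inverse_1_plus_square) simp
  finally show ?thesis .
qed

section \<open>Perturbed weights and the Laplace estimate on a lattice\<close>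

lemma abs_exp_minus_one_le: "\<bar>exp x - 1\<bar> \<le> \<bar>x\<bar> * exp \<bar>x\<bar>" for x :: real
proof (cases "x \<ge> 0")
  case True
  have "1 - x \<le> exp (- x)" using exp_ge_add_one_self[of "- x"] by simp
  then have "exp x * (1 - x) \<le> exp x * exp (- x)" by (intro mult_left_mono) auto
  also have "exp x * exp (- x) = 1" by (simp flip: exp_add)
  finally have "exp x * (1 - x) \<le> 1" .
  then show ?thesis using True by (simp add: algebra_simps)
next
  case False
  have "1 + x \<le> exp x" by (rule exp_ge_add_one_self)
  moreover have "- x * 1 \<le> - x * exp (- x)" using False by (intro mult_left_mono) auto
  moreover have "\<bar>exp x - 1\<bar> = 1 - exp x" using False by simp
  ultimately have "\<bar>exp x - 1\<bar> \<le> - x * exp (- x)" by linarith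
  then show ?thesis using False by simp
qed

text \<open>\<open>E\<close> is estimated twice: \<open>small\<close> supplies the factor
  \<open>1 / \<nu> ^ q\<close>, while \<open>large\<close> bounds \<open>exp |E|\<close> by a
  constant times \<open>exp (\<kappa> / 2 * y ^ (2 * m))\<close>, so that half of the decay
  survives. The two are combined through \<open>|exp E - 1| <= |E| * exp |E|\<close>.\<close>

lemma perturbed_weight_error:
  fixes \<kappa> C0 \<delta> t \<nu> E :: real
  assumes "\<kappa> > 0" "C0 \<ge> 0" "1 \<le> q" "q \<le> 2 * m" "0 < \<delta>" "\<delta> \<le> 1" "C0 * \<delta> ^ q \<le> \<kappa> / 2"
    and "\<nu> \<ge> 1" "\<bar>t\<bar> \<le> \<delta>"
    and E: "\<bar>E\<bar> \<le> C0 * (\<nu> ^ (2 * m) * \<bar>t\<bar> ^ (2 * m + q) + \<bar>t\<bar> ^ q + 1 / \<nu> ^ (2 * m))"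
  defines "y \<equiv> \<nu> * t"
  shows "\<bar>exp (- \<kappa> * y ^ (2 * m) + E) - exp (- \<kappa> * y ^ (2 * m))\<bar>
    \<le> 3 * C0 * exp (\<kappa> / 2 + C0) / \<nu> ^ q * ((1 + \<bar>y\<bar>) ^ (2 * m + q) * exp (- (\<kappa> / 2) * y ^ (2 * m)))"
proof -
  \<comment> \<open>Powers of \<open>t\<close> become powers of \<open>y\<close> over powers of
    \<open>\<nu>\<close>; the facts \<open>1\<close>, \<open>2\<close> and \<open>3\<close> then
    bring the three terms of the bound on \<open>E\<close> to one common form, which explains the
    constant 3.\<close>
  have y: "\<bar>t\<bar> ^ j = \<bar>y\<bar> ^ j / \<nu> ^ j" for j
    using \<open>\<nu> \<ge> 1\<close> by (simp add: y_def abs_mult power_mult_distrib)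
  have "\<nu> ^ (2 * m) * \<bar>t\<bar> ^ (2 * m + q) = \<bar>y\<bar> ^ (2 * m + q) / \<nu> ^ q"
    using \<open>\<nu> \<ge> 1\<close> by (simp add: y power_add)
  also have "\<dots> \<le> (1 + \<bar>y\<bar>) ^ (2 * m + q) / \<nu> ^ q"
    using \<open>\<nu> \<ge> 1\<close> by (intro divide_right_mono power_mono) auto
  finally have 1: "\<nu> ^ (2 * m) * \<bar>t\<bar> ^ (2 * m + q) \<le> (1 + \<bar>y\<bar>) ^ (2 * m + q) / \<nu> ^ q" .
  have "\<bar>y\<bar> ^ q \<le> (1 + \<bar>y\<bar>) ^ q" by (intro power_mono) auto
  also have "\<dots> \<le> (1 + \<bar>y\<bar>) ^ (2 * m + q)" by (intro power_increasing) auto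
  finally have 2: "\<bar>t\<bar> ^ q \<le> (1 + \<bar>y\<bar>) ^ (2 * m + q) / \<nu> ^ q"
    using \<open>\<nu> \<ge> 1\<close> by (simp add: y divide_right_mono)
  have "1 / \<nu> ^ (2 * m) \<le> 1 / \<nu> ^ q"
    using \<open>\<nu> \<ge> 1\<close> \<open>q \<le> 2 * m\<close> by (intro divide_left_mono power_increasing) auto
  also have "\<dots> \<le> (1 + \<bar>y\<bar>) ^ (2 * m + q) / \<nu> ^ q"
    using \<open>\<nu> \<ge> 1\<close> by (intro divide_right_mono one_le_power) auto
  finally have 3: "1 / \<nu> ^ (2 * m) \<le> (1 + \<bar>y\<bar>) ^ (2 * m + q) / \<nu> ^ q" .
  have "C0 * (\<nu> ^ (2 * m) * \<bar>t\<bar> ^ (2 * m + q) + \<bar>t\<bar> ^ q + 1 / \<nu> ^ (2 * m)) \<le> C0 * (3 * ((1 + \<bar>y\<bar>) ^ (2 * m + q) / \<nu> ^ q))"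
    using 1 2 3 \<open>C0 \<ge> 0\<close> by (intro mult_left_mono) linarith+
  also have "\<dots> = 3 * C0 / \<nu> ^ q * (1 + \<bar>y\<bar>) ^ (2 * m + q)" by (simp only: times_divide_eq_left times_divide_eq_right mult_ac)
  finally have small: "\<bar>E\<bar> \<le> 3 * C0 / \<nu> ^ q * (1 + \<bar>y\<bar>) ^ (2 * m + q)" using E by linarith
  \<comment> \<open>Here \<open>q\<close> of the powers of \<open>t\<close> are spent on
    \<open>C0 * \<delta> ^ q <= \<kappa> / 2\<close>, which leaves exactly half of the decay
    rate.\<close>
  have "C0 * (\<nu> ^ (2 * m) * \<bar>t\<bar> ^ (2 * m + q)) = C0 * \<bar>t\<bar> ^ q * y ^ (2 * m)"
    using \<open>\<nu> \<ge> 1\<close> by (simp add: y_def power_add power_mult_distrib power_even_abs)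
  also have "\<dots> \<le> C0 * \<delta> ^ q * y ^ (2 * m)"
    using assms by (intro mult_right_mono mult_left_mono power_mono) auto
  also have "\<dots> \<le> \<kappa> / 2 * y ^ (2 * m)" using assms by (intro mult_right_mono) auto
  finally have i: "C0 * (\<nu> ^ (2 * m) * \<bar>t\<bar> ^ (2 * m + q)) \<le> \<kappa> / 2 * y ^ (2 * m)" .
  have "C0 * \<bar>t\<bar> ^ q \<le> C0 * \<delta> ^ q" using assms by (intro mult_left_mono power_mono) auto
  then have ii: "C0 * \<bar>t\<bar> ^ q \<le> \<kappa> / 2" using assms by linarith
  have "C0 * (1 / \<nu> ^ (2 * m)) \<le> C0 * 1"
    using assms by (intro mult_left_mono) auto
  then have large: "\<bar>E\<bar> \<le> \<kappa> / 2 * y ^ (2 * m) + (\<kappa> / 2 + C0)"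
    using i ii E by (simp add: distrib_left)
  have "exp (- \<kappa> * y ^ (2 * m) + E) - exp (- \<kappa> * y ^ (2 * m)) = exp (- \<kappa> * y ^ (2 * m)) * (exp E - 1)"
    unfolding exp_add by (simp add: right_diff_distrib)
  then have "\<bar>exp (- \<kappa> * y ^ (2 * m) + E) - exp (- \<kappa> * y ^ (2 * m))\<bar> = exp (- \<kappa> * y ^ (2 * m)) * \<bar>exp E - 1\<bar>"
    by (simp only: abs_mult abs_exp_cancel)
  also have "\<dots> \<le> exp (- \<kappa> * y ^ (2 * m)) * (\<bar>E\<bar> * exp \<bar>E\<bar>)"
    by (intro mult_left_mono abs_exp_minus_one_le) auto
  also have "\<dots> \<le> exp (- \<kappa> * y ^ (2 * m)) *
      ((3 * C0 / \<nu> ^ q * (1 + \<bar>y\<bar>) ^ (2 * m + q)) * exp (\<kappa> / 2 * y ^ (2 * m) + (\<kappa> / 2 + C0)))"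
    using small large assms by (intro mult_left_mono mult_mono) auto
  also have "\<dots> = 3 * C0 / \<nu> ^ q * (1 + \<bar>y\<bar>) ^ (2 * m + q) *
      (exp (- \<kappa> * y ^ (2 * m)) * exp (\<kappa> / 2 * y ^ (2 * m) + (\<kappa> / 2 + C0)))" by simp
  also have "exp (- \<kappa> * y ^ (2 * m)) * exp (\<kappa> / 2 * y ^ (2 * m) + (\<kappa> / 2 + C0))
      = exp (\<kappa> / 2 + C0) * exp (- (\<kappa> / 2) * y ^ (2 * m))"
    by (simp flip: exp_add)
  finally show ?thesis by (simp add: mult_ac)
qed

text \<open>Rounding moves an end point by at most one index, and \<open>n >= 4 / \<delta>\<close>
  makes one index no more than \<open>n * \<delta> / 4\<close>. The range is half open, with
  \<open>j\<close> the first index beyond the window, so that its cells cover the interval from node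
  \<open>i\<close> to node \<open>j\<close>; this interval contains all \<open>t\<close> with
  \<open>|t| <= \<delta> / 2\<close>.\<close>

lemma lattice_window_interval:
  fixes a \<delta> :: real and n :: nat
  assumes n: "n \<ge> 1" "real n \<ge> 4 / \<delta>" and d: "0 < \<delta>" "\<delta> \<le> 2 * a" "\<delta> \<le> 2 * (1 - a)"
  obtains i j where "i \<le> j" "{k. k \<le> n \<and> \<bar>2 * (real k / real n - a)\<bar> \<le> \<delta>} = {i..<j}"
    "2 * (real i / real n - a) \<le> - \<delta> / 2" "\<delta> / 2 \<le> 2 * (real j / real n - a)"
proof -
  define L U where "L = real n * (a - \<delta> / 2)" and "U = real n * (a + \<delta> / 2)"
  define i j where "i = nat \<lceil>L\<rceil>" and "j = nat \<lfloor>U\<rfloor> + 1"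
  have n0: "real n > 0" using n by simp
  have "0 \<le> L" using d n0 by (simp add: L_def)
  have "real n * (a + \<delta> / 2) \<le> real n * 1" using d n0 by (intro mult_left_mono) auto
  then have "U \<le> real n" by (simp add: U_def)
  have "4 \<le> real n * \<delta>" using n d by (simp add: field_simps)
  then have "L + 4 \<le> U" by (simp add: L_def U_def algebra_simps)
  have i: "i \<le> k \<longleftrightarrow> L \<le> real k" for k unfolding i_def by linarith
  have j: "k < j \<longleftrightarrow> real k \<le> U" for k unfolding j_def using \<open>0 \<le> L\<close> \<open>L + 4 \<le> U\<close> by linarith
  have win: "\<bar>2 * (real k / real n - a)\<bar> \<le> \<delta> \<longleftrightarrow> L \<le> real k \<and> real k \<le> U" for k
    using n0 by (simp add: L_def U_def abs_le_iff field_simps) linarith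
  have "{k. k \<le> n \<and> \<bar>2 * (real k / real n - a)\<bar> \<le> \<delta>} = {i..<j}"
    using \<open>U \<le> real n\<close> unfolding set_eq_iff mem_Collect_eq atLeastLessThan_iff win i j by auto
  moreover have "real i \<le> L + 1" "U \<le> real j" 
    unfolding i_def j_def using \<open>0 \<le> L\<close> \<open>L + 4 \<le> U\<close> by linarith+
  moreover from this have "i \<le> j" using \<open>L + 4 \<le> U\<close> by linarith
  moreover have "2 * (real i / real n - a) \<le> - \<delta> / 2"
  proof -
    have "real i \<le> real n * (a - \<delta> / 4)"
      using \<open>real i \<le> L + 1\<close> \<open>4 \<le> real n * \<delta>\<close> by (simp add: L_def algebra_simps)
    then have "real i / real n \<le> a - \<delta> / 4" using n0 by (simp add: field_simps)
    then show ?thesis by simp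
  qed
  moreover have "\<delta> / 2 \<le> 2 * (real j / real n - a)"
  proof -
    have "a + \<delta> / 2 \<le> real j / real n" using \<open>U \<le> real j\<close> n0 by (simp add: U_def field_simps)
    then show ?thesis using d by simp
  qed
  ultimately show ?thesis using that by blast
qed

lemma antiderivative_exists:
  fixes F :: "real \<Rightarrow> real"
  assumes "\<And>x. isCont F x"
  obtains \<Phi> where "\<And>x. (\<Phi> has_real_derivative F x) (at x)"
proof -
  have "\<exists>\<Phi>. \<forall>x::real. - \<infinity> < ereal x \<longrightarrow> ereal x < \<infinity> \<longrightarrow> (\<Phi> has_vector_derivative F x) (at x)"
    using assms by (intro einterval_antiderivative) auto
  then show ?thesis using that by (auto simp: has_real_derivative_iff_has_vector_derivative)
qed

text \<open>Three errors are added: perturbed weights against exact ones, the Riemann sum against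
  the integral between the end nodes, and that integral against the one over the whole line. Only
  the local form of the weights matters, so \<open>w\<close> and \<open>K\<close> are kept abstract.
  \<open>C\<close> depends neither on \<open>n\<close> nor on \<open>\<phi>\<close>.\<close>

lemma lattice_laplace:
  fixes w :: "nat \<Rightarrow> nat \<Rightarrow> real" and K :: "nat \<Rightarrow> real" and a \<delta> \<kappa> C0 :: real
  assumes m: "m \<ge> 1" "1 \<le> q" "q < 2 * m" and \<kappa>: "\<kappa> > 0" and C0: "C0 \<ge> 0"
    and \<delta>: "0 < \<delta>" "\<delta> \<le> 1" "\<delta> \<le> 2 * a" "\<delta> \<le> 2 * (1 - a)" "C0 * \<delta> ^ q \<le> \<kappa> / 2"
    and K: "\<And>n. n \<ge> 1 \<Longrightarrow> K n > 0"
    and w: "\<And>n k t. n \<ge> 1 \<Longrightarrow> k \<le> n \<Longrightarrow> t = 2 * (real k / real n - a) \<Longrightarrow> \<bar>t\<bar> \<le> \<delta> \<Longrightarrow>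
      \<exists>E. w n k = K n * exp (- \<kappa> * (real n * t ^ (2 * m)) + E) \<and>
          \<bar>E\<bar> \<le> C0 * (real n * \<bar>t\<bar> ^ (2 * m + q) + \<bar>t\<bar> ^ q + 1 / real n)"
  shows "\<exists>C\<ge>0. \<forall>n \<nu> \<phi>. real n \<ge> 4 / \<delta> \<longrightarrow> \<nu> > 0 \<longrightarrow> \<nu> ^ (2 * m) = real n \<longrightarrow> unit_slope \<phi> \<longrightarrow> \<bar>\<phi> 0\<bar> \<le> 1 \<longrightarrow>
    \<bar>2 * \<nu> / real n * (\<Sum>k | k \<le> n \<and> \<bar>2 * (real k / real n - a)\<bar> \<le> \<delta>. \<phi> (\<nu> * (2 * (real k / real n - a))) * (w n k / K n))
       - (\<integral>x. \<phi> x * exp (- \<kappa> * x ^ (2 * m)) \<partial>lborel)\<bar> \<le> C / \<nu> ^ q"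
proof -
  obtain B where B: "B > 0"
    "\<And>\<phi> x. unit_slope \<phi> \<Longrightarrow> \<bar>\<phi> 0\<bar> \<le> 1 \<Longrightarrow> (1 + \<bar>x\<bar>) ^ q * \<bar>\<phi> x * exp (- \<kappa> * x ^ (2 * m))\<bar> \<le> B / (1 + x\<^sup>2)"
    "\<And>\<phi> x y. unit_slope \<phi> \<Longrightarrow> \<bar>\<phi> 0\<bar> \<le> 1 \<Longrightarrow> x \<le> y \<Longrightarrow>
       \<bar>\<phi> y * exp (- \<kappa> * y ^ (2 * m)) - \<phi> x * exp (- \<kappa> * x ^ (2 * m))\<bar> \<le> B * (arctan y - arctan x)"
    by (rule unit_slope_damped_bounds[OF \<kappa> m(1), of q]) (rule that)
  have "\<kappa> / 2 > 0" using \<kappa> by simp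
  \<comment> \<open>The exponent \<open>2 * m + q\<close> comes from
    \<open>perturbed_weight_error\<close>, the additional 1 from the linear growth of
    \<open>\<phi>\<close>.\<close>
  then obtain B1 where B1: "B1 > 0"
    "\<And>x::real. (1 + \<bar>x\<bar>) ^ (2 * m + q + 1) * exp (- (\<kappa> / 2) * x ^ (2 * m)) \<le> B1 / (1 + x\<^sup>2)"
    using exp_even_power_decay[of "\<kappa> / 2" m "2 * m + q + 1"] m by blast
  define C1 where "C1 = 3 * C0 * exp (\<kappa> / 2 + C0)"
  have "C1 \<ge> 0" using C0 by (simp add: C1_def)
  \<comment> \<open>The summands belong to \<open>I\<close> (weights), \<open>II\<close> (Riemann
    sum) and \<open>III\<close> (truncation at distance
    \<open>\<nu> * (\<delta> / 2)\<close>).\<close>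
  define C where "C = 9 * pi * (C1 * B1) + 2 * B * pi + B * pi * (2 / \<delta>) ^ q"
  have "\<bar>2 * \<nu> / real n * (\<Sum>k | k \<le> n \<and> \<bar>2 * (real k / real n - a)\<bar> \<le> \<delta>. \<phi> (\<nu> * (2 * (real k / real n - a))) * (w n k / K n))
       - (\<integral>x. \<phi> x * exp (- \<kappa> * x ^ (2 * m)) \<partial>lborel)\<bar> \<le> C / \<nu> ^ q"
    if n: "real n \<ge> 4 / \<delta>" and \<nu>: "\<nu> > 0" "\<nu> ^ (2 * m) = real n" and \<phi>: "unit_slope \<phi>" "\<bar>\<phi> 0\<bar> \<le> 1" for n \<nu> \<phi>
  proof -
    have "4 / \<delta> > 0" using \<delta> by simp
    then have n1: "n \<ge> 1" using n by (cases n) auto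
    then have n0: "real n > 0" by simp
    have \<nu>1: "\<nu> \<ge> 1"
    proof (rule ccontr)
      assume "\<not> \<nu> \<ge> 1"
      then have "\<nu> ^ (2 * m) < 1" using \<nu> m by (intro power_less_one_iff[THEN iffD2]) auto
      then show False using \<nu> n1 by simp
    qed
    define \<eta> where "\<eta> = 2 * \<nu> / real n"
    have \<eta>0: "\<eta> > 0" using \<nu> n0 by (simp add: \<eta>_def)
    have \<eta>: "\<eta> = 2 / \<nu> ^ (2 * m - 1)"
    proof -
      have "real n = \<nu> * \<nu> ^ (2 * m - 1)"
        using power_minus_mult[of "2 * m" \<nu>] m \<nu>(2) by (simp add: mult.commute)
      then show ?thesis using \<nu>(1) unfolding \<eta>_def by simp
    qed
    \<comment> \<open>By \<open>q < 2 * m\<close> the mesh is no coarser than the error aimed at;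
      the consequence \<open>\<eta> <= 2\<close> is what
      \<open>lattice_sum_inverse_square_le\<close> asks for.\<close>
    have \<eta>q: "\<eta> \<le> 2 / \<nu> ^ q"
      unfolding \<eta> using \<nu>1 m by (intro divide_left_mono power_increasing) auto
    also have "\<dots> \<le> 2" using one_le_power[OF \<nu>1, of q] by (simp add: divide_le_eq)
    finally have \<eta>2: "\<eta> \<le> 2" .
    define u where "u k = \<nu> * (2 * (real k / real n - a))" for k :: nat
    have u: "u (Suc k) = u k + \<eta>" for k
      using n0 by (simp add: u_def \<eta>_def field_simps)
    obtain i j where ij: "i \<le> j" and win: "{k. k \<le> n \<and> \<bar>2 * (real k / real n - a)\<bar> \<le> \<delta>} = {i..<j}"
      and ti: "2 * (real i / real n - a) \<le> - \<delta> / 2" and tj: "\<delta> / 2 \<le> 2 * (real j / real n - a)"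
      using lattice_window_interval[OF n1 n \<delta>(1,3,4)] by blast
    define F where "F x = \<phi> x * exp (- \<kappa> * x ^ (2 * m))" for x
    have contF: "isCont F x" for x
      unfolding F_def by (intro continuous_intros DERIV_isCont[OF unit_slope_has_derivative[OF \<phi>(1)]])
    obtain \<Phi> where \<Phi>: "\<And>x. (\<Phi> has_real_derivative F x) (at x)"
      using antiderivative_exists[of F] contF by blast
    have intF: "integrable lborel F"
      unfolding F_def by (rule unit_slope_damped_integrable[OF \<kappa> m(1) \<phi>])
    have uu: "u i \<le> - (\<nu> * (\<delta> / 2))" "\<nu> * (\<delta> / 2) \<le> u j"
      using mult_left_mono[OF ti, of \<nu>] mult_left_mono[OF tj, of \<nu>] \<nu> by (simp_all add: u_def)
    have pos: "\<nu> * (\<delta> / 2) > 0" using \<nu> \<delta> by simp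

    have point: "\<bar>\<phi> (u k) * (w n k / K n) - F (u k)\<bar> \<le> C1 * B1 / \<nu> ^ q * (1 / (1 + (u k)\<^sup>2))" if k: "k \<in> {i..<j}" for k
    proof -
      define t where "t = 2 * (real k / real n - a)"
      have kt: "k \<le> n" "\<bar>t\<bar> \<le> \<delta>" using k unfolding win[symmetric] t_def by auto
      have ut: "u k = \<nu> * t" by (simp add: u_def t_def)
      obtain E where E: "w n k = K n * exp (- \<kappa> * (real n * t ^ (2 * m)) + E)"
          "\<bar>E\<bar> \<le> C0 * (real n * \<bar>t\<bar> ^ (2 * m + q) + \<bar>t\<bar> ^ q + 1 / real n)"
        using w[OF n1 kt(1) t_def kt(2)] by blast
      have wK: "w n k / K n = exp (- \<kappa> * (u k) ^ (2 * m) + E)"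
        using E(1) K[OF n1] by (simp add: ut power_mult_distrib \<nu>(2))
      let ?G = "(1 + \<bar>u k\<bar>) ^ (2 * m + q) * exp (- (\<kappa> / 2) * (u k) ^ (2 * m))"
      have "\<bar>exp (- \<kappa> * (u k) ^ (2 * m) + E) - exp (- \<kappa> * (u k) ^ (2 * m))\<bar> \<le> C1 / \<nu> ^ q * ?G"
        unfolding C1_def ut
        using E(2) by (intro perturbed_weight_error[OF \<kappa> C0 m(2) _ \<delta>(1,2,5) \<nu>1 kt(2)]) (use m \<nu> in auto)
      then have "\<bar>\<phi> (u k)\<bar> * \<bar>w n k / K n - exp (- \<kappa> * (u k) ^ (2 * m))\<bar> \<le> (1 + \<bar>u k\<bar>) * (C1 / \<nu> ^ q * ?G)"
        unfolding wK using unit_slope_growth[OF \<phi>] by (intro mult_mono) auto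
      also have "\<dots> = C1 / \<nu> ^ q * ((1 + \<bar>u k\<bar>) ^ (2 * m + q + 1) * exp (- (\<kappa> / 2) * (u k) ^ (2 * m)))"
        by simp
      also have "\<dots> \<le> C1 / \<nu> ^ q * (B1 / (1 + (u k)\<^sup>2))"
        using B1 \<open>C1 \<ge> 0\<close> \<nu> by (intro mult_left_mono) auto
      also have "\<dots> = C1 * B1 / \<nu> ^ q * (1 / (1 + (u k)\<^sup>2))" by simp
      finally show ?thesis
        unfolding F_def abs_mult[symmetric] right_diff_distrib .
    qed
    have "\<bar>\<eta> * (\<Sum>k\<in>{i..<j}. \<phi> (u k) * (w n k / K n)) - \<eta> * (\<Sum>k\<in>{i..<j}. F (u k))\<bar>
        = \<eta> * \<bar>\<Sum>k\<in>{i..<j}. \<phi> (u k) * (w n k / K n) - F (u k)\<bar>"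
      using \<eta>0 by (simp add: sum_subtractf abs_mult flip: right_diff_distrib)
    also have "\<dots> \<le> \<eta> * (\<Sum>k\<in>{i..<j}. C1 * B1 / \<nu> ^ q * (1 / (1 + (u k)\<^sup>2)))"
      using \<eta>0 by (intro mult_left_mono order_trans[OF sum_abs] sum_mono point) auto
    also have "\<dots> = C1 * B1 / \<nu> ^ q * (\<eta> * (\<Sum>k\<in>{i..<j}. 1 / (1 + (u k)\<^sup>2)))"
      by (simp add: sum_distrib_left mult_ac)
    also have "\<dots> \<le> C1 * B1 / \<nu> ^ q * (9 * pi)"
      using B1 \<open>C1 \<ge> 0\<close> \<nu> by (intro mult_left_mono lattice_sum_inverse_square_le[where u = u, OF \<eta>0 \<eta>2 ij u]) auto
    also have "\<dots> = 9 * pi * (C1 * B1) / \<nu> ^ q" by simp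
    finally have I: "\<bar>\<eta> * (\<Sum>k\<in>{i..<j}. \<phi> (u k) * (w n k / K n)) - \<eta> * (\<Sum>k\<in>{i..<j}. F (u k))\<bar>
        \<le> 9 * pi * (C1 * B1) / \<nu> ^ q" .
    have "\<bar>\<eta> * (\<Sum>k\<in>{i..<j}. F (u k)) - (\<Phi> (u j) - \<Phi> (u i))\<bar> \<le> \<eta> * B * pi"
      using B(3)[OF \<phi>] B(1) by (intro riemann_sum_antiderivative[where u = u, OF \<Phi> _ _ \<eta>0 ij u]) (auto simp: F_def)
    also have "\<dots> \<le> 2 / \<nu> ^ q * B * pi" using \<eta>q B(1) by (intro mult_right_mono) auto
    finally have II: "\<bar>\<eta> * (\<Sum>k\<in>{i..<j}. F (u k)) - (\<Phi> (u j) - \<Phi> (u i))\<bar> \<le> 2 * B * pi / \<nu> ^ q" by simp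
    have "(\<integral>x. F x * indicator {u i..u j} x \<partial>lborel) = \<Phi> (u j) - \<Phi> (u i)"
      using uu pos by (intro integral_FTC_Icc_real \<Phi> contF) linarith
    moreover have "\<bar>(\<integral>x. F x * indicator {u i..u j} x \<partial>lborel) - (\<integral>x. F x \<partial>lborel)\<bar> \<le> B * pi / (\<nu> * (\<delta> / 2)) ^ q"
      using B(1) B(2)[OF \<phi>] uu pos by (intro truncation_error[OF intF]) (auto simp: F_def)
    moreover have "B * pi / (\<nu> * (\<delta> / 2)) ^ q = B * pi * (2 / \<delta>) ^ q / \<nu> ^ q"
      using \<nu> \<delta> by (simp add: power_mult_distrib power_divide field_simps)
    ultimately have III: "\<bar>(\<Phi> (u j) - \<Phi> (u i)) - (\<integral>x. F x \<partial>lborel)\<bar> \<le> B * pi * (2 / \<delta>) ^ q / \<nu> ^ q" by simp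
    have "\<bar>\<eta> * (\<Sum>k\<in>{i..<j}. \<phi> (u k) * (w n k / K n)) - (\<integral>x. F x \<partial>lborel)\<bar> \<le> C / \<nu> ^ q"
      using I II III unfolding C_def add_divide_distrib by linarith
    then show ?thesis unfolding win u_def[symmetric] \<eta>_def[symmetric] F_def[symmetric] .
  qed
  note bound = this
  have "C \<ge> 0" using \<open>C1 \<ge> 0\<close> B(1) B1(1) \<delta> by (simp add: C_def)
  show ?thesis by (intro exI[of _ C] conjI allI impI \<open>C \<ge> 0\<close>) (rule bound)
qed

section \<open>Binomial coefficients and entropy\<close>

text \<open>Its limit \<open>ln (2 pi) / 2\<close> is never needed: the factor \<open>exp (- stirling_rem n)\<close> does not depend on
  the number of plus spins and cancels on normalization.\<close>
definition stirling_rem :: "nat \<Rightarrow> real" where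
  "stirling_rem n = ln (fact n) - (real n + 1 / 2) * ln (real n) + real n"

text \<open>Both sides vanish at 0, and the derivatives differ by
  \<open>x^2 / ((1 + x) (2 + x)^2)\<close>. At \<open>x = 1 / n\<close> the left side is
  \<open>1 / (n + 1 / 2)\<close>, the reciprocal of the factor in \<open>stirling_rem\<close>; this
  is what makes \<open>stirling_rem\<close> decrease.\<close>

lemma ln_one_plus_ge_pade:
  assumes "x \<ge> (0::real)"
  shows "2 * x / (2 + x) \<le> ln (1 + x)"
proof -
  have "ln (1 + 0) - 2 * 0 / (2 + 0) \<le> ln (1 + x) - 2 * x / (2 + x)"
  proof (rule DERIV_nonneg_imp_nondecreasing[OF assms])
    fix z :: real assume z: "0 \<le> z" "z \<le> x"
    have "((\<lambda>x. ln (1 + x) - 2 * x / (2 + x)) has_real_derivative 1 / (1 + z) - (2 * (2 + z) - 2 * z) / ((2 + z) * (2 + z))) (at z)"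
      using z by (auto intro!: derivative_eq_intros simp: power2_eq_square)
    moreover have "(2 * (2 + z) - 2 * z) / ((2 + z) * (2 + z)) \<le> 1 / (1 + z)"
      using z by (simp add: divide_simps) (simp add: algebra_simps)
    ultimately show "\<exists>u. ((\<lambda>x. ln (1 + x) - 2 * x / (2 + x)) has_real_derivative u) (at z) \<and> 0 \<le> u"
      by (intro exI conjI) auto
  qed
  then show ?thesis by simp
qed

text \<open>The right side is the trapezoidal rule for the integral of \<open>1 / t\<close> over
  \<open>[1, 1 + x]\<close>, an overestimate because the integrand is convex.\<close>

lemma ln_one_plus_le_trapezoid:
  assumes "x \<ge> (0::real)"
  shows "ln (1 + x) \<le> ((1 + x) - 1 / (1 + x)) / 2"
proof -
  have "((1 + 0) - 1 / (1 + 0)) / 2 - ln (1 + 0) \<le> ((1 + x) - 1 / (1 + x)) / 2 - ln (1 + x)"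
  proof (rule DERIV_nonneg_imp_nondecreasing[OF assms])
    fix z :: real assume z: "0 \<le> z" "z \<le> x"
    have "((\<lambda>x. ((1 + x) - 1 / (1 + x)) / 2 - ln (1 + x)) has_real_derivative (1 + 1 / ((1 + z) * (1 + z))) / 2 - 1 / (1 + z)) (at z)"
      using z by (auto intro!: derivative_eq_intros simp: power2_eq_square)
    moreover have "(1 + 1 / ((1 + z) * (1 + z))) / 2 - 1 / (1 + z) = (1 - 1 / (1 + z))\<^sup>2 / 2"
    proof -
      have "(1 + w * w) / 2 - w = (1 - w)\<^sup>2 / 2" for w :: real
        by (simp add: power2_eq_square field_simps)
      from this[of "1 / (1 + z)"] show ?thesis by simp
    qed
    ultimately show "\<exists>u. ((\<lambda>x. ((1 + x) - 1 / (1 + x)) / 2 - ln (1 + x)) has_real_derivative u) (at z) \<and> 0 \<le> u"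
      by (intro exI conjI) auto
  qed
  then show ?thesis by simp
qed

text \<open>The step equals \<open>(n + 1 / 2) * ln (1 + 1 / n) - 1\<close>. Its upper bound is
  written as a difference so that sums over n telescope.\<close>

lemma stirling_rem_step:
  assumes "n \<ge> 1"
  shows "0 \<le> stirling_rem n - stirling_rem (Suc n)"
    "stirling_rem n - stirling_rem (Suc n) \<le> (1 / real n - 1 / real (Suc n)) / 4"
proof -
  have n: "real n > 0" using assms by simp
  have "real (Suc n) = real n * (1 + 1 / real n)" using n by (simp add: distrib_left)
  then have "ln (real (Suc n)) = ln (real n * (1 + 1 / real n))" by (rule arg_cong)
  also have "\<dots> = ln (real n) + ln (1 + 1 / real n)" using n by (intro ln_mult_pos add_pos_nonneg) auto
  finally have l: "ln (real (Suc n)) = ln (real n) + ln (1 + 1 / real n)" .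
  have f: "ln (fact (Suc n) :: real) = ln (real (Suc n)) + ln (fact n)"
    by (simp only: fact_Suc of_nat_mult) (subst ln_mult; simp)
  have eq: "stirling_rem n - stirling_rem (Suc n) = (real n + 1 / 2) * ln (1 + 1 / real n) - 1"
    unfolding stirling_rem_def f l by (simp add: algebra_simps)
  have "2 * (1 / real n) / (2 + 1 / real n) = 1 / (real n + 1 / 2)" using n by (simp add: field_simps)
  then have "1 / (real n + 1 / 2) \<le> ln (1 + 1 / real n)"
    using ln_one_plus_ge_pade[of "1 / real n"] n by simp
  then have "(real n + 1 / 2) * (1 / (real n + 1 / 2)) \<le> (real n + 1 / 2) * ln (1 + 1 / real n)"
    using n by (intro mult_left_mono) auto
  then show "0 \<le> stirling_rem n - stirling_rem (Suc n)" unfolding eq using n by simp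
  have "(real n + 1 / 2) * ln (1 + 1 / real n) \<le> (real n + 1 / 2) * (((1 + 1 / real n) - 1 / (1 + 1 / real n)) / 2)"
    using n by (intro mult_left_mono ln_one_plus_le_trapezoid) auto
  also have "\<dots> = 1 + (1 / real n - 1 / real (Suc n)) / 4"
    using n by (simp add: divide_simps) (simp add: algebra_simps)
  finally show "stirling_rem n - stirling_rem (Suc n) \<le> (1 / real n - 1 / real (Suc n)) / 4" unfolding eq by linarith
qed

lemma stirling_rem_diff:
  assumes "1 \<le> k" "k \<le> n"
  shows "0 \<le> stirling_rem k - stirling_rem n \<and> stirling_rem k - stirling_rem n \<le> (1 / real k - 1 / real n) / 4"
  using assms(2)
proof (induction n rule: dec_induct)
  case (step j)
  then have "j \<ge> 1" using assms by simp
  then show ?case using stirling_rem_step[of j] step.IH by argo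
qed simp

text \<open>An exact identity: the square-root prefactor of Stirling's formula gives the logarithmic
  terms, and the whole error is kept in the three \<open>stirling_rem\<close> terms.\<close>

lemma binomial_entropy_expansion:
  assumes "0 < k" "k < n"
  defines "x \<equiv> real k / real n"
  shows "real (n choose k) = exp (real n * entropy_I x - ln (real n) / 2 - (ln x + ln (1 - x)) / 2
    + (stirling_rem n - stirling_rem k - stirling_rem (n - k)))"
proof -
  have n: "real n > 0" "real k > 0" "real (n - k) > 0" using assms by auto
  have x: "0 < x" "x < 1" using assms by (auto simp: x_def)
  have k: "real k = real n * x" using n by (simp add: x_def)
  have nk: "real (n - k) = real n * (1 - x)" using assms k by (simp add: of_nat_diff algebra_simps)
  have lk: "ln (real k) = ln (real n) + ln x" unfolding k using n x by (subst ln_mult) auto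
  have lnk: "ln (real (n - k)) = ln (real n) + ln (1 - x)" unfolding nk using n x by (subst ln_mult) auto
  have fct: "ln (fact j) = stirling_rem j + (real j + 1 / 2) * ln (real j) - real j" for j
    by (simp add: stirling_rem_def)
  have "real (n choose k) = fact n / (fact k * fact (n - k))"
    using assms by (intro binomial_fact) simp
  moreover have "real (n choose k) > 0" using assms by simp
  ultimately have "real (n choose k) = exp (ln (fact n / (fact k * fact (n - k))))" by simp
  also have "ln (fact n / (fact k * fact (n - k)) :: real) = ln (fact n) - ln (fact k) - ln (fact (n - k))"
    by (simp add: ln_div ln_mult)
  also have "\<dots> = real n * entropy_I x - ln (real n) / 2 - (ln x + ln (1 - x)) / 2
    + (stirling_rem n - stirling_rem k - stirling_rem (n - k))"
    unfolding fct lk lnk unfolding k nk entropy_I_def by (simp add: field_simps)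
  finally show ?thesis .
qed

text \<open>With \<open>x = k / n\<close>, the k-th term of the expansion of
  \<open>(x + (1 - x)) ^ n = 1\<close> is at most 1. Unlike the Stirling expansion this holds up to
  the boundary of \<open>[0, 1]\<close>.\<close>

lemma binomial_le_exp_entropy:
  assumes "k \<le> n" "n \<ge> 1"
  shows "real (n choose k) \<le> exp (real n * entropy_I (real k / real n))"
proof (cases "k = 0 \<or> k = n")
  case True
  \<comment> \<open>Both sides equal 1, as the entropy vanishes at 0 and 1.\<close>
  then show ?thesis using assms by (auto simp: entropy_I_def)
next
  case False
  define x where "x = real k / real n"
  have x: "0 < x" "x < 1" using assms False by (auto simp: x_def)
  have k: "real k = real n * x" using assms by (simp add: x_def)
  have nk: "real (n - k) = real n * (1 - x)" using assms k by (simp add: of_nat_diff algebra_simps)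
  have "real (n choose k) * x ^ k * (1 - x) ^ (n - k) \<le> (\<Sum>i\<le>n. real (n choose i) * x ^ i * (1 - x) ^ (n - i))"
    using x assms by (intro member_le_sum) auto
  also have "\<dots> = 1" using binomial_ring[of x "1 - x" n] by simp
  finally have "real (n choose k) * (x ^ k * (1 - x) ^ (n - k)) \<le> 1" by (simp add: mult.assoc)
  moreover have "x ^ k * (1 - x) ^ (n - k) = exp (- (real n * entropy_I x))"
  proof -
    have "x ^ k = exp (real k * ln x)" "(1 - x) ^ (n - k) = exp (real (n - k) * ln (1 - x))"
      using x by (simp_all add: exp_of_nat_mult)
    then have "x ^ k * (1 - x) ^ (n - k) = exp (real k * ln x + real (n - k) * ln (1 - x))"
      by (simp only: exp_add)
    also have "real k * ln x + real (n - k) * ln (1 - x) = - (real n * entropy_I x)"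
      unfolding k nk entropy_I_def by (simp add: algebra_simps)
    finally show ?thesis .
  qed
  ultimately have "real (n choose k) * exp (- (real n * entropy_I x)) \<le> 1" by metis
  then show ?thesis unfolding x_def[symmetric] by (simp add: exp_minus pos_divide_le_eq flip: divide_inverse)
qed

section \<open>Taylor expansion with a uniform remainder\<close>

text \<open>Lagrange's remainder, with the N-th derivative bounded on a compact interval.
  \<open>D\<close> covers \<open>i = N\<close> as well, so that \<open>diff N\<close> is continuous
  there.\<close>

lemma taylor_remainder_bound:
  fixes diff :: "nat \<Rightarrow> real \<Rightarrow> real"
  assumes "N > 0" and D: "\<And>i x. i \<le> N \<Longrightarrow> \<bar>x - c\<bar> \<le> \<rho> \<Longrightarrow> (diff i has_real_derivative diff (Suc i) x) (at x)"
  obtains C where "C \<ge> 0"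
    "\<And>x. \<bar>x - c\<bar> \<le> \<rho> \<Longrightarrow> \<bar>diff 0 x - (\<Sum>i<N. diff i c / fact i * (x - c) ^ i)\<bar> \<le> C * \<bar>x - c\<bar> ^ N"
proof -
  have "continuous_on {c - \<rho>..c + \<rho>} (diff N)"
    by (intro continuous_at_imp_continuous_on ballI DERIV_isCont[OF D]) (auto simp: abs_le_iff)
  then have "bounded (diff N ` {c - \<rho>..c + \<rho>})"
    by (intro compact_imp_bounded compact_continuous_image) auto
  then obtain M where M: "M > 0" "\<And>x. x \<in> {c - \<rho>..c + \<rho>} \<Longrightarrow> \<bar>diff N x\<bar> \<le> M"
    by (auto simp: bounded_pos)
  have "\<bar>diff 0 x - (\<Sum>i<N. diff i c / fact i * (x - c) ^ i)\<bar> \<le> M / fact N * \<bar>x - c\<bar> ^ N" if x: "\<bar>x - c\<bar> \<le> \<rho>" for x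
  proof (cases "x = c")
    case True
    have "(\<Sum>i<N. diff i c / fact i * (x - c) ^ i) = (\<Sum>i\<in>{0}. diff i c / fact i * (x - c) ^ i)"
      using True \<open>N > 0\<close> by (intro sum.mono_neutral_right) auto
    then show ?thesis using True M by simp
  next
    case False
    have "\<exists>t. (if x < c then x < t \<and> t < c else c < t \<and> t < x) \<and>
        diff 0 x = (\<Sum>i<N. diff i c / fact i * (x - c) ^ i) + diff N t / fact N * (x - c) ^ N"
      using x False by (intro Taylor[where a = "c - \<rho>" and b = "c + \<rho>"] \<open>N > 0\<close> refl allI impI D) (auto simp: abs_le_iff)
    then obtain t where lt: "if x < c then x < t \<and> t < c else c < t \<and> t < x" and
      t2: "diff 0 x = (\<Sum>i<N. diff i c / fact i * (x - c) ^ i) + diff N t / fact N * (x - c) ^ N"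
      by blast
    have t1: "t \<in> {c - \<rho>..c + \<rho>}" using lt x unfolding abs_le_iff by (simp split: if_splits)
    have "\<bar>diff 0 x - (\<Sum>i<N. diff i c / fact i * (x - c) ^ i)\<bar> = \<bar>diff N t\<bar> / fact N * \<bar>x - c\<bar> ^ N"
      using t2 by (simp add: abs_mult power_abs)
    also have "\<dots> \<le> M / fact N * \<bar>x - c\<bar> ^ N"
      using M(2)[OF t1] by (intro mult_right_mono divide_right_mono) auto
    finally show ?thesis .
  qed
  then show ?thesis using M(1) by (intro that[of "M / fact N"]) auto
qed

section \<open>Weights near a maximizer\<close>

text \<open>\<open>four_A_deriv\<close> iterates the total operator \<open>deriv\<close>; explicit
  tables, verified to be successive derivatives, give access to its values.\<close>

fun four_f_D :: "real \<Rightarrow> real \<Rightarrow> nat \<Rightarrow> real \<Rightarrow> real" where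
  "four_f_D \<beta> h 0 = (\<lambda>a. \<beta> * (2 * a - 1) ^ 4 + h * (2 * a - 1) ^ 2)"
| "four_f_D \<beta> h (Suc 0) = (\<lambda>a. 8 * \<beta> * (2 * a - 1) ^ 3 + 4 * h * (2 * a - 1))"
| "four_f_D \<beta> h (Suc (Suc 0)) = (\<lambda>a. 48 * \<beta> * (2 * a - 1) ^ 2 + 8 * h)"
| "four_f_D \<beta> h (Suc (Suc (Suc 0))) = (\<lambda>a. 192 * \<beta> * (2 * a - 1))"
| "four_f_D \<beta> h (Suc (Suc (Suc (Suc 0)))) = (\<lambda>a. 384 * \<beta>)"
| "four_f_D \<beta> h (Suc (Suc (Suc (Suc (Suc k))))) = (\<lambda>a. 0)"

text \<open>From order two on the entropy has rational derivatives, and the sign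
  \<open>(- 1) ^ k\<close> makes the two terms cancel at 1/2 in every odd order.\<close>

fun entropy_D :: "nat \<Rightarrow> real \<Rightarrow> real" where
  "entropy_D 0 = entropy_I"
| "entropy_D (Suc 0) = (\<lambda>a. ln (1 - a) - ln a)"
| "entropy_D (Suc (Suc k)) = (\<lambda>a. - fact k * ((- 1) ^ k / a ^ Suc k + 1 / (1 - a) ^ Suc k))"

lemma four_f_D_DERIV: "(four_f_D \<beta> h k has_real_derivative four_f_D \<beta> h (Suc k) a) (at a)"
  by (cases "(\<beta>, h, k)" rule: four_f_D.cases)
    (auto intro!: derivative_eq_intros simp: eval_nat_numeral algebra_simps)

lemma DERIV_one_over_power:
  assumes "(b has_real_derivative b') (at a)" "b a \<noteq> 0"
  shows "((\<lambda>a. 1 / b a ^ Suc j) has_real_derivative - b' * real (Suc j) / b a ^ Suc (Suc j)) (at a)"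
  by (rule derivative_eq_intros assms refl | simp add: assms)+

lemma entropy_D_DERIV:
  assumes "0 < a" "a < 1"
  shows "(entropy_D k has_real_derivative entropy_D (Suc k) a) (at a)"
proof -
  consider "k = 0" | "k = 1" | j where "k = Suc (Suc j)"
    by (metis One_nat_def not0_implies_Suc)
  then show ?thesis
  proof cases
    case 1
    have "((\<lambda>a. - a * ln a - (1 - a) * ln (1 - a)) has_real_derivative ln (1 - a) - ln a) (at a)"
      using assms by (auto intro!: derivative_eq_intros simp: diff_divide_distrib[symmetric])
    then show ?thesis unfolding 1 by (simp add: entropy_I_def[abs_def])
  next
    case 2
    have "((\<lambda>a. ln (1 - a) - ln a) has_real_derivative - (1 / a + 1 / (1 - a))) (at a)"
      using assms by (auto intro!: derivative_eq_intros simp: field_simps)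
    then show ?thesis unfolding 2 by simp
  next
    case 3
    have "((\<lambda>a. - fact j * ((- 1) ^ j * (1 / a ^ Suc j) + 1 / (1 - a) ^ Suc j)) has_real_derivative
        - fact j * ((- 1) ^ j * (- 1 * real (Suc j) / a ^ Suc (Suc j)) + - (- 1) * real (Suc j) / (1 - a) ^ Suc (Suc j))) (at a)"
      using assms by (intro DERIV_cmult DERIV_add DERIV_one_over_power) (auto intro!: derivative_eq_intros)
    then have "((\<lambda>a. - fact j * ((- 1) ^ j * (1 / a ^ Suc j) + 1 / (1 - a) ^ Suc j)) has_real_derivative
        - fact (Suc j) * ((- 1) ^ Suc j / a ^ Suc (Suc j) + 1 / (1 - a) ^ Suc (Suc j))) (at a)"
      by (rule DERIV_cong) (simp add: algebra_simps del: power_Suc of_nat_Suc, simp)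
    then show ?thesis unfolding 3 by simp
  qed
qed

text \<open>The next \<open>deriv\<close> at \<open>a\<close> sees the previous derivative on a
  neighbourhood, so the induction runs over all points of the open interval at once.\<close>

lemma four_A_deriv_eq:
  assumes "0 < a" "a < 1"
  shows "four_A_deriv k \<beta> h a = four_f_D \<beta> h k a + entropy_D k a"
  using assms
proof (induction k arbitrary: a)
  case 0
  then show ?case by (simp add: four_A_deriv_def four_A_def four_f_def)
next
  case (Suc k)
  have "((\<lambda>x. four_f_D \<beta> h k x + entropy_D k x) has_real_derivative four_f_D \<beta> h (Suc k) a + entropy_D (Suc k) a) (at a)"
    by (intro DERIV_add four_f_D_DERIV entropy_D_DERIV Suc.prems)
  then have "(four_A_deriv k \<beta> h has_real_derivative four_f_D \<beta> h (Suc k) a + entropy_D (Suc k) a) (at a)"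
    by (rule has_field_derivative_transform_within_open[of _ _ _ "{0<..<1}"]) (use Suc in auto)
  then show ?case by (simp add: four_A_deriv_def DERIV_imp_deriv)
qed

lemma four_A_deriv_DERIV:
  assumes "0 < a" "a < 1"
  shows "(four_A_deriv k \<beta> h has_real_derivative four_A_deriv (Suc k) \<beta> h a) (at a)"
proof -
  have "((\<lambda>x. four_f_D \<beta> h k x + entropy_D k x) has_real_derivative four_A_deriv (Suc k) \<beta> h a) (at a)"
    unfolding four_A_deriv_eq[OF assms] by (intro DERIV_add four_f_D_DERIV entropy_D_DERIV assms)
  then show ?thesis
    by (rule has_field_derivative_transform_within_open[of _ _ _ "{0<..<1}"]) (use assms four_A_deriv_eq in auto)
qed

text \<open>6-regularity says nothing about order 7. The polynomial part has degree four, and the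
  entropy part vanishes by symmetry; this is what raises \<open>q\<close> to 2 for
  \<open>m = 3\<close>.\<close>

lemma four_A_deriv_7_half: "four_A_deriv 7 \<beta> h (1 / 2) = 0"
  by (simp add: four_A_deriv_eq eval_nat_numeral)

section \<open>Local expansion of the weights at a maximizer\<close>

text \<open>Stirling's prefactor \<open>(x (1 - x))^(-1/2)\<close> equals
  \<open>exp (- log_edge x / 2)\<close>.\<close>

definition log_edge :: "real \<Rightarrow> real" where
  "log_edge x = ln x + ln (1 - x)"

text \<open>Taylor's formula of order \<open>q\<close>. For \<open>q = 2\<close> the linear term is
  absent because \<open>1 / x - 1 / (1 - x)\<close> vanishes at 1/2.\<close>

lemma log_edge_bound:
  assumes q: "q = 1 \<or> q = 2 \<and> a = 1 / 2" and "0 < \<rho>" "\<rho> < a" "\<rho> < 1 - a"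
  obtains C where "C \<ge> 0" "\<And>x. \<bar>x - a\<bar> \<le> \<rho> \<Longrightarrow> \<bar>log_edge x - log_edge a\<bar> \<le> C * \<bar>x - a\<bar> ^ q"
proof -
  \<comment> \<open>Derivatives up to order three: the remainder bound with \<open>q = 2\<close>
    needs \<open>d 2\<close> to be differentiable.\<close>
  define d where "d i = (case i of 0 \<Rightarrow> log_edge | Suc 0 \<Rightarrow> (\<lambda>x. 1 / x - 1 / (1 - x))
     | Suc (Suc 0) \<Rightarrow> (\<lambda>x. - 1 / x ^ 2 - 1 / (1 - x) ^ 2) | _ \<Rightarrow> (\<lambda>x. 2 / x ^ 3 - 2 / (1 - x) ^ 3))" for i :: nat
  have "(d i has_real_derivative d (Suc i) x) (at x)" if "i \<le> q" "\<bar>x - a\<bar> \<le> \<rho>" for i x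
  proof -
    have x: "0 < x" "x < 1" using that assms by auto
    have "i = 0 \<or> i = Suc 0 \<or> i = Suc (Suc 0)" using that q by auto
    then show ?thesis
    proof (elim disjE)
      assume "i = 0"
      then show ?thesis using x
        by (auto simp: d_def log_edge_def[abs_def] intro!: derivative_eq_intros)
    next
      assume "i = Suc 0"
      then show ?thesis using x
        by (auto simp: d_def power2_eq_square intro!: derivative_eq_intros)
    next
      assume "i = Suc (Suc 0)"
      have "((\<lambda>x. 1 - x) has_real_derivative - 1) (at x)" by (auto intro!: derivative_eq_intros)
      from DERIV_diff[OF DERIV_minus[OF DERIV_one_over_power[OF DERIV_ident, of x 1]] DERIV_one_over_power[OF this, of 1]]
      show ?thesis using x \<open>i = Suc (Suc 0)\<close> by (simp add: d_def eval_nat_numeral)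
    qed
  qed
  note D = this
  have "q > 0" using q by auto
  obtain C where C: "C \<ge> 0"
    "\<And>x. \<bar>x - a\<bar> \<le> \<rho> \<Longrightarrow> \<bar>d 0 x - (\<Sum>i<q. d i a / fact i * (x - a) ^ i)\<bar> \<le> C * \<bar>x - a\<bar> ^ q"
    by (rule taylor_remainder_bound[of q a \<rho> d, OF \<open>q > 0\<close>]) (erule (1) D, rule that)
  have "(\<Sum>i<q. d i a / fact i * (x - a) ^ i) = log_edge a" for x
    using q by (auto simp: d_def numeral_2_eq_2)
  then show ?thesis using C(2) by (intro that[OF C(1)]) (simp add: d_def)
qed

lemma four_A_taylor:
  assumes "0 < \<rho>" "\<rho> < a" "\<rho> < 1 - a" "m \<ge> 1"
    and flat: "\<And>k. 1 \<le> k \<Longrightarrow> k < 2 * m + q \<Longrightarrow> k \<noteq> 2 * m \<Longrightarrow> four_A_deriv k \<beta> h a = 0" and "q \<ge> 1"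
  obtains C where "C \<ge> 0"
    "\<And>x. \<bar>x - a\<bar> \<le> \<rho> \<Longrightarrow> \<bar>four_A \<beta> h x - four_A \<beta> h a - four_A_deriv (2 * m) \<beta> h a / fact (2 * m) * (x - a) ^ (2 * m)\<bar>
       \<le> C * \<bar>x - a\<bar> ^ (2 * m + q)"
proof -
  let ?d = "\<lambda>i. four_A_deriv i \<beta> h" and ?N = "2 * m + q"
  have N: "?N > 0" using assms by simp
  have D: "(?d i has_real_derivative ?d (Suc i) x) (at x)" if "i \<le> ?N" "\<bar>x - a\<bar> \<le> \<rho>" for i x
    using assms that by (intro four_A_deriv_DERIV) auto
  obtain C where C: "C \<ge> 0"
    "\<And>x. \<bar>x - a\<bar> \<le> \<rho> \<Longrightarrow> \<bar>?d 0 x - (\<Sum>i<?N. ?d i a / fact i * (x - a) ^ i)\<bar> \<le> C * \<bar>x - a\<bar> ^ ?N"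
    by (rule taylor_remainder_bound[of ?N a \<rho> ?d, OF N]) (erule (1) D, rule that)
  have "(\<Sum>i<?N. ?d i a / fact i * (x - a) ^ i) = (\<Sum>i\<in>{0, 2 * m}. ?d i a / fact i * (x - a) ^ i)" for x
    using assms by (intro sum.mono_neutral_right) (auto simp del: fact_Suc)
  then have "(\<Sum>i<?N. ?d i a / fact i * (x - a) ^ i) = four_A \<beta> h a + ?d (2 * m) a / fact (2 * m) * (x - a) ^ (2 * m)" for x
    using assms by (simp add: four_A_deriv_def[of 0])
  then show ?thesis using C(2) by (intro that[OF C(1)]) (simp add: four_A_deriv_def[of 0] diff_diff_eq)
qed

definition spin_weight :: "real \<Rightarrow> real \<Rightarrow> nat \<Rightarrow> nat \<Rightarrow> real" where
  "spin_weight \<beta> h n k = real (n choose k) * exp (real n * four_f \<beta> h (real k / real n))"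

text \<open>The Stirling form of \<open>spin_weight\<close> at \<open>x = a\<close>, where the
  remainders of \<open>k\<close> and \<open>n - k\<close> are both replaced by
  \<open>stirling_rem n\<close>; together with that of \<open>n\<close> they leave a single
  \<open>- stirling_rem n\<close>.\<close>

definition peak_scale :: "real \<Rightarrow> real \<Rightarrow> real \<Rightarrow> nat \<Rightarrow> real" where
  "peak_scale \<beta> h a n = exp (real n * four_A \<beta> h a - ln (real n) / 2 - log_edge a / 2 - stirling_rem n)"

text \<open>The three terms in the bound on \<open>E\<close> come from \<open>four_A_taylor\<close>,
  \<open>log_edge_bound\<close> and \<open>stirling_rem_diff\<close>. The factor
  \<open>2 ^ (2 * m)\<close> in \<open>\<kappa>\<close> appears because \<open>t\<close> is twice
  the displacement of \<open>k / n\<close>.\<close>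

lemma spin_weight_expansion:
  assumes "0 < \<rho>" "\<rho> < a" "\<rho> < 1 - a" "m \<ge> 1"
    and q: "q = 1 \<or> q = 2 \<and> a = 1 / 2"
    and flat: "\<And>k. 1 \<le> k \<Longrightarrow> k < 2 * m + q \<Longrightarrow> k \<noteq> 2 * m \<Longrightarrow> four_A_deriv k \<beta> h a = 0"
  defines "\<kappa> \<equiv> - four_A_deriv (2 * m) \<beta> h a / (2 ^ (2 * m) * fact (2 * m))"
  obtains C where "C \<ge> 0"
    "\<And>n k t. n \<ge> 1 \<Longrightarrow> k \<le> n \<Longrightarrow> t = 2 * (real k / real n - a) \<Longrightarrow> \<bar>t\<bar> \<le> \<rho> \<Longrightarrow>
      \<exists>E. spin_weight \<beta> h n k = peak_scale \<beta> h a n * exp (- \<kappa> * (real n * t ^ (2 * m)) + E) \<and>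
          \<bar>E\<bar> \<le> C * (real n * \<bar>t\<bar> ^ (2 * m + q) + \<bar>t\<bar> ^ q + 1 / real n)"
proof -
  have "q \<ge> 1" using q by auto
  obtain C1 where C1: "C1 \<ge> 0"
    "\<And>x. \<bar>x - a\<bar> \<le> \<rho> \<Longrightarrow> \<bar>four_A \<beta> h x - four_A \<beta> h a - four_A_deriv (2 * m) \<beta> h a / fact (2 * m) * (x - a) ^ (2 * m)\<bar>
       \<le> C1 * \<bar>x - a\<bar> ^ (2 * m + q)"
    by (rule four_A_taylor[OF assms(1-4) flat \<open>q \<ge> 1\<close>]) (assumption | rule that)+
  obtain C2 where C2: "C2 \<ge> 0" "\<And>x. \<bar>x - a\<bar> \<le> \<rho> \<Longrightarrow> \<bar>log_edge x - log_edge a\<bar> \<le> C2 * \<bar>x - a\<bar> ^ q"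
    by (rule log_edge_bound[OF q assms(1-3)]) (rule that)
  \<comment> \<open>On the window both \<open>k\<close> and \<open>n - k\<close> are at least
    \<open>r * n\<close>, so their Stirling remainders differ from that of \<open>n\<close> by order
    \<open>1 / n\<close>.\<close>
  define r where "r = min (a - \<rho>) (1 - a - \<rho>)"
  have r: "r > 0" using assms by (simp add: r_def)
  define C where "C = C1 + C2 + 1 / r"
  have "\<exists>E. spin_weight \<beta> h n k = peak_scale \<beta> h a n * exp (- \<kappa> * (real n * t ^ (2 * m)) + E) \<and>
          \<bar>E\<bar> \<le> C * (real n * \<bar>t\<bar> ^ (2 * m + q) + \<bar>t\<bar> ^ q + 1 / real n)"
    if n: "n \<ge> 1" "k \<le> n" and t: "t = 2 * (real k / real n - a)" "\<bar>t\<bar> \<le> \<rho>" for n k t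
  proof -
    define x where "x = real k / real n"
    have n0: "real n > 0" using n by simp
    have xt: "x - a = t / 2" using t by (simp add: x_def)
    have xa: "\<bar>x - a\<bar> \<le> \<rho>" using t(2) xt by simp
    have x: "r \<le> x" "r \<le> 1 - x" using xa by (auto simp: r_def)
    have rk: "r * real n \<le> real k" using x(1) n0 by (simp add: x_def field_simps)
    have rnk: "r * real n \<le> real (n - k)" using x(2) n0 n by (simp add: x_def field_simps of_nat_diff)
    have "0 < r * real n" using r n0 by simp
    then have k: "0 < k" "k < n" using rk rnk n by (auto intro!: Nat.gr0I) 
    \<comment> \<open>What is left of the Stirling remainders after \<open>- stirling_rem n\<close>
      has been moved into \<open>peak_scale\<close>.\<close>
    define S where "S = 2 * stirling_rem n - stirling_rem k - stirling_rem (n - k)"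
    have "1 / real k \<le> 1 / (r * real n)" "1 / real (n - k) \<le> 1 / (r * real n)"
      using rk rnk \<open>0 < r * real n\<close> by (intro divide_left_mono; simp)+
    moreover have "0 < 1 / real n" "0 < 1 / (r * real n)" using n0 r by simp_all
    moreover have "0 \<le> stirling_rem k - stirling_rem n \<and> stirling_rem k - stirling_rem n \<le> (1 / real k - 1 / real n) / 4"
      using k by (intro stirling_rem_diff) auto
    moreover have "0 \<le> stirling_rem (n - k) - stirling_rem n \<and> stirling_rem (n - k) - stirling_rem n \<le> (1 / real (n - k) - 1 / real n) / 4"
      using k by (intro stirling_rem_diff) auto
    ultimately have "\<bar>S\<bar> \<le> 1 / (r * real n)" unfolding S_def abs_le_iff by argo
    then have S: "\<bar>S\<bar> \<le> 1 / r * (1 / real n)" by simp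
    define E where "E = real n * (four_A \<beta> h x - four_A \<beta> h a - four_A_deriv (2 * m) \<beta> h a / fact (2 * m) * (x - a) ^ (2 * m))
      - (log_edge x - log_edge a) / 2 + S"
    have pw: "four_A_deriv (2 * m) \<beta> h a / fact (2 * m) * (x - a) ^ (2 * m) = - \<kappa> * t ^ (2 * m)"
      unfolding xt \<kappa>_def by (simp add: power_divide)
    have "spin_weight \<beta> h n k = exp (real n * entropy_I x - ln (real n) / 2 - log_edge x / 2
        + (stirling_rem n - stirling_rem k - stirling_rem (n - k)) + real n * four_f \<beta> h x)"
      unfolding spin_weight_def exp_add x_def log_edge_def binomial_entropy_expansion[OF k] ..
    also have "\<dots> = exp ((real n * four_A \<beta> h a - ln (real n) / 2 - log_edge a / 2 - stirling_rem n)
        + (- \<kappa> * (real n * t ^ (2 * m)) + E))"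
      unfolding E_def pw S_def four_A_def by (rule arg_cong[where f = exp]) (simp add: field_simps)
    also have "\<dots> = peak_scale \<beta> h a n * exp (- \<kappa> * (real n * t ^ (2 * m)) + E)"
      unfolding peak_scale_def by (simp only: exp_add)
    finally have 1: "spin_weight \<beta> h n k = peak_scale \<beta> h a n * exp (- \<kappa> * (real n * t ^ (2 * m)) + E)" .
    have half: "\<bar>x - a\<bar> ^ j \<le> \<bar>t\<bar> ^ j" for j using xt by (intro power_mono) auto
    have "\<bar>E\<bar> \<le> real n * (C1 * \<bar>x - a\<bar> ^ (2 * m + q)) + C2 * \<bar>x - a\<bar> ^ q + 1 / r * (1 / real n)"
    proof -
      have "\<bar>real n * (four_A \<beta> h x - four_A \<beta> h a - four_A_deriv (2 * m) \<beta> h a / fact (2 * m) * (x - a) ^ (2 * m))\<bar>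
          \<le> real n * (C1 * \<bar>x - a\<bar> ^ (2 * m + q))"
        using C1(2)[OF xa] by (simp only: abs_mult abs_of_nat) (intro mult_left_mono; simp)
      moreover have "\<bar>u - v / 2 + w\<bar> \<le> u' + v' + w'"
        if "\<bar>u\<bar> \<le> u'" "\<bar>v\<bar> \<le> v'" "\<bar>w\<bar> \<le> w'" for u v w u' v' w' :: real
        using that by linarith
      ultimately show ?thesis using C2(2)[OF xa] S unfolding E_def by blast
    qed
    also have "\<dots> \<le> real n * (C1 * \<bar>t\<bar> ^ (2 * m + q)) + C2 * \<bar>t\<bar> ^ q + 1 / r * (1 / real n)"
      using C1(1) C2(1) half r by (intro add_mono mult_left_mono) auto
    also have "\<dots> = C1 * (real n * \<bar>t\<bar> ^ (2 * m + q)) + C2 * \<bar>t\<bar> ^ q + 1 / r * (1 / real n)" by simp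
    also have "\<dots> \<le> C * (real n * \<bar>t\<bar> ^ (2 * m + q)) + C * \<bar>t\<bar> ^ q + C * (1 / real n)"
      using C1(1) C2(1) r by (intro add_mono mult_right_mono) (auto simp: C_def)
    finally show ?thesis using 1 by (auto simp: distrib_left)
  qed
  note bound = this
  have "C \<ge> 0" using C1(1) C2(1) r by (simp add: C_def)
  then show ?thesis by (rule that) (rule bound)
qed

text \<open>Since \<open>M / n - (2 * a - 1) = 2 * (k / n - a)\<close> for \<open>k\<close> plus
  spins, this is the conditioning event of the theorem in terms of \<open>k\<close>; hence the
  factor 2.\<close>

definition window :: "nat \<Rightarrow> real \<Rightarrow> real \<Rightarrow> nat set" where
  "window n a \<delta> = {k. k \<le> n \<and> \<bar>2 * (real k / real n - a)\<bar> \<le> \<delta>}"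

definition off_window :: "nat \<Rightarrow> real set \<Rightarrow> real \<Rightarrow> nat set" where
  "off_window n S \<delta> = {k. k \<le> n \<and> (\<forall>a\<in>S. \<bar>2 * (real k / real n - a)\<bar> > \<delta>)}"

lemma finite_window [simp]: "finite (window n a \<delta>)"
  by (simp add: window_def)

lemma finite_off_window [simp]: "finite (off_window n S \<delta>)"
  by (simp add: off_window_def)

lemma spin_weight_pos: "k \<le> n \<Longrightarrow> spin_weight \<beta> h n k > 0"
  by (simp add: spin_weight_def)

lemma spin_weight_nonneg: "spin_weight \<beta> h n k \<ge> 0"
  by (simp add: spin_weight_def)

lemma peak_scale_pos: "peak_scale \<beta> h a n > 0"
  by (simp add: peak_scale_def)

text \<open>The parameter \<open>q\<close> is the order of the correction to the leading term \<open>(x - a) ^ (2 * m)\<close>; the case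
  \<open>q = 2\<close> relies on the symmetry of \<open>four_A\<close> about \<open>1 / 2\<close>.\<close>
definition flat_peak :: "real \<Rightarrow> real \<Rightarrow> real \<Rightarrow> nat \<Rightarrow> nat \<Rightarrow> bool" where
  "flat_peak \<beta> h a m q \<longleftrightarrow> 0 < a \<and> a < 1 \<and> 1 \<le> m \<and> q < 2 * m \<and> (q = 1 \<or> q = 2 \<and> a = 1 / 2) \<and>
     (\<forall>k. 1 \<le> k \<longrightarrow> k < 2 * m + q \<longrightarrow> k \<noteq> 2 * m \<longrightarrow> four_A_deriv k \<beta> h a = 0) \<and>
     four_A_deriv (2 * m) \<beta> h a < 0"

text \<open>The leading Taylor term of \<open>four_A\<close> is
  \<open>- peak_rate \<beta> h a m * t ^ (2 * m)\<close> in the variable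
  \<open>t = 2 * (x - a)\<close>. For \<open>m = 1\<close> the rate is \<open>|A''(a)| / 8\<close>,
  which is the Gaussian exponent of variance \<open>4 / |A''(a)|\<close>.\<close>

definition peak_rate :: "real \<Rightarrow> real \<Rightarrow> real \<Rightarrow> nat \<Rightarrow> real" where
  "peak_rate \<beta> h a m = - four_A_deriv (2 * m) \<beta> h a / (2 ^ (2 * m) * fact (2 * m))"

lemma peak_rate_pos: "flat_peak \<beta> h a m q \<Longrightarrow> peak_rate \<beta> h a m > 0"
  unfolding peak_rate_def flat_peak_def by (intro divide_pos_pos) simp_all

lemma spin_laplace:
  assumes "flat_peak \<beta> h a m q"
  obtains \<delta>0 where "\<delta>0 > 0"
    "\<And>\<delta>. 0 < \<delta> \<Longrightarrow> \<delta> \<le> \<delta>0 \<Longrightarrow> \<exists>C\<ge>0. \<forall>n \<nu> \<phi>. real n \<ge> 4 / \<delta> \<longrightarrow> \<nu> > 0 \<longrightarrow> \<nu> ^ (2 * m) = real n \<longrightarrow>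
      unit_slope \<phi> \<longrightarrow> \<bar>\<phi> 0\<bar> \<le> 1 \<longrightarrow>
      \<bar>2 * \<nu> / real n * (\<Sum>k\<in>window n a \<delta>. \<phi> (\<nu> * (2 * (real k / real n - a))) * (spin_weight \<beta> h n k / peak_scale \<beta> h a n))
       - (\<integral>x. \<phi> x * exp (- peak_rate \<beta> h a m * x ^ (2 * m)) \<partial>lborel)\<bar> \<le> C / \<nu> ^ q"
proof -
  have a: "0 < a" "a < 1" and m: "1 \<le> m" "q < 2 * m" and q: "q = 1 \<or> q = 2 \<and> a = 1 / 2"
    and flat: "\<And>k. 1 \<le> k \<Longrightarrow> k < 2 * m + q \<Longrightarrow> k \<noteq> 2 * m \<Longrightarrow> four_A_deriv k \<beta> h a = 0"
    using assms by (auto simp: flat_peak_def)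
  have q1: "1 \<le> q" using q by auto
  define \<kappa> where "\<kappa> = peak_rate \<beta> h a m"
  have \<kappa>: "\<kappa> > 0" using peak_rate_pos[OF assms] by (simp add: \<kappa>_def)
  define \<rho> where "\<rho> = min a (1 - a) / 2"
  have \<rho>: "0 < \<rho>" "\<rho> < a" "\<rho> < 1 - a" using a by (auto simp: \<rho>_def min_def)
  obtain C where C: "C \<ge> 0"
    "\<And>n k t. n \<ge> 1 \<Longrightarrow> k \<le> n \<Longrightarrow> t = 2 * (real k / real n - a) \<Longrightarrow> \<bar>t\<bar> \<le> \<rho> \<Longrightarrow>
      \<exists>E. spin_weight \<beta> h n k = peak_scale \<beta> h a n * exp (- \<kappa> * (real n * t ^ (2 * m)) + E) \<and>
          \<bar>E\<bar> \<le> C * (real n * \<bar>t\<bar> ^ (2 * m + q) + \<bar>t\<bar> ^ q + 1 / real n)"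
    by (rule spin_weight_expansion[OF \<rho> m(1) q flat, folded peak_rate_def, folded \<kappa>_def]) (assumption | rule that)+
  \<comment> \<open>The last entry yields \<open>C * \<delta> ^ q <= \<kappa> / 2\<close>, as
    \<open>\<delta> ^ q <= \<delta>\<close> for \<open>\<delta> <= 1\<close>; \<open>C + 1\<close>
    avoids a division by zero.\<close>
  define \<delta>0 where "\<delta>0 = min (min 1 \<rho>) (\<kappa> / (2 * (C + 1)))"
  have "\<delta>0 > 0" using \<rho> \<kappa> C(1) by (simp add: \<delta>0_def)
  moreover have "\<exists>C\<ge>0. \<forall>n \<nu> \<phi>. real n \<ge> 4 / \<delta> \<longrightarrow> \<nu> > 0 \<longrightarrow> \<nu> ^ (2 * m) = real n \<longrightarrow>
      unit_slope \<phi> \<longrightarrow> \<bar>\<phi> 0\<bar> \<le> 1 \<longrightarrow>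
      \<bar>2 * \<nu> / real n * (\<Sum>k\<in>window n a \<delta>. \<phi> (\<nu> * (2 * (real k / real n - a))) * (spin_weight \<beta> h n k / peak_scale \<beta> h a n))
       - (\<integral>x. \<phi> x * exp (- \<kappa> * x ^ (2 * m)) \<partial>lborel)\<bar> \<le> C / \<nu> ^ q" if \<delta>: "0 < \<delta>" "\<delta> \<le> \<delta>0" for \<delta>
    unfolding window_def
  proof (rule lattice_laplace[OF m(1) q1 m(2) \<kappa> C(1) \<delta>(1)])
    show "\<delta> \<le> 1" "\<delta> \<le> 2 * a" "\<delta> \<le> 2 * (1 - a)" using \<delta> \<rho> by (auto simp: \<delta>0_def)
    have "C * \<delta> ^ q \<le> (C + 1) * \<delta> ^ 1"
      using C(1) \<delta> q1 \<open>\<delta> \<le> 1\<close> by (intro mult_mono power_decreasing) auto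
    also have "\<dots> \<le> (C + 1) * (\<kappa> / (2 * (C + 1)))" using C(1) \<delta> by (intro mult_left_mono) (auto simp: \<delta>0_def)
    also have "\<dots> = \<kappa> / 2" using C(1) by (simp add: field_simps)
    finally show "C * \<delta> ^ q \<le> \<kappa> / 2" .
    show "peak_scale \<beta> h a n > 0" for n by (rule peak_scale_pos)
    fix n k t assume "1 \<le> n" "k \<le> n" "t = 2 * (real k / real n - a)" "\<bar>t\<bar> \<le> \<delta>"
    moreover from this have "\<bar>t\<bar> \<le> \<rho>" using \<delta> by (simp add: \<delta>0_def)
    ultimately show "\<exists>E. spin_weight \<beta> h n k = peak_scale \<beta> h a n * exp (- \<kappa> * (real n * t ^ (2 * m)) + E) \<and>
          \<bar>E\<bar> \<le> C * (real n * \<bar>t\<bar> ^ (2 * m + q) + \<bar>t\<bar> ^ q + 1 / real n)"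
      by (intro C(2))
  qed
  ultimately show ?thesis unfolding \<kappa>_def by (rule that)
qed

section \<open>Weights away from the maximizers\<close>

text \<open>Only the point 0 needs work. There \<open>ln (1 / sqrt x) <= 1 / sqrt x - 1\<close>
  gives \<open>- 2 * sqrt x <= x * ln x <= 0\<close>.\<close>

lemma continuous_on_mult_ln: "continuous_on {0..1::real} (\<lambda>x. x * ln x)"
  unfolding continuous_on_eq_continuous_within
proof
  fix x :: real assume x: "x \<in> {0..1}"
  show "continuous (at x within {0..1}) (\<lambda>x. x * ln x)"
  proof (cases "x = 0")
    case False
    then have "isCont (\<lambda>x. x * ln x) x" using x by (intro continuous_intros) auto
    then show ?thesis by (rule continuous_at_imp_continuous_at_within)
  next
    case True
    have "((\<lambda>x::real. x * ln x) \<longlongrightarrow> 0) (at_right 0)"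
    proof (rule tendsto_sandwich[where f = "\<lambda>x. - 2 * sqrt x" and h = "\<lambda>_. 0"])
      have "((\<lambda>x::real. - 2 * sqrt x) \<longlongrightarrow> - 2 * sqrt 0) (at_right 0)"
        by (intro tendsto_intros)
      then show "((\<lambda>x::real. - 2 * sqrt x) \<longlongrightarrow> 0) (at_right 0)" by simp
      have ev: "\<forall>\<^sub>F x in at_right (0::real). x \<in> {0<..<1}" by (intro eventually_at_right_real) simp
      show "\<forall>\<^sub>F x::real in at_right 0. x * ln x \<le> 0"
        using ev by eventually_elim (auto simp: mult_le_0_iff)
      show "\<forall>\<^sub>F x in at_right 0. - 2 * sqrt x \<le> x * ln x"
        using ev
      proof eventually_elim
        case (elim x)
        then have s: "0 < sqrt x" "sqrt x * sqrt x = x" by auto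
        have "ln (1 / sqrt x) \<le> 1 / sqrt x - 1" using s by (intro ln_le_minus_one) auto
        moreover have "ln (1 / sqrt x) = - (ln x / 2)" using elim by (simp add: ln_div ln_sqrt)
        ultimately have "- 2 / sqrt x \<le> ln x" by simp
        then have "x * (- 2 / sqrt x) \<le> x * ln x" using elim by (intro mult_left_mono) auto
        moreover have "x * (- 2 / sqrt x) = - 2 * sqrt x" using s by (simp add: field_simps)
        ultimately show ?case by simp
      qed
    qed simp
    then show ?thesis unfolding True continuous_within by (simp add: at_within_Icc_at_right)
  qed
qed

lemma continuous_on_four_A: "continuous_on {0..1} (four_A \<beta> h)"
proof -
  have "continuous_on {0..1::real} (\<lambda>a. (1 - a) * ln (1 - a))"
    by (rule continuous_on_compose2[OF continuous_on_mult_ln, of "{0..1}" "\<lambda>a. 1 - a"])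
       (auto intro!: continuous_intros)
  then have "continuous_on {0..1} (\<lambda>a. four_f \<beta> h a + (- (a * ln a) - (1 - a) * ln (1 - a)))"
    unfolding four_f_def
    by (intro continuous_on_add continuous_on_diff continuous_on_minus continuous_on_mult_ln)
      (auto intro!: continuous_intros)
  then show ?thesis by (simp add: four_A_def[abs_def] entropy_I_def)
qed

lemma spin_weight_le: 
  assumes "k \<le> n" "n \<ge> 1"
  shows "spin_weight \<beta> h n k \<le> exp (real n * four_A \<beta> h (real k / real n))"
  using mult_right_mono[OF binomial_le_exp_entropy[OF assms], of "exp (real n * four_f \<beta> h (real k / real n))"]
  by (simp add: spin_weight_def four_A_def distrib_left exp_add mult.commute)

text \<open>With the strict inequality relaxed, the points far from all maximizers form a compact
  set that contains no maximizer because \<open>\<delta> > 0\<close>. \<open>four_A\<close> attains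
  its supremum on it, strictly below the maximal value, which is written as the value at
  \<open>a\<close>. If the set is empty any gap will do.\<close>

lemma gap_off_window:
  assumes "a \<in> maximizers \<beta> h" "\<delta> > 0"
  obtains \<epsilon> where "\<epsilon> > 0"
    "\<And>x. x \<in> {0..1} \<Longrightarrow> (\<And>b. b \<in> maximizers \<beta> h \<Longrightarrow> \<delta> < \<bar>2 * (x - b)\<bar>) \<Longrightarrow> four_A \<beta> h x \<le> four_A \<beta> h a - \<epsilon>"
proof (cases "{x \<in> {0..1}. \<forall>b\<in>maximizers \<beta> h. \<delta> \<le> \<bar>2 * (x - b)\<bar>} = {}")
  case True
  then have "\<exists>b\<in>maximizers \<beta> h. \<not> \<delta> < \<bar>2 * (x - b)\<bar>" if "x \<in> {0..1}" for x
    using that by force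
  then show ?thesis using that[of 1] by force
next
  case False
  define T where "T = {x \<in> {0..1}. \<forall>b\<in>maximizers \<beta> h. \<delta> \<le> \<bar>2 * (x - b)\<bar>}"
  have "T = {0..1} \<inter> (\<Inter>b\<in>maximizers \<beta> h. {x. \<delta> \<le> \<bar>2 * (x - b)\<bar>})" by (auto simp: T_def)
  moreover have "closed {x. \<delta> \<le> \<bar>2 * (x - b)\<bar>}" for b by (intro closed_Collect_le continuous_intros)
  ultimately have "compact T" by (simp add: compact_Int_closed closed_INT)
  moreover have "continuous_on T (four_A \<beta> h)"
    using continuous_on_four_A by (rule continuous_on_subset) (auto simp: T_def)
  ultimately obtain x0 where x0: "x0 \<in> T" "\<And>x. x \<in> T \<Longrightarrow> four_A \<beta> h x \<le> four_A \<beta> h x0"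
    using continuous_attains_sup[of T "four_A \<beta> h"] False[folded T_def] by blast
  have "x0 \<notin> maximizers \<beta> h" using x0(1) \<open>\<delta> > 0\<close> by (force simp: T_def)
  moreover have "x0 \<in> {0..1}" using x0(1) by (auto simp: T_def)
  ultimately obtain y where "y \<in> {0..1}" "four_A \<beta> h x0 < four_A \<beta> h y"
    unfolding maximizers_def by force
  then have "four_A \<beta> h x0 < four_A \<beta> h a" using assms(1) by (force simp: maximizers_def)
  moreover have "four_A \<beta> h x \<le> four_A \<beta> h a - (four_A \<beta> h a - four_A \<beta> h x0)"
    if "x \<in> {0..1}" "\<And>b. b \<in> maximizers \<beta> h \<Longrightarrow> \<delta> < \<bar>2 * (x - b)\<bar>" for x
    using x0(2)[of x] that by (auto simp: T_def intro: less_imp_le)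
  ultimately show ?thesis by (intro that[of "four_A \<beta> h a - four_A \<beta> h x0"]) auto
qed

lemma stirling_rem_le_1: "n \<ge> 1 \<Longrightarrow> stirling_rem n \<le> 1"
  using stirling_rem_diff[of 1 n] by (simp add: stirling_rem_def)

text \<open>There are at most \<open>n + 1\<close> terms, each at most
  \<open>exp (n * (A(a) - \<epsilon>))\<close>. Dividing by \<open>peak_scale\<close> costs a
  further factor of order \<open>sqrt n\<close>, estimated crudely by \<open>n\<close>; this gives
  the square.\<close>

lemma off_window_weight_bound:
  assumes "a \<in> maximizers \<beta> h" "\<delta> > 0"
  obtains \<epsilon> C where "\<epsilon> > 0" "C \<ge> 0"
    "\<And>n. n \<ge> 1 \<Longrightarrow> (\<Sum>k\<in>off_window n (maximizers \<beta> h) \<delta>. spin_weight \<beta> h n k) / peak_scale \<beta> h a n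
       \<le> C * (real n) ^ 2 * exp (- \<epsilon> * real n)"
proof -
  obtain \<epsilon> where \<epsilon>: "\<epsilon> > 0"
    "\<And>x. x \<in> {0..1} \<Longrightarrow> (\<And>b. b \<in> maximizers \<beta> h \<Longrightarrow> \<delta> < \<bar>2 * (x - b)\<bar>) \<Longrightarrow> four_A \<beta> h x \<le> four_A \<beta> h a - \<epsilon>"
    using gap_off_window[OF assms] by blast
  \<comment> \<open>The 2 is from \<open>n + 1 <= 2 * n\<close>, the 1 in the exponent from
    \<open>stirling_rem n <= 1\<close>.\<close>
  define C where "C = 2 * exp (log_edge a / 2 + 1)"
  have "(\<Sum>k\<in>off_window n (maximizers \<beta> h) \<delta>. spin_weight \<beta> h n k) / peak_scale \<beta> h a n
       \<le> C * (real n) ^ 2 * exp (- \<epsilon> * real n)" if n: "n \<ge> 1" for n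
  proof -
    let ?O = "off_window n (maximizers \<beta> h) \<delta>" and ?A = "four_A \<beta> h a"
    have "spin_weight \<beta> h n k \<le> exp (real n * (?A - \<epsilon>))" if "k \<in> ?O" for k
    proof -
      have "k \<le> n" using that by (simp add: off_window_def)
      have "four_A \<beta> h (real k / real n) \<le> ?A - \<epsilon>"
        using that n by (intro \<epsilon>(2)) (auto simp: off_window_def)
      then have "exp (real n * four_A \<beta> h (real k / real n)) \<le> exp (real n * (?A - \<epsilon>))"
        by (simp add: mult_left_mono)
      with spin_weight_le[OF \<open>k \<le> n\<close> n] show ?thesis by (rule order_trans)
    qed
    then have "(\<Sum>k\<in>?O. spin_weight \<beta> h n k) \<le> real (card ?O) * exp (real n * (?A - \<epsilon>))"
      using sum_bounded_above[of ?O "spin_weight \<beta> h n"] by simp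
    also have "\<dots> \<le> (2 * real n) * exp (real n * (?A - \<epsilon>))"
    proof -
      have "card ?O \<le> card {..n}" by (intro card_mono) (auto simp: off_window_def)
      then show ?thesis using n by (intro mult_right_mono) auto
    qed
    finally have 1: "(\<Sum>k\<in>?O. spin_weight \<beta> h n k) \<le> (2 * real n) * exp (real n * (?A - \<epsilon>))" .
    have "1 / peak_scale \<beta> h a n = exp (ln (real n) / 2 + (log_edge a / 2 + stirling_rem n) - real n * ?A)"
    proof -
      have inv: "1 / exp x = exp (- x)" for x :: real by (simp add: exp_minus divide_inverse)
      show ?thesis unfolding peak_scale_def inv by (rule arg_cong[where f = exp]) simp
    qed
    also have "\<dots> \<le> exp (ln (real n) + (log_edge a / 2 + 1) - real n * ?A)"
    proof -
      have "0 \<le> ln (real n)" using n by simp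
      then show ?thesis unfolding exp_le_cancel_iff using stirling_rem_le_1[OF n] by linarith
    qed
    also have "\<dots> = real n * exp (log_edge a / 2 + 1) * exp (- (real n * ?A))"
      using n unfolding diff_conv_add_uminus exp_add by simp
    finally have 2: "1 / peak_scale \<beta> h a n \<le> real n * exp (log_edge a / 2 + 1) * exp (- (real n * ?A))" .
    have "(\<Sum>k\<in>?O. spin_weight \<beta> h n k) * (1 / peak_scale \<beta> h a n)
        \<le> ((2 * real n) * exp (real n * (?A - \<epsilon>))) * (real n * exp (log_edge a / 2 + 1) * exp (- (real n * ?A)))"
      using 1 2 peak_scale_pos[of \<beta> h a n]
      by (intro mult_mono) (auto intro: sum_nonneg spin_weight_nonneg less_imp_le)
    also have "\<dots> = C * (real n) ^ 2 * (exp (real n * (?A - \<epsilon>)) * exp (- (real n * ?A)))"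
      by (simp add: C_def power2_eq_square)
    also have "exp (real n * (?A - \<epsilon>)) * exp (- (real n * ?A)) = exp (- \<epsilon> * real n)"
      by (simp add: algebra_simps flip: exp_add)
    finally show ?thesis by simp
  qed
  moreover have "C \<ge> 0" by (simp add: C_def)
  ultimately show ?thesis using \<epsilon>(1) by (intro that[of \<epsilon> C])
qed

section \<open>Normalization of Laplace sums\<close>

lemma unit_slope_const [simp]: "unit_slope (\<lambda>_. c)"
  by (simp add: unit_slope_def)

lemma laplace_moment_bound:
  fixes \<kappa> :: real
  assumes "\<kappa> > 0" "m \<ge> 1"
  obtains M where "M \<ge> 0"
    "\<And>\<phi>. unit_slope \<phi> \<Longrightarrow> \<bar>\<phi> 0\<bar> \<le> 1 \<Longrightarrow> \<bar>\<integral>x. \<phi> x * exp (- \<kappa> * x ^ (2 * m)) \<partial>lborel\<bar> \<le> M"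
proof -
  obtain B where B: "B > 0"
    "\<And>\<phi> x. unit_slope \<phi> \<Longrightarrow> \<bar>\<phi> 0\<bar> \<le> 1 \<Longrightarrow> (1 + \<bar>x\<bar>) ^ 0 * \<bar>\<phi> x * exp (- \<kappa> * x ^ (2 * m))\<bar> \<le> B / (1 + x\<^sup>2)"
    "\<And>\<phi> x y. unit_slope \<phi> \<Longrightarrow> \<bar>\<phi> 0\<bar> \<le> 1 \<Longrightarrow> x \<le> y \<Longrightarrow>
       \<bar>\<phi> y * exp (- \<kappa> * y ^ (2 * m)) - \<phi> x * exp (- \<kappa> * x ^ (2 * m))\<bar> \<le> B * (arctan y - arctan x)"
    by (rule unit_slope_damped_bounds[OF assms(1,2), of 0]) (rule that)
  have "\<bar>\<integral>x. \<phi> x * exp (- \<kappa> * x ^ (2 * m)) \<partial>lborel\<bar> \<le> B * pi" if \<phi>: "unit_slope \<phi>" "\<bar>\<phi> 0\<bar> \<le> 1" for \<phi>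
  proof -
    have "\<bar>\<integral>x. \<phi> x * exp (- \<kappa> * x ^ (2 * m)) \<partial>lborel\<bar> \<le> (\<integral>x. \<bar>\<phi> x * exp (- \<kappa> * x ^ (2 * m))\<bar> \<partial>lborel)"
      by (rule integral_abs_bound)
    also have "\<dots> \<le> (\<integral>x. B * (1 / (1 + x\<^sup>2)) \<partial>lborel)"
    proof (rule integral_mono)
      show "integrable lborel (\<lambda>x. \<bar>\<phi> x * exp (- \<kappa> * x ^ (2 * m))\<bar>)"
        by (intro integrable_abs unit_slope_damped_integrable assms \<phi>)
      show "integrable lborel (\<lambda>x::real. B * (1 / (1 + x\<^sup>2)))"
        using lborel_integrable_inverse_1_plus_square by (rule integrable_mult_right)
    qed (use B(2)[OF \<phi>] in simp)
    also have "\<dots> = B * pi"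
      by (simp only: integral_mult_right_zero lborel_integral_inverse_1_plus_square)
    finally show ?thesis .
  qed
  then show ?thesis using B(1) by (intro that[of "B * pi"]) auto
qed

lemma laplace_integrable:
  fixes \<kappa> :: real
  assumes "\<kappa> > 0" "m \<ge> 1"
  shows "integrable lborel (\<lambda>x. exp (- \<kappa> * x ^ (2 * m)))"
  using unit_slope_damped_integrable[OF assms, of "\<lambda>_. 1"] by simp

lemma laplace_mass_pos:
  fixes \<kappa> :: real
  assumes "\<kappa> > 0" "m \<ge> 1"
  shows "0 < (\<integral>x. exp (- \<kappa> * x ^ (2 * m)) \<partial>lborel)"
proof -
  have "(\<integral>x. exp (- \<kappa> * x ^ (2 * m)) \<partial>lborel) \<noteq> 0"
  proof
    assume "(\<integral>x. exp (- \<kappa> * x ^ (2 * m)) \<partial>lborel) = 0"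
    then have "AE x in lborel. exp (- \<kappa> * x ^ (2 * m)) = 0"
      using integral_nonneg_eq_0_iff_AE[OF laplace_integrable[OF assms]] by simp
    then have "AE x in (lborel :: real measure). False" by simp
    then have "ae_filter (lborel :: real measure) = bot" by (simp add: eventually_False)
    then show False by (simp add: ae_filter_eq_bot_iff emeasure_lborel_UNIV)
  qed
  moreover have "0 \<le> (\<integral>x. exp (- \<kappa> * x ^ (2 * m)) \<partial>lborel)" by (rule Bochner_Integration.integral_nonneg) simp
  ultimately show ?thesis by linarith
qed

lemma ratio_difference_bound:
  fixes S0 S1 T0 T :: real
  assumes "\<bar>S0 - T0\<bar> \<le> e" "\<bar>S1 - T\<bar> \<le> e" "T / 2 \<le> S1" "T > 0" "\<bar>T0\<bar> \<le> M"
  shows "\<bar>S0 / S1 - T0 / T\<bar> \<le> (2 / T + 2 * M / T\<^sup>2) * e"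
proof -
  have S1: "S1 > 0" using assms by linarith
  have "e \<ge> 0" using assms(1) by linarith
  have "S0 / S1 - T0 / T = (S0 - T0) / S1 + T0 * (T - S1) / (S1 * T)"
    using S1 \<open>T > 0\<close> by (simp add: field_simps)
  then have "\<bar>S0 / S1 - T0 / T\<bar> \<le> \<bar>S0 - T0\<bar> / S1 + \<bar>T0\<bar> * \<bar>S1 - T\<bar> / (S1 * T)"
    using S1 \<open>T > 0\<close> abs_triangle_ineq[of "(S0 - T0) / S1" "T0 * (T - S1) / (S1 * T)"]
    by (simp add: abs_mult abs_minus_commute)
  also have "\<dots> \<le> e / (T / 2) + M * e / (T / 2 * T)"
    using assms S1 \<open>e \<ge> 0\<close> by (intro add_mono frac_le mult_mono) auto
  also have "\<dots> = (2 / T + 2 * M / T\<^sup>2) * e"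
    using \<open>T > 0\<close> by (simp add: field_simps power2_eq_square)
  finally show ?thesis .
qed

lemma unit_slope_shift: "unit_slope \<phi> \<Longrightarrow> unit_slope (\<lambda>x. \<phi> x - c)"
  unfolding unit_slope_def
proof
  fix x assume *: "\<forall>x. \<phi> differentiable at x \<and> \<bar>deriv \<phi> x\<bar> \<le> 1"
  then have "((\<lambda>x. \<phi> x - c) has_real_derivative deriv \<phi> x - 0) (at x)"
    by (intro DERIV_diff DERIV_const) (simp add: DERIV_deriv_iff_real_differentiable)
  then show "(\<lambda>x. \<phi> x - c) differentiable at x \<and> \<bar>deriv (\<lambda>x. \<phi> x - c) x\<bar> \<le> 1"
    using * by (auto simp: DERIV_imp_deriv real_differentiable_def)
qed

lemma unit_slope_damped_integrable':
  fixes \<kappa> :: real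
  assumes "\<kappa> > 0" "m \<ge> 1" "unit_slope \<phi>"
  shows "integrable lborel (\<lambda>x. \<phi> x * exp (- \<kappa> * x ^ (2 * m)))"
proof -
  have "integrable lborel (\<lambda>x. (\<phi> x - \<phi> 0) * exp (- \<kappa> * x ^ (2 * m)) + \<phi> 0 * exp (- \<kappa> * x ^ (2 * m)))"
    using unit_slope_damped_integrable[OF assms(1,2) unit_slope_shift[OF assms(3), of "\<phi> 0"]]
    by (intro Bochner_Integration.integrable_add integrable_mult_right laplace_integrable assms) auto
  then show ?thesis by (simp add: algebra_simps)
qed

text \<open>Index set \<open>J\<close>, nodes \<open>Y\<close>, weights \<open>W\<close>, prefactor
  \<open>c\<close>. A single error \<open>e\<close> for the whole test class is what a Wasserstein
  bound requires, and the test function 1 gives the total mass.\<close>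

definition laplace_close ::
    "real \<Rightarrow> nat \<Rightarrow> real \<Rightarrow> nat set \<Rightarrow> (nat \<Rightarrow> real) \<Rightarrow> (nat \<Rightarrow> real) \<Rightarrow> real \<Rightarrow> bool" where
  "laplace_close \<kappa> m c J Y W e \<longleftrightarrow> (\<forall>\<phi>. unit_slope \<phi> \<longrightarrow> \<bar>\<phi> 0\<bar> \<le> 1 \<longrightarrow>
     \<bar>c * (\<Sum>k\<in>J. \<phi> (Y k) * W k) - (\<integral>x. \<phi> x * exp (- \<kappa> * x ^ (2 * m)) \<partial>lborel)\<bar> \<le> e)"

lemma laplace_closeD:
  "laplace_close \<kappa> m c J Y W e \<Longrightarrow> unit_slope \<phi> \<Longrightarrow> \<bar>\<phi> 0\<bar> \<le> 1 \<Longrightarrow>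
     \<bar>c * (\<Sum>k\<in>J. \<phi> (Y k) * W k) - (\<integral>x. \<phi> x * exp (- \<kappa> * x ^ (2 * m)) \<partial>lborel)\<bar> \<le> e"
  by (simp add: laplace_close_def)

text \<open>The test function 1 controls the normalizer and keeps it above half of its limit, so
  quotients inherit the error. The prefactor \<open>c\<close> cancels, and the restriction on
  \<open>\<phi> 0\<close> disappears by passing to \<open>\<phi> - \<phi> 0\<close>.\<close>

lemma normalized_laplace:
  fixes J :: "nat \<Rightarrow> nat set" and Y W :: "nat \<Rightarrow> nat \<Rightarrow> real" and c r :: "nat \<Rightarrow> real" and \<kappa> :: real
  assumes \<kappa>: "\<kappa> > 0" "m \<ge> 1" and r: "r \<longlonglongrightarrow> 0" and c: "\<forall>\<^sub>F n in sequentially. c n > 0"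
    and ev: "\<forall>\<^sub>F n in sequentially. laplace_close \<kappa> m (c n) (J n) (Y n) (W n) (C * r n)"
  obtains C' where "\<forall>\<^sub>F n in sequentially. 0 < (\<Sum>k\<in>J n. W n k) \<and> (\<forall>\<phi>. unit_slope \<phi> \<longrightarrow>
     \<bar>(\<Sum>k\<in>J n. \<phi> (Y n k) * W n k) / (\<Sum>k\<in>J n. W n k)
       - (\<integral>x. \<phi> x * exp (- \<kappa> * x ^ (2 * m)) \<partial>lborel) / (\<integral>x. exp (- \<kappa> * x ^ (2 * m)) \<partial>lborel)\<bar> \<le> C' * r n)"
proof -
  obtain M where M: "M \<ge> 0"
    "\<And>\<phi>. unit_slope \<phi> \<Longrightarrow> \<bar>\<phi> 0\<bar> \<le> 1 \<Longrightarrow> \<bar>\<integral>x. \<phi> x * exp (- \<kappa> * x ^ (2 * m)) \<partial>lborel\<bar> \<le> M"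
    by (rule laplace_moment_bound[OF \<kappa>]) (rule that)
  define T where "T = (\<integral>x. exp (- \<kappa> * x ^ (2 * m)) \<partial>lborel)"
  have T: "T > 0" unfolding T_def by (rule laplace_mass_pos[OF \<kappa>])
  define C' where "C' = (2 / T + 2 * M / T\<^sup>2) * C"
  have "(\<lambda>n. C * r n) \<longlonglongrightarrow> C * 0" by (intro tendsto_intros r)
  then have "\<forall>\<^sub>F n in sequentially. C * r n < T / 2"
    using T by (intro order_tendstoD(2)) auto
  with c ev have "\<forall>\<^sub>F n in sequentially. 0 < (\<Sum>k\<in>J n. W n k) \<and> (\<forall>\<phi>. unit_slope \<phi> \<longrightarrow>
     \<bar>(\<Sum>k\<in>J n. \<phi> (Y n k) * W n k) / (\<Sum>k\<in>J n. W n k)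
       - (\<integral>x. \<phi> x * exp (- \<kappa> * x ^ (2 * m)) \<partial>lborel) / T\<bar> \<le> C' * r n)"
  proof eventually_elim
    case (elim n)
    let ?S = "\<lambda>\<phi>. \<Sum>k\<in>J n. \<phi> (Y n k) * W n k" and ?I = "\<lambda>\<phi>. \<integral>x. \<phi> x * exp (- \<kappa> * x ^ (2 * m)) \<partial>lborel"
    let ?W = "\<Sum>k\<in>J n. W n k"
    have "\<bar>c n * ?S (\<lambda>_. 1) - ?I (\<lambda>_. 1)\<bar> \<le> C * r n"
      using laplace_closeD[OF elim(2), of "\<lambda>_. 1"] by simp
    then have 1: "\<bar>c n * ?W - T\<bar> \<le> C * r n" by (simp add: T_def)
    then have 2: "T / 2 \<le> c n * ?W" using elim(3) by linarith
    then have "0 < c n * ?W" using T by linarith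
    then have pos: "0 < ?W" using elim(1) by (simp add: zero_less_mult_iff)
    have "\<bar>?S \<phi> / ?W - ?I \<phi> / T\<bar> \<le> C' * r n" if \<phi>: "unit_slope \<phi>" for \<phi>
    proof -
      \<comment> \<open>Subtracting \<open>\<phi> 0\<close> shifts both normalized quantities by the
        same constant, so their difference is unchanged.\<close>
      let ?\<psi> = "\<lambda>x. \<phi> x - \<phi> 0"
      have \<psi>: "unit_slope ?\<psi>" "\<bar>?\<psi> 0\<bar> \<le> 1" using unit_slope_shift[OF \<phi>] by auto
      have "\<bar>c n * ?S ?\<psi> - ?I ?\<psi>\<bar> \<le> C * r n" by (rule laplace_closeD[OF elim(2) \<psi>])
      then have "\<bar>(c n * ?S ?\<psi>) / (c n * ?W) - ?I ?\<psi> / T\<bar> \<le> (2 / T + 2 * M / T\<^sup>2) * (C * r n)"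
        using 1 2 T M(2)[OF \<psi>] by (rule ratio_difference_bound)
      moreover have "(c n * ?S ?\<psi>) / (c n * ?W) = ?S \<phi> / ?W - \<phi> 0"
        using pos elim(1) by (simp add: left_diff_distrib sum_subtractf diff_divide_distrib flip: sum_distrib_left)
      moreover have "?I ?\<psi> = ?I \<phi> - \<phi> 0 * T"
        unfolding T_def left_diff_distrib
        using unit_slope_damped_integrable'[OF \<kappa> \<phi>] laplace_integrable[OF \<kappa>] by simp
      ultimately show ?thesis using T by (simp add: C'_def diff_divide_distrib)
    qed
    with pos show ?case by blast
  qed
  then show ?thesis using that unfolding T_def by blast
qed

section \<open>The scale n^(1/(2m)) and the sum over all k\<close>

definition root_scale :: "nat \<Rightarrow> nat \<Rightarrow> real" where
  "root_scale m n = real n powr (1 / real (2 * m))"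

lemma root_scale_pos: "n \<ge> 1 \<Longrightarrow> root_scale m n > 0"
  by (simp add: root_scale_def)

lemma root_scale_power: "n \<ge> 1 \<Longrightarrow> m \<ge> 1 \<Longrightarrow> root_scale m n ^ (2 * m) = real n"
  using powr_power[where z = "real n" and n = "2 * m" and u = "1 / real (2 * m)"] by (simp add: root_scale_def)

lemma root_scale_ge_1: "n \<ge> 1 \<Longrightarrow> root_scale m n \<ge> 1"
  unfolding root_scale_def by (rule ge_one_powr_ge_zero) auto

lemma root_scale_le:
  assumes "n \<ge> 1" "m \<ge> 1"
  shows "root_scale m n \<le> real n"
proof -
  have "root_scale m n \<le> root_scale m n ^ (2 * m)"
    using assms by (intro self_le_power root_scale_ge_1) auto
  also have "\<dots> = real n" by (rule root_scale_power[OF assms])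
  finally show ?thesis .
qed

lemma root_scale_inverse_power: "n \<ge> 1 \<Longrightarrow> 1 / root_scale m n ^ q = real n powr (- (real q / real (2 * m)))"
  using powr_power[where z = "real n" and n = q and u = "1 / real (2 * m)"]
  by (simp add: root_scale_def powr_minus_divide)

lemma root_scale_inverse_tendsto:
  assumes "m \<ge> 1" "q \<ge> 1"
  shows "(\<lambda>n. 1 / root_scale m n ^ q) \<longlonglongrightarrow> 0"
proof -
  have "(\<lambda>n. real n powr (- (real q / real (2 * m)))) \<longlonglongrightarrow> 0"
    using assms by (intro tendsto_neg_powr filterlim_real_sequentially) auto
  moreover have "\<forall>\<^sub>F n in sequentially. real n powr (- (real q / real (2 * m))) = 1 / root_scale m n ^ q"
    using eventually_ge_at_top[of 1] by eventually_elim (simp add: root_scale_inverse_power)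
  ultimately show ?thesis by (rule Lim_transform_eventually)
qed

text \<open>For \<open>k\<close> plus spins this is
  \<open>(M - n * (2 * a - 1)) / n^(1 - 1/(2m))\<close>, the quantity whose fluctuations are
  studied.\<close>

definition lattice_pt :: "real \<Rightarrow> nat \<Rightarrow> nat \<Rightarrow> nat \<Rightarrow> real" where
  "lattice_pt a m n k = root_scale m n * (2 * (real k / real n - a))"

text \<open>Mesh of the rescaled lattice divided by the height of the peak; it turns a sum of
  weights into a Riemann sum.\<close>

definition lattice_norm :: "real \<Rightarrow> real \<Rightarrow> real \<Rightarrow> nat \<Rightarrow> nat \<Rightarrow> real" where
  "lattice_norm \<beta> h a m n = 2 * root_scale m n / real n / peak_scale \<beta> h a n"

lemma lattice_norm_pos: "n \<ge> 1 \<Longrightarrow> lattice_norm \<beta> h a m n > 0"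
  by (simp add: lattice_norm_def peak_scale_pos root_scale_pos)

lemma window_laplace:
  assumes "flat_peak \<beta> h a m q"
  obtains \<delta>0 where "\<delta>0 > 0"
    "\<And>\<delta>. 0 < \<delta> \<Longrightarrow> \<delta> \<le> \<delta>0 \<Longrightarrow> \<exists>C. \<forall>\<^sub>F n in sequentially. laplace_close (peak_rate \<beta> h a m) m (lattice_norm \<beta> h a m n) (window n a \<delta>)
        (lattice_pt a m n) (spin_weight \<beta> h n) (C * (1 / root_scale m n ^ q))"
proof -
  have m: "m \<ge> 1" using assms by (simp add: flat_peak_def)
  obtain \<delta>0 where \<delta>0: "\<delta>0 > 0"
    "\<And>\<delta>. 0 < \<delta> \<Longrightarrow> \<delta> \<le> \<delta>0 \<Longrightarrow> \<exists>C\<ge>0. \<forall>n \<nu> \<phi>. real n \<ge> 4 / \<delta> \<longrightarrow> \<nu> > 0 \<longrightarrow> \<nu> ^ (2 * m) = real n \<longrightarrow>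
      unit_slope \<phi> \<longrightarrow> \<bar>\<phi> 0\<bar> \<le> 1 \<longrightarrow>
      \<bar>2 * \<nu> / real n * (\<Sum>k\<in>window n a \<delta>. \<phi> (\<nu> * (2 * (real k / real n - a))) * (spin_weight \<beta> h n k / peak_scale \<beta> h a n))
       - (\<integral>x. \<phi> x * exp (- peak_rate \<beta> h a m * x ^ (2 * m)) \<partial>lborel)\<bar> \<le> C / \<nu> ^ q"
    by (rule spin_laplace[OF assms]) (rule that)
  show ?thesis
  proof (rule that[OF \<delta>0(1)])
    fix \<delta> :: real assume \<delta>: "0 < \<delta>" "\<delta> \<le> \<delta>0"
    obtain C where C: "\<forall>n \<nu> \<phi>. real n \<ge> 4 / \<delta> \<longrightarrow> \<nu> > 0 \<longrightarrow> \<nu> ^ (2 * m) = real n \<longrightarrow>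
      unit_slope \<phi> \<longrightarrow> \<bar>\<phi> 0\<bar> \<le> 1 \<longrightarrow>
      \<bar>2 * \<nu> / real n * (\<Sum>k\<in>window n a \<delta>. \<phi> (\<nu> * (2 * (real k / real n - a))) * (spin_weight \<beta> h n k / peak_scale \<beta> h a n))
       - (\<integral>x. \<phi> x * exp (- peak_rate \<beta> h a m * x ^ (2 * m)) \<partial>lborel)\<bar> \<le> C / \<nu> ^ q"
      using \<delta>0(2)[OF \<delta>] by (elim exE conjE)
    have "\<forall>\<^sub>F n in sequentially. real n \<ge> 4 / \<delta>"
      using filterlim_real_sequentially by (simp add: filterlim_at_top)
    then have "\<forall>\<^sub>F n in sequentially. laplace_close (peak_rate \<beta> h a m) m (lattice_norm \<beta> h a m n) (window n a \<delta>)
        (lattice_pt a m n) (spin_weight \<beta> h n) (C * (1 / root_scale m n ^ q))"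
      using eventually_ge_at_top[of 1]
    proof (eventually_elim, unfold laplace_close_def, intro allI impI)
      fix n :: nat and \<phi> assume n: "4 / \<delta> \<le> real n" "1 \<le> n" and \<phi>: "unit_slope \<phi>" "\<bar>\<phi> 0\<bar> \<le> 1"
      let ?\<nu> = "root_scale m n"
      have "lattice_norm \<beta> h a m n * (\<Sum>k\<in>window n a \<delta>. \<phi> (lattice_pt a m n k) * spin_weight \<beta> h n k)
        = 2 * ?\<nu> / real n * (\<Sum>k\<in>window n a \<delta>. \<phi> (?\<nu> * (2 * (real k / real n - a))) * (spin_weight \<beta> h n k / peak_scale \<beta> h a n))"
        by (simp add: lattice_norm_def lattice_pt_def flip: sum_divide_distrib)
      then show "\<bar>lattice_norm \<beta> h a m n * (\<Sum>k\<in>window n a \<delta>. \<phi> (lattice_pt a m n k) * spin_weight \<beta> h n k)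
       - (\<integral>x. \<phi> x * exp (- peak_rate \<beta> h a m * x ^ (2 * m)) \<partial>lborel)\<bar> \<le> C * (1 / ?\<nu> ^ q)"
        using C[rule_format, OF n(1) root_scale_pos[OF n(2)] root_scale_power[OF n(2) m] \<phi>]
        by (simp only: times_divide_eq_right mult_1_right)
    qed
    then show "\<exists>C. \<forall>\<^sub>F n in sequentially. laplace_close (peak_rate \<beta> h a m) m (lattice_norm \<beta> h a m n) (window n a \<delta>)
        (lattice_pt a m n) (spin_weight \<beta> h n) (C * (1 / root_scale m n ^ q))" ..
  qed
qed

text \<open>With a single maximizer, everything outside one fixed window is exponentially small,
  whereas a test function there is at most three times \<open>root_scale m n\<close>. The window
  estimate thus extends to all \<open>k\<close> at the same rate.\<close>

lemma full_laplace:
  assumes fp: "flat_peak \<beta> h a m q" and mx: "maximizers \<beta> h = {a}"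
  obtains C where "\<forall>\<^sub>F n in sequentially. laplace_close (peak_rate \<beta> h a m) m (lattice_norm \<beta> h a m n) {..n}
        (lattice_pt a m n) (spin_weight \<beta> h n) (C * (1 / root_scale m n ^ q))"
proof -
  have m: "m \<ge> 1" "q < 2 * m" and a: "0 < a" "a < 1" using fp by (auto simp: flat_peak_def)
  obtain \<delta>0 where \<delta>0: "\<delta>0 > 0"
    "\<And>\<delta>. 0 < \<delta> \<Longrightarrow> \<delta> \<le> \<delta>0 \<Longrightarrow> \<exists>C. \<forall>\<^sub>F n in sequentially. laplace_close (peak_rate \<beta> h a m) m (lattice_norm \<beta> h a m n) (window n a \<delta>)
        (lattice_pt a m n) (spin_weight \<beta> h n) (C * (1 / root_scale m n ^ q))"
    by (rule window_laplace[OF fp]) (rule that)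
  obtain C1 where C1: "\<forall>\<^sub>F n in sequentially. laplace_close (peak_rate \<beta> h a m) m (lattice_norm \<beta> h a m n) (window n a \<delta>0)
        (lattice_pt a m n) (spin_weight \<beta> h n) (C1 * (1 / root_scale m n ^ q))"
    using \<delta>0(2)[OF \<delta>0(1) order_refl] ..
  have "a \<in> maximizers \<beta> h" using mx by simp
  then obtain \<epsilon> C2 where \<epsilon>: "\<epsilon> > 0" "C2 \<ge> 0"
    "\<And>n. n \<ge> 1 \<Longrightarrow> (\<Sum>k\<in>off_window n (maximizers \<beta> h) \<delta>0. spin_weight \<beta> h n k) / peak_scale \<beta> h a n
       \<le> C2 * (real n) ^ 2 * exp (- \<epsilon> * real n)"
    by (rule off_window_weight_bound[OF _ \<delta>0(1)]) (rule that)
  \<comment> \<open>6 is the mesh constant 2 times the growth constant 3. Four powers of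
    \<open>n\<close> are absorbed by
    \<open>n ^ 4 * exp (- \<epsilon> * n) <= fact 4 / \<epsilon> ^ 4\<close>, which leaves
    \<open>1 / n <= 1 / root_scale m n ^ q\<close>.\<close>
  define C3 where "C3 = 6 * C2 * (fact 4 / \<epsilon> ^ 4)"
  have out: "\<bar>lattice_norm \<beta> h a m n * (\<Sum>k\<in>off_window n {a} \<delta>0. \<phi> (lattice_pt a m n k) * spin_weight \<beta> h n k)\<bar>
      \<le> C3 * (1 / root_scale m n ^ q)" if n: "n \<ge> 1" and \<phi>: "unit_slope \<phi>" "\<bar>\<phi> 0\<bar> \<le> 1" for n \<phi>
  proof -
    let ?\<nu> = "root_scale m n" and ?K = "peak_scale \<beta> h a n" and ?W = "spin_weight \<beta> h n"
    have \<nu>: "1 \<le> ?\<nu>" "?\<nu> \<le> real n" using root_scale_ge_1[OF n] root_scale_le[OF n m(1)] by auto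
    have pt: "\<bar>\<phi> (lattice_pt a m n k)\<bar> \<le> 3 * ?\<nu>" if "k \<in> off_window n {a} \<delta>0" for k
    proof -
      have "k \<le> n" using that by (simp add: off_window_def)
      then have "0 \<le> real k / real n" "real k / real n \<le> 1" using n by auto
      moreover have "\<bar>2 * (x - a)\<bar> \<le> 2" if "0 \<le> x" "x \<le> 1" for x using that a by (simp add: abs_le_iff)
      ultimately have "\<bar>2 * (real k / real n - a)\<bar> \<le> 2" by blast
      then have "?\<nu> * \<bar>2 * (real k / real n - a)\<bar> \<le> ?\<nu> * 2" using \<nu> by (intro mult_left_mono) auto
      then have "\<bar>lattice_pt a m n k\<bar> \<le> 2 * ?\<nu>" using \<nu> by (simp add: abs_mult lattice_pt_def)
      then show ?thesis using unit_slope_growth[OF \<phi>, of "lattice_pt a m n k"] \<nu>(1) by linarith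
    qed
    have "\<bar>\<Sum>k\<in>off_window n {a} \<delta>0. \<phi> (lattice_pt a m n k) * ?W k\<bar> \<le> (\<Sum>k\<in>off_window n {a} \<delta>0. 3 * ?\<nu> * ?W k)"
      by (rule order_trans[OF sum_abs], intro sum_mono)
        (simp only: abs_mult abs_of_nonneg[OF spin_weight_nonneg], intro mult_right_mono pt spin_weight_nonneg)
    also have "\<dots> = 3 * ?\<nu> * (\<Sum>k\<in>off_window n {a} \<delta>0. ?W k)" by (simp add: sum_distrib_left)
    finally have "lattice_norm \<beta> h a m n * \<bar>\<Sum>k\<in>off_window n {a} \<delta>0. \<phi> (lattice_pt a m n k) * ?W k\<bar>
        \<le> lattice_norm \<beta> h a m n * (3 * ?\<nu> * (\<Sum>k\<in>off_window n {a} \<delta>0. ?W k))"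
      by (rule mult_left_mono[OF _ less_imp_le[OF lattice_norm_pos[OF n]]])
    also have "\<dots> = 6 * (?\<nu> * ?\<nu> / real n) * ((\<Sum>k\<in>off_window n {a} \<delta>0. ?W k) / ?K)"
      by (simp add: lattice_norm_def)
    also have "\<dots> \<le> 6 * real n * (C2 * (real n) ^ 2 * exp (- \<epsilon> * real n))"
    proof (intro mult_mono)
      show "?\<nu> * ?\<nu> / real n \<le> real n" using n \<nu> mult_mono[OF \<nu>(2) \<nu>(2)] by (simp add: divide_le_eq)
      show "(\<Sum>k\<in>off_window n {a} \<delta>0. ?W k) / ?K \<le> C2 * (real n) ^ 2 * exp (- \<epsilon> * real n)"
        using \<epsilon>(3)[OF n] mx by simp
      show "0 \<le> (\<Sum>k\<in>off_window n {a} \<delta>0. ?W k) / ?K"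
        by (intro divide_nonneg_pos sum_nonneg spin_weight_nonneg peak_scale_pos)
    qed auto
    also have "\<dots> = 6 * C2 * ((real n) ^ 4 * exp (- \<epsilon> * real n)) * (1 / real n)"
      using n by (simp add: eval_nat_numeral)
    also have "\<dots> \<le> 6 * C2 * (fact 4 / \<epsilon> ^ 4) * (1 / ?\<nu> ^ q)"
    proof (intro mult_mono mult_left_mono)
      have "(\<epsilon> * real n) ^ 4 / fact 4 \<le> exp (\<epsilon> * real n)"
        using \<epsilon> by (intro power_div_fact_le_exp) auto
      then show "(real n) ^ 4 * exp (- \<epsilon> * real n) \<le> fact 4 / \<epsilon> ^ 4"
        using \<epsilon>(1) by (simp add: exp_minus power_mult_distrib field_simps)
      have "?\<nu> ^ q \<le> ?\<nu> ^ (2 * m)" using \<nu> m by (intro power_increasing) auto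
      also have "\<dots> = real n" by (rule root_scale_power[OF n m(1)])
      finally show "1 / real n \<le> 1 / ?\<nu> ^ q" using \<nu> by (intro divide_left_mono) auto
    qed (use \<epsilon> in auto)
    finally show ?thesis using lattice_norm_pos[OF n, of \<beta> h a m] by (simp add: abs_mult C3_def)
  qed
  from C1 eventually_ge_at_top[of 1]
  have "\<forall>\<^sub>F n in sequentially. laplace_close (peak_rate \<beta> h a m) m (lattice_norm \<beta> h a m n) {..n}
        (lattice_pt a m n) (spin_weight \<beta> h n) ((C1 + C3) * (1 / root_scale m n ^ q))"
  proof eventually_elim
    case (elim n)
    show ?case
      unfolding laplace_close_def
    proof (intro allI impI)
      fix \<phi> assume \<phi>: "unit_slope \<phi>" "\<bar>\<phi> 0\<bar> \<le> 1"
      let ?g = "\<lambda>k. \<phi> (lattice_pt a m n k) * spin_weight \<beta> h n k" and ?c = "lattice_norm \<beta> h a m n"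
      let ?I = "\<integral>x. \<phi> x * exp (- peak_rate \<beta> h a m * x ^ (2 * m)) \<partial>lborel"
      have "{..n} = window n a \<delta>0 \<union> off_window n {a} \<delta>0" "window n a \<delta>0 \<inter> off_window n {a} \<delta>0 = {}"
        by (auto simp: window_def off_window_def)
      then have "?c * (\<Sum>k\<le>n. ?g k) = ?c * (\<Sum>k\<in>window n a \<delta>0. ?g k) + ?c * (\<Sum>k\<in>off_window n {a} \<delta>0. ?g k)"
        by (simp add: sum.union_disjoint distrib_left)
      then show "\<bar>?c * (\<Sum>k\<le>n. ?g k) - ?I\<bar> \<le> (C1 + C3) * (1 / root_scale m n ^ q)"
        using laplace_closeD[OF elim(1) \<phi>] out[OF elim(2) \<phi>] unfolding distrib_right by linarith
    qed
  qed
  then show ?thesis by (rule that)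
qed

section \<open>From configurations to lattice sums\<close>

lemma finite_spin_configs [simp]: "finite (spin_configs n)"
  by (simp add: spin_configs_def finite_PiE)

text \<open>Configurations correspond to their sets of plus sites, which are then grouped by
  cardinality.\<close>

lemma sum_spin_configs:
  fixes F :: "nat \<Rightarrow> real"
  shows "(\<Sum>\<omega>\<in>spin_configs n. F (card {i \<in> {..<n}. \<omega> i = 1})) = (\<Sum>k\<le>n. real (n choose k) * F k)"
proof -
  have "bij_betw (\<lambda>\<omega>. {i \<in> {..<n}. \<omega> i = 1}) (spin_configs n) (Pow {..<n})"
  \<comment> \<open>The inverse is a restricted abstraction because the configurations are
    extensional functions on \<open>{..<n}\<close>.\<close>
  proof (rule bij_betwI[where g = "\<lambda>B. \<lambda>i\<in>{..<n}. if i \<in> B then 1 else - 1"])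
    fix \<omega> :: "nat \<Rightarrow> real" assume \<omega>: "\<omega> \<in> spin_configs n"
    show "(\<lambda>i\<in>{..<n}. if i \<in> {i \<in> {..<n}. \<omega> i = 1} then 1 else - 1) = \<omega>"
    proof
      fix i show "(\<lambda>i\<in>{..<n}. if i \<in> {i \<in> {..<n}. \<omega> i = 1} then 1 else - 1) i = \<omega> i"
        using \<omega> by (cases "i < n") (auto simp: spin_configs_def PiE_def extensional_def Pi_def)
    qed
  qed (auto simp: spin_configs_def)
  then have "(\<Sum>\<omega>\<in>spin_configs n. F (card {i \<in> {..<n}. \<omega> i = 1})) = (\<Sum>B\<in>Pow {..<n}. F (card B))"
    by (rule sum.reindex_bij_betw)
  also have "\<dots> = (\<Sum>k\<le>n. \<Sum>B\<in>{B \<in> Pow {..<n}. card B = k}. F (card B))"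
    by (rule sum.group[symmetric]) (auto intro: card_mono[of "{..<n}", simplified])
  also have "\<dots> = (\<Sum>k\<le>n. real (n choose k) * F k)"
  proof (rule sum.cong[OF refl])
    fix k
    have "(\<Sum>B\<in>{B \<in> Pow {..<n}. card B = k}. F (card B)) = (\<Sum>B\<in>{B. B \<subseteq> {..<n} \<and> card B = k}. F k)"
      by (rule sum.cong) auto
    also have "\<dots> = real (n choose k) * F k" by (simp add: n_subsets)
    finally show "(\<Sum>B\<in>{B \<in> Pow {..<n}. card B = k}. F (card B)) = real (n choose k) * F k" .
  qed
  finally show ?thesis .
qed

lemma magnetization_eq:
  assumes "\<omega> \<in> spin_configs n"
  shows "magnetization n \<omega> = 2 * real (card {i \<in> {..<n}. \<omega> i = 1}) - real n"
proof -
  have "magnetization n \<omega> = (\<Sum>i<n. 2 * (if \<omega> i = 1 then 1 else 0) - 1)"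
    unfolding magnetization_def using assms by (intro sum.cong) (auto simp: spin_configs_def)
  also have "\<dots> = 2 * real (card {i \<in> {..<n}. \<omega> i = 1}) - real n"
    by (simp add: sum_subtractf sum_distrib_left[symmetric] sum.If_cases Int_def)
  finally show ?thesis .
qed

definition partition_sum :: "real \<Rightarrow> real \<Rightarrow> nat \<Rightarrow> real" where
  "partition_sum \<beta> h n = (\<Sum>k\<le>n. spin_weight \<beta> h n k)"

lemma partition_sum_pos: "partition_sum \<beta> h n > 0"
  unfolding partition_sum_def by (intro sum_pos spin_weight_pos) auto

lemma sum_four_spin_weight:
  "(\<Sum>\<omega>\<in>spin_configs n. four_spin_weight \<beta> h n \<omega> * F (magnetization n \<omega>))
    = (\<Sum>k\<le>n. spin_weight \<beta> h n k * F (2 * real k - real n))"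
proof -
  have "(\<Sum>\<omega>\<in>spin_configs n. four_spin_weight \<beta> h n \<omega> * F (magnetization n \<omega>))
    = (\<Sum>\<omega>\<in>spin_configs n. (\<lambda>k. exp (real n * four_f \<beta> h (real k / real n)) * F (2 * real k - real n))
         (card {i \<in> {..<n}. \<omega> i = 1}))"
    by (intro sum.cong) (auto simp: four_spin_weight_def plus_fraction_def magnetization_eq)
  also have "\<dots> = (\<Sum>k\<le>n. real (n choose k) * (exp (real n * four_f \<beta> h (real k / real n)) * F (2 * real k - real n)))"
    by (rule sum_spin_configs)
  finally show ?thesis by (simp add: spin_weight_def mult.assoc)
qed

lemma sum_four_spin_weight_1: "(\<Sum>\<omega>\<in>spin_configs n. four_spin_weight \<beta> h n \<omega>) = partition_sum \<beta> h n"
  using sum_four_spin_weight[where F = "\<lambda>_. 1"] by (simp add: partition_sum_def)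

lemma four_spin_measure_eq:
  "four_spin_measure \<beta> h n = point_measure (spin_configs n) (\<lambda>\<omega>. ennreal (four_spin_weight \<beta> h n \<omega> / partition_sum \<beta> h n))"
  by (simp add: four_spin_measure_def sum_four_spin_weight_1)

lemma space_four_spin_measure [simp]: "space (four_spin_measure \<beta> h n) = spin_configs n"
  by (simp add: four_spin_measure_def space_point_measure)

lemma sets_four_spin_measure [simp]: "sets (four_spin_measure \<beta> h n) = Pow (spin_configs n)"
  by (simp add: four_spin_measure_def sets_point_measure)

lemma measurable_four_spin_measure [measurable]: "f \<in> four_spin_measure \<beta> h n \<rightarrow>\<^sub>M (borel :: real measure)"
  by (simp add: four_spin_measure_def)

lemma four_spin_probability_nonneg: "0 \<le> four_spin_weight \<beta> h n \<omega> / partition_sum \<beta> h n"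
  using partition_sum_pos[of \<beta> h n] by (simp add: four_spin_weight_def)

lemma integral_four_spin_measure:
  fixes F :: "real \<Rightarrow> real"
  shows "(\<integral>\<omega>. F (magnetization n \<omega>) \<partial>four_spin_measure \<beta> h n)
    = (\<Sum>k\<le>n. F (2 * real k - real n) * spin_weight \<beta> h n k) / partition_sum \<beta> h n"
proof -
  have "(\<integral>\<omega>. F (magnetization n \<omega>) \<partial>four_spin_measure \<beta> h n)
      = (\<Sum>\<omega>\<in>spin_configs n. four_spin_weight \<beta> h n \<omega> / partition_sum \<beta> h n * F (magnetization n \<omega>))"
    unfolding four_spin_measure_eq
    by (subst lebesgue_integral_point_measure_finite) (auto simp: four_spin_probability_nonneg)
  also have "\<dots> = (\<Sum>\<omega>\<in>spin_configs n. four_spin_weight \<beta> h n \<omega> * F (magnetization n \<omega>)) / partition_sum \<beta> h n"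
    by (simp add: sum_divide_distrib)
  finally show ?thesis unfolding sum_four_spin_weight by (simp add: mult.commute)
qed

lemma prob_space_four_spin_measure: "prob_space (four_spin_measure \<beta> h n)"
proof
  have "emeasure (four_spin_measure \<beta> h n) (spin_configs n)
      = (\<Sum>\<omega>\<in>spin_configs n. ennreal (four_spin_weight \<beta> h n \<omega> / partition_sum \<beta> h n))"
    unfolding four_spin_measure_eq by (rule emeasure_point_measure_finite) auto
  also have "\<dots> = ennreal (\<Sum>\<omega>\<in>spin_configs n. four_spin_weight \<beta> h n \<omega> / partition_sum \<beta> h n)"
    by (rule sum_ennreal) (rule four_spin_probability_nonneg)
  also have "(\<Sum>\<omega>\<in>spin_configs n. four_spin_weight \<beta> h n \<omega> / partition_sum \<beta> h n) = 1"
    using partition_sum_pos[of \<beta> h n] by (simp add: sum_four_spin_weight_1 flip: sum_divide_distrib)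
  finally show "emeasure (four_spin_measure \<beta> h n) (space (four_spin_measure \<beta> h n)) = 1" by simp
qed

lemma prob_four_spin_measure:
  "\<P>(\<omega> in four_spin_measure \<beta> h n. P (magnetization n \<omega>))
    = (\<Sum>k | k \<le> n \<and> P (2 * real k - real n). spin_weight \<beta> h n k) / partition_sum \<beta> h n"
proof -
  interpret prob_space "four_spin_measure \<beta> h n" by (rule prob_space_four_spin_measure)
  have "\<P>(\<omega> in four_spin_measure \<beta> h n. P (magnetization n \<omega>))
      = (\<integral>\<omega>. indicator {\<omega> \<in> spin_configs n. P (magnetization n \<omega>)} \<omega> \<partial>four_spin_measure \<beta> h n)"
    by (simp add: Collect_conj_eq Int_ac)
  also have "\<dots> = (\<integral>\<omega>. indicator (Collect P) (magnetization n \<omega>) \<partial>four_spin_measure \<beta> h n)"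
    by (intro Bochner_Integration.integral_cong) (auto simp: indicator_def)
  also have "\<dots> = (\<Sum>k\<le>n. indicator (Collect P) (2 * real k - real n) * spin_weight \<beta> h n k) / partition_sum \<beta> h n"
    by (rule integral_four_spin_measure)
  also have "(\<Sum>k\<le>n. indicator (Collect P) (2 * real k - real n) * spin_weight \<beta> h n k)
      = (\<Sum>k | k \<le> n \<and> P (2 * real k - real n). spin_weight \<beta> h n k)"
    by (intro sum.mono_neutral_cong_right) auto
  finally show ?thesis .
qed

section \<open>Expectations under the laws as lattice sums\<close>

lemma integral_magnetization_law:
  assumes [measurable]: "\<phi> \<in> borel_measurable borel"
  shows "(\<integral>x. \<phi> x \<partial>magnetization_law \<beta> h n s)
    = (\<Sum>k\<le>n. \<phi> ((2 * real k - real n) / s) * spin_weight \<beta> h n k) / partition_sum \<beta> h n"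
  unfolding magnetization_law_def
  by (subst integral_distr) (auto simp: integral_four_spin_measure[where F = "\<lambda>y. \<phi> (y / s)"])

lemma (in prob_space) integral_uniform_measure:
  fixes f :: "'a \<Rightarrow> real"
  assumes [measurable]: "A \<in> events" "f \<in> borel_measurable M" and pos: "prob A > 0"
  shows "(\<integral>x. f x \<partial>uniform_measure M A) = (\<integral>x. indicator A x * f x \<partial>M) / prob A"
proof -
  have "uniform_measure M A = density M (\<lambda>x. ennreal (indicator A x / prob A))"
    unfolding uniform_measure_def emeasure_eq_measure
    using pos divide_ennreal[of 1 "prob A"]
    by (intro arg_cong[where f = "density M"] ext) (auto simp: indicator_def)
  then have "(\<integral>x. f x \<partial>uniform_measure M A) = (\<integral>x. (indicator A x / prob A) * f x \<partial>M)"
    by (simp add: integral_density pos)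
  also have "\<dots> = (\<integral>x. (indicator A x * f x) / prob A \<partial>M)" by simp
  finally show ?thesis by simp
qed

lemma magnetization_window:
  assumes "n \<ge> 1"
  shows "(2 * real k - real n) / real n - (2 * a - 1) = 2 * (real k / real n - a)"
  using assms by (simp add: field_simps)

text \<open>Conditioning restricts the sum to the window, and the partition sum cancels between the
  restricted integral and the probability of the event. The nodes match because
  \<open>root_scale 1 n\<close> is \<open>sqrt n\<close>.\<close>

lemma integral_conditional_fluctuation_law:
  assumes [measurable]: "\<phi> \<in> borel_measurable borel" and n: "n \<ge> 1"
    and pos: "0 < (\<Sum>k\<in>window n a \<delta>. spin_weight \<beta> h n k)"
  shows "(\<integral>x. \<phi> x \<partial>conditional_fluctuation_law \<beta> h a \<delta> n)
    = (\<Sum>k\<in>window n a \<delta>. \<phi> (lattice_pt a 1 n k) * spin_weight \<beta> h n k) / (\<Sum>k\<in>window n a \<delta>. spin_weight \<beta> h n k)"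
proof -
  interpret prob_space "four_spin_measure \<beta> h n" by (rule prob_space_four_spin_measure)
  let ?M = "four_spin_measure \<beta> h n" and ?Z = "partition_sum \<beta> h n"
  let ?P = "\<lambda>y. \<bar>y / real n - (2 * a - 1)\<bar> \<le> \<delta>"
  let ?g = "\<lambda>y. \<phi> ((y - real n * (2 * a - 1)) / sqrt (real n))"
  define A where "A = {\<omega> \<in> space ?M. ?P (magnetization n \<omega>)}"
  have win: "{k. k \<le> n \<and> ?P (2 * real k - real n)} = window n a \<delta>"
    unfolding window_def magnetization_window[OF n] ..
  have pt: "((2 * real k - real n) - real n * (2 * a - 1)) / sqrt (real n) = lattice_pt a 1 n k" for k
  proof -
    define s where "s = sqrt (real n)"
    have s: "s > 0" "real n = s * s" "root_scale 1 n = s"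
      using n by (simp_all add: s_def root_scale_def powr_half_sqrt)
    have "(2 * real k - real n) - real n * (2 * a - 1) = real n * (2 * (real k / real n - a))"
      using n by (simp add: field_simps)
    then show ?thesis using s by (simp add: lattice_pt_def flip: s_def)
  qed
  have pA: "prob A = (\<Sum>k\<in>window n a \<delta>. spin_weight \<beta> h n k) / ?Z"
    unfolding A_def prob_four_spin_measure[where P = ?P] win ..
  have "(\<integral>x. \<phi> x \<partial>conditional_fluctuation_law \<beta> h a \<delta> n) = (\<integral>\<omega>. ?g (magnetization n \<omega>) \<partial>uniform_measure ?M A)"
    unfolding conditional_fluctuation_law_def A_def
    by (rule integral_distr) (simp_all add: measurable_cong_sets[OF sets_uniform_measure refl])
  also have "\<dots> = (\<integral>\<omega>. indicator A \<omega> * ?g (magnetization n \<omega>) \<partial>?M) / prob A"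
  proof (rule integral_uniform_measure)
    show "prob A > 0" using pos partition_sum_pos[of \<beta> h n] by (simp add: pA)
  qed (auto simp: A_def)
  also have "(\<integral>\<omega>. indicator A \<omega> * ?g (magnetization n \<omega>) \<partial>?M)
      = (\<integral>\<omega>. (\<lambda>y. indicator (Collect ?P) y * ?g y) (magnetization n \<omega>) \<partial>?M)"
    by (intro Bochner_Integration.integral_cong) (auto simp: A_def indicator_def)
  also have "\<dots> = (\<Sum>k\<le>n. indicator (Collect ?P) (2 * real k - real n) * ?g (2 * real k - real n) * spin_weight \<beta> h n k) / ?Z"
    by (rule integral_four_spin_measure)
  also have "(\<Sum>k\<le>n. indicator (Collect ?P) (2 * real k - real n) * ?g (2 * real k - real n) * spin_weight \<beta> h n k)
      = (\<Sum>k\<in>window n a \<delta>. \<phi> (lattice_pt a 1 n k) * spin_weight \<beta> h n k)"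
    unfolding win[symmetric] pt by (intro sum.mono_neutral_cong_right) auto
  finally show ?thesis unfolding pA using partition_sum_pos[of \<beta> h n] by simp
qed

lemma unit_slope_measurable: "unit_slope \<phi> \<Longrightarrow> \<phi> \<in> borel_measurable borel"
  by (intro borel_measurable_continuous_onI continuous_at_imp_continuous_on ballI DERIV_isCont[OF unit_slope_has_derivative])

lemma integral_law_proportional_to:
  fixes \<kappa> :: real
  assumes \<phi>: "unit_slope \<phi>" and \<kappa>: "\<kappa> > 0" "m \<ge> 1"
  shows "(\<integral>x. \<phi> x \<partial>law_proportional_to (\<lambda>x. exp (- \<kappa> * x ^ (2 * m))))
    = (\<integral>x. \<phi> x * exp (- \<kappa> * x ^ (2 * m)) \<partial>lborel) / (\<integral>x. exp (- \<kappa> * x ^ (2 * m)) \<partial>lborel)"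
proof -
  note [measurable] = unit_slope_measurable[OF \<phi>]
  have "(\<integral>x. \<phi> x \<partial>law_proportional_to (\<lambda>x. exp (- \<kappa> * x ^ (2 * m))))
      = (\<integral>x. exp (- \<kappa> * x ^ (2 * m)) / (\<integral>y. exp (- \<kappa> * y ^ (2 * m)) \<partial>lborel) * \<phi> x \<partial>lborel)"
    unfolding law_proportional_to_def using laplace_mass_pos[OF \<kappa>]
    by (subst integral_density) auto
  also have "\<dots> = (\<integral>x. \<phi> x * exp (- \<kappa> * x ^ (2 * m)) / (\<integral>y. exp (- \<kappa> * y ^ (2 * m)) \<partial>lborel) \<partial>lborel)"
    by (simp add: mult.commute)
  finally show ?thesis by simp
qed

lemma wasserstein_le:
  assumes "\<And>\<phi>. unit_slope \<phi> \<Longrightarrow> \<bar>(\<integral>x. \<phi> x \<partial>P) - (\<integral>x. \<phi> x \<partial>Q)\<bar> \<le> e"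
  shows "wasserstein P Q \<le> ennreal e"
  unfolding wasserstein_def by (rule SUP_least) (auto intro!: ennreal_leI assms simp: unit_slope_def)

text \<open>The Gaussian integral is read off from the normalization of
  \<open>normal_density\<close>. The exponent is written \<open>2 * 1\<close> to agree with the
  general \<open>2 * m\<close>.\<close>

lemma normal_law_eq:
  assumes "\<kappa> > 0"
  shows "normal_law (1 / (2 * \<kappa>)) = law_proportional_to (\<lambda>x. exp (- \<kappa> * x ^ (2 * 1)))"
    and normal_mass: "(\<integral>x. exp (- \<kappa> * x ^ (2 * 1)) \<partial>lborel) = sqrt (pi / \<kappa>)"
proof -
  define \<sigma> where "\<sigma> = sqrt (1 / (2 * \<kappa>))"
  have \<sigma>: "\<sigma> > 0" "\<sigma>\<^sup>2 = 1 / (2 * \<kappa>)" using assms by (auto simp: \<sigma>_def)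
  have d: "normal_density 0 \<sigma> x = exp (- \<kappa> * x ^ (2 * 1)) / sqrt (pi / \<kappa>)" for x
    using \<sigma> assms by (simp add: normal_density_def)
  have "1 = (\<integral>x. normal_density 0 \<sigma> x \<partial>lborel)" using \<sigma> by simp
  also have "\<dots> = (\<integral>x. exp (- \<kappa> * x ^ (2 * 1)) \<partial>lborel) / sqrt (pi / \<kappa>)" unfolding d by simp
  finally show m: "(\<integral>x. exp (- \<kappa> * x ^ (2 * 1)) \<partial>lborel) = sqrt (pi / \<kappa>)" using assms by (simp add: field_simps)
  show "normal_law (1 / (2 * \<kappa>)) = law_proportional_to (\<lambda>x. exp (- \<kappa> * x ^ (2 * 1)))"
    unfolding normal_law_def law_proportional_to_def m \<sigma>_def[symmetric] d ..
qed

section \<open>Limit theorems for the magnetization\<close>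

lemma ennreal_bigo_cong:
  assumes "ennreal_bigo d r" "\<forall>\<^sub>F n in sequentially. d' n = d n" "\<forall>\<^sub>F n in sequentially. r n \<le> r' n"
    "\<forall>\<^sub>F n in sequentially. 0 \<le> r n"
  shows "ennreal_bigo d' r'"
proof -
  obtain C where "\<forall>\<^sub>F n in sequentially. d n \<le> ennreal (C * r n)"
    using assms(1) by (auto simp: ennreal_bigo_def)
  \<comment> \<open>\<open>C\<close> may be negative, in which case replacing \<open>r\<close> by a
    larger \<open>r'\<close> would lower the bound; hence the absolute value.\<close>
  with assms(2-4) have "\<forall>\<^sub>F n in sequentially. d' n \<le> ennreal (\<bar>C\<bar> * r' n)"
  proof eventually_elim
    case (elim n)
    have "C * r n \<le> \<bar>C\<bar> * r n" using elim by (intro mult_right_mono) auto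
    also have "\<dots> \<le> \<bar>C\<bar> * r' n" using elim by (intro mult_left_mono) auto
    finally have "ennreal (C * r n) \<le> ennreal (\<bar>C\<bar> * r' n)" by (rule ennreal_leI)
    with elim(4) show ?case unfolding elim(1) by (rule order_trans)
  qed
  then show ?thesis unfolding ennreal_bigo_def by blast
qed

lemma flat_peak_1:
  assumes "regular_maximizer 1 \<beta> h a" "0 < a" "a < 1"
  shows "flat_peak \<beta> h a 1 1"
proof -
  have "four_A_deriv k \<beta> h a = 0" if "1 \<le> k" "k < 2 * 1 + 1" "k \<noteq> 2 * 1" for k :: nat
  proof -
    have "k \<in> {1..2 * 1 - 1}" using that by auto
    then show ?thesis using assms by (auto simp: regular_maximizer_def)
  qed
  with assms show ?thesis by (auto simp: flat_peak_def regular_maximizer_def)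
qed

lemma flat_peak_2:
  assumes "regular_maximizer 2 \<beta> h (1 / 2)"
  shows "flat_peak \<beta> h (1 / 2) 2 1"
proof -
  have "four_A_deriv k \<beta> h (1 / 2) = 0" if "1 \<le> k" "k < 2 * 2 + 1" "k \<noteq> 2 * 2" for k :: nat
  proof -
    have "k \<in> {1..2 * 2 - 1}" using that by auto
    then show ?thesis using assms by (auto simp: regular_maximizer_def)
  qed
  with assms show ?thesis by (auto simp: flat_peak_def regular_maximizer_def)
qed

text \<open>Orders up to 5 vanish by regularity and order 7 by symmetry. The choice
  \<open>q = 2\<close> gives the error \<open>n^(-1/3)\<close>; \<open>q = 1\<close> would give only
  \<open>n^(-1/6)\<close>.\<close>

lemma flat_peak_3:
  assumes "regular_maximizer 3 \<beta> h (1 / 2)"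
  shows "flat_peak \<beta> h (1 / 2) 3 2"
proof -
  have "four_A_deriv k \<beta> h (1 / 2) = 0" if "1 \<le> k" "k < 2 * 3 + 2" "k \<noteq> 2 * 3" for k :: nat
  proof (cases "k = 7")
    case True then show ?thesis by (simp add: four_A_deriv_7_half)
  next
    case False
    then have "k \<in> {1..2 * 3 - 1}" using that by auto
    then show ?thesis using assms by (auto simp: regular_maximizer_def)
  qed
  with assms show ?thesis by (auto simp: flat_peak_def regular_maximizer_def)
qed

text \<open>At \<open>a = 1 / 2\<close> the centring \<open>2 * a - 1\<close> is zero, so dividing
  \<open>M\<close> by \<open>n / root_scale m n\<close> produces exactly the nodes
  \<open>lattice_pt (1 / 2) m n k\<close>.\<close>

lemma magnetization_wasserstein:
  assumes fp: "flat_peak \<beta> h (1 / 2) m q" and mx: "maximizers \<beta> h = {1 / 2}"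
  shows "ennreal_bigo
    (\<lambda>n. wasserstein (magnetization_law \<beta> h n (real n / root_scale m n))
       (law_proportional_to (\<lambda>x. exp (- peak_rate \<beta> h (1 / 2) m * x ^ (2 * m)))))
    (\<lambda>n. 1 / root_scale m n ^ q)"
proof -
  have m: "m \<ge> 1" "q \<ge> 1" using fp by (auto simp: flat_peak_def)
  note \<kappa> = peak_rate_pos[OF fp]
  obtain C where C: "\<forall>\<^sub>F n in sequentially. laplace_close (peak_rate \<beta> h (1 / 2) m) m (lattice_norm \<beta> h (1 / 2) m n) {..n}
        (lattice_pt (1 / 2) m n) (spin_weight \<beta> h n) (C * (1 / root_scale m n ^ q))"
    by (rule full_laplace[OF fp mx]) (rule that)
  have "\<forall>\<^sub>F n in sequentially. lattice_norm \<beta> h (1 / 2) m n > 0"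
    using eventually_ge_at_top[of 1] by eventually_elim (rule lattice_norm_pos)
  from normalized_laplace[OF \<kappa> m(1) root_scale_inverse_tendsto[OF m] this C]
  obtain C' where "\<forall>\<^sub>F n in sequentially. 0 < (\<Sum>k\<le>n. spin_weight \<beta> h n k) \<and> (\<forall>\<phi>. unit_slope \<phi> \<longrightarrow>
     \<bar>(\<Sum>k\<le>n. \<phi> (lattice_pt (1 / 2) m n k) * spin_weight \<beta> h n k) / (\<Sum>k\<le>n. spin_weight \<beta> h n k)
       - (\<integral>x. \<phi> x * exp (- peak_rate \<beta> h (1 / 2) m * x ^ (2 * m)) \<partial>lborel)
         / (\<integral>x. exp (- peak_rate \<beta> h (1 / 2) m * x ^ (2 * m)) \<partial>lborel)\<bar> \<le> C' * (1 / root_scale m n ^ q))"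
    by blast
  with eventually_ge_at_top[of 1]
  have "\<forall>\<^sub>F n in sequentially. wasserstein (magnetization_law \<beta> h n (real n / root_scale m n))
       (law_proportional_to (\<lambda>x. exp (- peak_rate \<beta> h (1 / 2) m * x ^ (2 * m)))) \<le> ennreal (C' * (1 / root_scale m n ^ q))"
  proof eventually_elim
    case (elim n)
    have pt: "(2 * real k - real n) / (real n / root_scale m n) = lattice_pt (1 / 2) m n k" for k
      using elim(1) by (simp add: lattice_pt_def field_simps)
    show ?case
    proof (rule wasserstein_le)
      fix \<phi> assume \<phi>: "unit_slope \<phi>"
      show "\<bar>(\<integral>x. \<phi> x \<partial>magnetization_law \<beta> h n (real n / root_scale m n))
          - (\<integral>x. \<phi> x \<partial>law_proportional_to (\<lambda>x. exp (- peak_rate \<beta> h (1 / 2) m * x ^ (2 * m))))\<bar> \<le> C' * (1 / root_scale m n ^ q)"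
        unfolding integral_law_proportional_to[OF \<phi> \<kappa> m(1)] integral_magnetization_law[OF unit_slope_measurable[OF \<phi>]]
          pt partition_sum_def
        using elim(2) \<phi> by blast
    qed
  qed
  then show ?thesis unfolding ennreal_bigo_def by blast
qed

lemma normal_law_peak:
  assumes "flat_peak \<beta> h a 1 q"
  shows "normal_law (4 / \<bar>four_A_deriv 2 \<beta> h a\<bar>) = law_proportional_to (\<lambda>x. exp (- peak_rate \<beta> h a 1 * x ^ (2 * 1)))"
proof -
  have "four_A_deriv 2 \<beta> h a < 0" using assms by (simp add: flat_peak_def)
  then have "4 / \<bar>four_A_deriv 2 \<beta> h a\<bar> = 1 / (2 * peak_rate \<beta> h a 1)"
    by (simp add: peak_rate_def numeral_2_eq_2 field_simps)
  then show ?thesis using normal_law_eq[OF peak_rate_pos[OF assms]] by simp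
qed

lemma window_laplace_eventually:
  assumes "flat_peak \<beta> h a m q"
  shows "\<forall>\<^sub>F \<delta> in at_right 0. \<exists>C. \<forall>\<^sub>F n in sequentially.
    laplace_close (peak_rate \<beta> h a m) m (lattice_norm \<beta> h a m n) (window n a \<delta>)
        (lattice_pt a m n) (spin_weight \<beta> h n) (C * (1 / root_scale m n ^ q))"
proof -
  obtain \<delta>0 where \<delta>0: "\<delta>0 > 0"
    "\<And>\<delta>. 0 < \<delta> \<Longrightarrow> \<delta> \<le> \<delta>0 \<Longrightarrow> \<exists>C. \<forall>\<^sub>F n in sequentially.
      laplace_close (peak_rate \<beta> h a m) m (lattice_norm \<beta> h a m n) (window n a \<delta>)
        (lattice_pt a m n) (spin_weight \<beta> h n) (C * (1 / root_scale m n ^ q))"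
    by (rule window_laplace[OF assms]) (rule that)
  have "\<forall>\<^sub>F \<delta> in at_right 0. \<delta> \<in> {0<..<\<delta>0}" using \<delta>0(1) by (rule eventually_at_right_real)
  then show ?thesis by eventually_elim (rule \<delta>0(2), auto)
qed

text \<open>Conditioning confines the sum to one window, so the estimate at a single peak is enough
  and the other maximizers do not enter.\<close>

lemma conditional_wasserstein:
  assumes fp: "flat_peak \<beta> h a 1 1"
  shows "\<forall>\<^sub>F \<delta> in at_right 0. ennreal_bigo
    (\<lambda>n. wasserstein (conditional_fluctuation_law \<beta> h a \<delta> n) (normal_law (4 / \<bar>four_A_deriv 2 \<beta> h a\<bar>)))
    (\<lambda>n. 1 / root_scale 1 n ^ 1)"
  using window_laplace_eventually[OF fp]
proof eventually_elim
  case (elim \<delta>)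
  then obtain C where C: "\<forall>\<^sub>F n in sequentially.
    laplace_close (peak_rate \<beta> h a 1) 1 (lattice_norm \<beta> h a 1 n) (window n a \<delta>)
        (lattice_pt a 1 n) (spin_weight \<beta> h n) (C * (1 / root_scale 1 n ^ 1))" ..
  note \<kappa> = peak_rate_pos[OF fp]
  have "\<forall>\<^sub>F n in sequentially. lattice_norm \<beta> h a 1 n > 0"
    using eventually_ge_at_top[of 1] by eventually_elim (rule lattice_norm_pos)
  from normalized_laplace[OF \<kappa> order_refl root_scale_inverse_tendsto[OF order_refl order_refl] this C]
  obtain C' where "\<forall>\<^sub>F n in sequentially. 0 < (\<Sum>k\<in>window n a \<delta>. spin_weight \<beta> h n k) \<and> (\<forall>\<phi>. unit_slope \<phi> \<longrightarrow>
     \<bar>(\<Sum>k\<in>window n a \<delta>. \<phi> (lattice_pt a 1 n k) * spin_weight \<beta> h n k) / (\<Sum>k\<in>window n a \<delta>. spin_weight \<beta> h n k)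
       - (\<integral>x. \<phi> x * exp (- peak_rate \<beta> h a 1 * x ^ (2 * 1)) \<partial>lborel)
         / (\<integral>x. exp (- peak_rate \<beta> h a 1 * x ^ (2 * 1)) \<partial>lborel)\<bar> \<le> C' * (1 / root_scale 1 n ^ 1))"
    by blast
  with eventually_ge_at_top[of 1]
  have "\<forall>\<^sub>F n in sequentially. wasserstein (conditional_fluctuation_law \<beta> h a \<delta> n)
       (normal_law (4 / \<bar>four_A_deriv 2 \<beta> h a\<bar>)) \<le> ennreal (C' * (1 / root_scale 1 n ^ 1))"
  proof eventually_elim
    case (elim n)
    show ?case unfolding normal_law_peak[OF fp]
    proof (rule wasserstein_le)
      fix \<phi> assume \<phi>: "unit_slope \<phi>"
      show "\<bar>(\<integral>x. \<phi> x \<partial>conditional_fluctuation_law \<beta> h a \<delta> n)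
          - (\<integral>x. \<phi> x \<partial>law_proportional_to (\<lambda>x. exp (- peak_rate \<beta> h a 1 * x ^ (2 * 1))))\<bar> \<le> C' * (1 / root_scale 1 n ^ 1)"
        unfolding integral_law_proportional_to[OF \<phi> \<kappa> order_refl]
          integral_conditional_fluctuation_law[OF unit_slope_measurable[OF \<phi>] elim(1) conjunct1[OF elim(2)]]
        using elim(2) \<phi> by blast
    qed
  qed
  then show ?case unfolding ennreal_bigo_def by blast
qed

section \<open>Exponential concentration\<close>

text \<open>The term of order \<open>Suc j\<close> of the exponential series beats
  \<open>n ^ j\<close> by a factor \<open>1 / n\<close>.\<close>

lemma power_mult_exp_tendsto_0:
  fixes \<epsilon> :: real
  assumes "\<epsilon> > 0"
  shows "(\<lambda>n. C * real n ^ j * exp (- \<epsilon> * real n)) \<longlonglongrightarrow> 0"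
proof -
  define B where "B = \<bar>C\<bar> * (fact (Suc j) / \<epsilon> ^ Suc j)"
  have b: "norm (C * real n ^ j * exp (- \<epsilon> * real n)) \<le> B * (1 / real n)" if "n \<ge> 1" for n
  proof -
    have "(\<epsilon> * real n) ^ Suc j / fact (Suc j) \<le> exp (\<epsilon> * real n)"
      using assms by (intro power_div_fact_le_exp) auto
    then have "real n ^ Suc j * exp (- \<epsilon> * real n) \<le> fact (Suc j) / \<epsilon> ^ Suc j"
      using assms by (simp add: exp_minus power_mult_distrib field_simps del: power_Suc fact_Suc)
    then have "real n ^ Suc j * exp (- \<epsilon> * real n) * (1 / real n) \<le> fact (Suc j) / \<epsilon> ^ Suc j * (1 / real n)"
      by (rule mult_right_mono) simp
    also have "real n ^ Suc j * exp (- \<epsilon> * real n) * (1 / real n) = real n ^ j * exp (- \<epsilon> * real n)"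
      using that by simp
    finally have "real n ^ j * exp (- \<epsilon> * real n) \<le> fact (Suc j) / \<epsilon> ^ Suc j * (1 / real n)" .
    then have "\<bar>C\<bar> * (real n ^ j * exp (- \<epsilon> * real n)) \<le> \<bar>C\<bar> * (fact (Suc j) / \<epsilon> ^ Suc j * (1 / real n))"
      by (rule mult_left_mono) simp
    then show ?thesis by (simp add: B_def abs_mult mult.assoc del: fact_Suc)
  qed
  show ?thesis
  proof (rule Lim_null_comparison)
    show "\<forall>\<^sub>F n in sequentially. norm (C * real n ^ j * exp (- \<epsilon> * real n)) \<le> B * (1 / real n)"
      using eventually_ge_at_top[of 1] by eventually_elim (rule b)
    have "(\<lambda>n. B * (1 / real n)) \<longlonglongrightarrow> B * 0" by (intro tendsto_intros lim_1_over_n)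
    then show "(\<lambda>n. B * (1 / real n)) \<longlonglongrightarrow> 0" by simp
  qed
qed

text \<open>The probability is the off-window weight over the partition sum. The former is
  exponentially small relative to \<open>peak_scale\<close>, and the latter is at least a constant
  times \<open>peak_scale\<close> by the mass of one peak. Half of the exponent absorbs the
  polynomial factor.\<close>

lemma maximizers_concentrated:
  assumes a: "a \<in> maximizers \<beta> h" and fp: "flat_peak \<beta> h a m q"
  shows "exponentially_concentrated \<beta> h (maximizers \<beta> h)"
  unfolding exponentially_concentrated_def
proof (rule eventually_mono[OF eventually_at_right_less])
  fix \<delta> :: real assume \<delta>: "0 < \<delta>"
  have m: "m \<ge> 1" "q \<ge> 1" using fp by (auto simp: flat_peak_def)
  let ?S = "maximizers \<beta> h"
  obtain \<epsilon> C where \<epsilon>: "\<epsilon> > 0" "C \<ge> 0"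
    "\<And>n. n \<ge> 1 \<Longrightarrow> (\<Sum>k\<in>off_window n ?S \<delta>. spin_weight \<beta> h n k) / peak_scale \<beta> h a n
       \<le> C * (real n) ^ 2 * exp (- \<epsilon> * real n)"
    by (rule off_window_weight_bound[OF a \<delta>]) (rule that)
  define T where "T = (\<integral>x. exp (- peak_rate \<beta> h a m * x ^ (2 * m)) \<partial>lborel)"
  have T: "T > 0" unfolding T_def by (rule laplace_mass_pos[OF peak_rate_pos[OF fp] m(1)])
  \<comment> \<open>The lower bound on the partition sum uses a window of its own, narrow enough for
    the Laplace estimate; \<open>\<delta>\<close> itself is any positive number.\<close>
  obtain \<delta>1 C1 where C1: "\<forall>\<^sub>F n in sequentially.
    laplace_close (peak_rate \<beta> h a m) m (lattice_norm \<beta> h a m n) (window n a \<delta>1)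
        (lattice_pt a m n) (spin_weight \<beta> h n) (C1 * (1 / root_scale m n ^ q))"
    using eventually_happens'[OF _ window_laplace_eventually[OF fp]] trivial_limit_at_right_real by blast
  have "(\<lambda>n. C1 * (1 / root_scale m n ^ q)) \<longlonglongrightarrow> C1 * 0"
    by (intro tendsto_intros root_scale_inverse_tendsto m)
  then have small: "\<forall>\<^sub>F n in sequentially. C1 * (1 / root_scale m n ^ q) < T / 2"
    using T by (intro order_tendstoD(2)) auto
  have "\<epsilon> / 2 > 0" using \<epsilon> by simp
  from power_mult_exp_tendsto_0[OF this, of "4 * C / T" 2]
  have "\<forall>\<^sub>F n in sequentially. 4 * C / T * real n ^ 2 * exp (- (\<epsilon> / 2) * real n) < 1"
    by (rule order_tendstoD(2)) simp
  with C1 small eventually_ge_at_top[of 1]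
  have "\<forall>\<^sub>F n in sequentially. \<P>(\<omega> in four_spin_measure \<beta> h n.
             \<forall>a\<in>?S. \<bar>magnetization n \<omega> / real n - (2 * a - 1)\<bar> > \<delta>) \<le> exp (- (\<epsilon> / 2) * real n)"
  proof eventually_elim
    case (elim n)
    let ?W = "\<Sum>k\<in>window n a \<delta>1. spin_weight \<beta> h n k" and ?K = "peak_scale \<beta> h a n"
    let ?Z = "partition_sum \<beta> h n" and ?O = "\<Sum>k\<in>off_window n ?S \<delta>. spin_weight \<beta> h n k"
    have n: "n \<ge> 1" by fact
    have K: "?K > 0" by (rule peak_scale_pos)
    have "\<bar>lattice_norm \<beta> h a m n * ?W - T\<bar> \<le> C1 * (1 / root_scale m n ^ q)"
      using laplace_closeD[OF elim(1), of "\<lambda>_. 1"] by (simp add: T_def)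
    then have "T / 2 \<le> lattice_norm \<beta> h a m n * ?W" using elim(2) by linarith
    \<comment> \<open>A crude use of \<open>root_scale m n <= n\<close>: the true order of the peak
      mass is larger, but a multiple of \<open>peak_scale\<close> suffices against an
      exponential.\<close>
    also have "lattice_norm \<beta> h a m n \<le> 2 / ?K"
      using root_scale_le[OF n m(1)] n K by (simp add: lattice_norm_def field_simps)
    then have "lattice_norm \<beta> h a m n * ?W \<le> 2 / ?K * ?W"
      by (rule mult_right_mono) (intro sum_nonneg spin_weight_nonneg)
    also have "?W \<le> ?Z"
      unfolding partition_sum_def by (rule sum_mono2) (auto simp: window_def spin_weight_nonneg)
    then have "2 / ?K * ?W \<le> 2 / ?K * ?Z" using K by (intro mult_left_mono) auto
    finally have Z: "T / 4 * ?K \<le> ?Z" using K by (simp add: field_simps)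
    have "\<P>(\<omega> in four_spin_measure \<beta> h n. \<forall>a\<in>?S. \<bar>magnetization n \<omega> / real n - (2 * a - 1)\<bar> > \<delta>) = ?O / ?Z"
      unfolding prob_four_spin_measure[where P = "\<lambda>y. \<forall>a\<in>?S. \<bar>y / real n - (2 * a - 1)\<bar> > \<delta>"]
      by (simp only: off_window_def magnetization_window[OF n])
    also have "\<dots> \<le> ?O / (T / 4 * ?K)"
      using Z T K partition_sum_pos[of \<beta> h n] by (intro divide_left_mono mult_pos_pos sum_nonneg spin_weight_nonneg) auto
    also have "\<dots> = 4 / T * (?O / ?K)" by simp
    also have "\<dots> \<le> 4 / T * (C * (real n) ^ 2 * exp (- \<epsilon> * real n))"
      using \<epsilon>(3)[OF n] T by (intro mult_left_mono) auto
    also have "\<dots> = (4 * C / T * real n ^ 2 * exp (- (\<epsilon> / 2) * real n)) * exp (- (\<epsilon> / 2) * real n)"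
      by (simp add: mult.assoc flip: exp_add)
    also have "\<dots> \<le> 1 * exp (- (\<epsilon> / 2) * real n)"
      using elim(4) by (intro mult_right_mono) auto
    finally show ?case by simp
  qed
  then show "\<exists>c>0. \<forall>\<^sub>F n in sequentially. \<P>(\<omega> in four_spin_measure \<beta> h n.
             \<forall>a\<in>?S. \<bar>magnetization n \<omega> / real n - (2 * a - 1)\<bar> > \<delta>) \<le> exp (- c * real n)"
    using \<epsilon>(1) by (intro exI[of _ "\<epsilon> / 2"]) auto
qed

section \<open>Masses of the peaks and weak convergence\<close>

lemma window_mass_limit:
  assumes fp: "flat_peak \<beta> h a 1 1"
    and C: "\<forall>\<^sub>F n in sequentially. laplace_close (peak_rate \<beta> h a 1) 1 (lattice_norm \<beta> h a 1 n) (window n a \<delta>)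
        (lattice_pt a 1 n) (spin_weight \<beta> h n) (C * (1 / root_scale 1 n ^ 1))"
  shows "(\<lambda>n. lattice_norm \<beta> h a 1 n * (\<Sum>k\<in>window n a \<delta>. spin_weight \<beta> h n k))
    \<longlonglongrightarrow> (\<integral>x. exp (- peak_rate \<beta> h a 1 * x ^ (2 * 1)) \<partial>lborel)"
proof (rule LIM_zero_cancel, rule Lim_null_comparison)
  show "\<forall>\<^sub>F n in sequentially. norm (lattice_norm \<beta> h a 1 n * (\<Sum>k\<in>window n a \<delta>. spin_weight \<beta> h n k)
      - (\<integral>x. exp (- peak_rate \<beta> h a 1 * x ^ (2 * 1)) \<partial>lborel)) \<le> C * (1 / root_scale 1 n ^ 1)"
    using C
  proof eventually_elim
    case (elim n)
    show ?case using laplace_closeD[OF elim, of "\<lambda>_. 1"] by simp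
  qed
  have "(\<lambda>n. C * (1 / root_scale 1 n ^ 1)) \<longlonglongrightarrow> C * 0"
    by (intro tendsto_intros root_scale_inverse_tendsto) auto
  then show "(\<lambda>n. C * (1 / root_scale 1 n ^ 1)) \<longlonglongrightarrow> 0" by simp
qed

lemma off_window_mass_limit:
  assumes a: "a \<in> maximizers \<beta> h" and "\<delta> > 0"
  shows "(\<lambda>n. lattice_norm \<beta> h a 1 n * (\<Sum>k\<in>off_window n (maximizers \<beta> h) \<delta>. spin_weight \<beta> h n k)) \<longlonglongrightarrow> 0"
proof -
  obtain \<epsilon> C where \<epsilon>: "\<epsilon> > 0" "C \<ge> 0"
    "\<And>n. n \<ge> 1 \<Longrightarrow> (\<Sum>k\<in>off_window n (maximizers \<beta> h) \<delta>. spin_weight \<beta> h n k) / peak_scale \<beta> h a n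
       \<le> C * (real n) ^ 2 * exp (- \<epsilon> * real n)"
    by (rule off_window_weight_bound[OF assms]) (rule that)
  show ?thesis
  proof (rule Lim_null_comparison)
    show "(\<lambda>n. (2 * C) * real n ^ 2 * exp (- \<epsilon> * real n)) \<longlonglongrightarrow> 0"
      by (rule power_mult_exp_tendsto_0[OF \<epsilon>(1)])
    show "\<forall>\<^sub>F n in sequentially. norm (lattice_norm \<beta> h a 1 n * (\<Sum>k\<in>off_window n (maximizers \<beta> h) \<delta>. spin_weight \<beta> h n k))
        \<le> (2 * C) * real n ^ 2 * exp (- \<epsilon> * real n)"
      using eventually_ge_at_top[of 1]
    proof eventually_elim
      case (elim n)
      let ?O = "\<Sum>k\<in>off_window n (maximizers \<beta> h) \<delta>. spin_weight \<beta> h n k"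
      have O: "?O \<ge> 0" by (intro sum_nonneg spin_weight_nonneg)
      have "norm (lattice_norm \<beta> h a 1 n * ?O) = lattice_norm \<beta> h a 1 n * ?O"
        using O lattice_norm_pos[OF elim, of \<beta> h a 1] by simp
      also have "\<dots> = (2 * root_scale 1 n / real n) * (?O / peak_scale \<beta> h a n)"
        by (simp add: lattice_norm_def)
      also have "\<dots> \<le> 2 * (C * (real n) ^ 2 * exp (- \<epsilon> * real n))"
        using \<epsilon>(3)[OF elim] root_scale_le[OF elim, of 1] O peak_scale_pos[of \<beta> h a n] elim
        by (intro mult_mono) (auto simp: divide_le_eq)
      finally show ?case by simp
    qed
  qed
qed

lemma powr_edge:
  assumes "0 < a" "a < 1"
  shows "(a * (1 - a)) powr (- 1 / 2) = exp (- log_edge a / 2)"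
  using assms by (simp add: powr_def log_edge_def ln_mult add_divide_distrib)

text \<open>The lattice variable is twice the displacement of \<open>k / n\<close>, so the integral
  with rate \<open>|A''(a)| / 8\<close> is twice the one with rate \<open>|A''(a)| / 2\<close> in
  \<open>maximizer_weight\<close>. The factor 2 is common to all maximizers and cancels in the
  mixture.\<close>

lemma maximizer_weight_eq:
  assumes "flat_peak \<beta> h a 1 1"
  shows "exp (- log_edge a / 2) * (\<integral>x. exp (- peak_rate \<beta> h a 1 * x ^ (2 * 1)) \<partial>lborel) = 2 * maximizer_weight \<beta> h a"
    and "maximizer_weight \<beta> h a > 0"
proof -
  define D where "D = - four_A_deriv 2 \<beta> h a"
  have D: "D > 0" and a: "0 < a" "a < 1" using assms by (simp_all add: flat_peak_def D_def)
  have r: "peak_rate \<beta> h a 1 = D / 8" by (simp add: peak_rate_def D_def numeral_2_eq_2)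
  have "(\<integral>x. exp (- (D / 2) * x ^ (2 * 1)) \<partial>lborel) = sqrt (pi / (D / 2))"
    using D by (intro normal_mass) simp
  then have w: "maximizer_weight \<beta> h a = exp (- log_edge a / 2) * sqrt (2 * pi / D)"
    unfolding maximizer_weight_def powr_edge[OF a] by (simp add: D_def mult.commute)
  have "(\<integral>x. exp (- peak_rate \<beta> h a 1 * x ^ (2 * 1)) \<partial>lborel) = sqrt (pi / (D / 8))"
    unfolding r using D by (intro normal_mass) simp
  also have "pi / (D / 8) = 2\<^sup>2 * (2 * pi / D)" using D by (simp add: field_simps)
  also have "sqrt \<dots> = 2 * sqrt (2 * pi / D)" by (subst real_sqrt_mult) simp
  finally show "exp (- log_edge a / 2) * (\<integral>x. exp (- peak_rate \<beta> h a 1 * x ^ (2 * 1)) \<partial>lborel) = 2 * maximizer_weight \<beta> h a"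
    unfolding w by simp
  show "maximizer_weight \<beta> h a > 0" unfolding w using D by simp
qed

text \<open>\<open>four_A\<close> has the same value at all maximizers, so the heights of two peaks
  differ only through \<open>log_edge\<close>. One normalization therefore serves all peaks, and
  \<open>log_edge\<close> is the source of \<open>(a * (1 - a)) powr (- 1 / 2)\<close> in the
  limiting weights.\<close>

lemma lattice_norm_maximizers:
  assumes "a \<in> maximizers \<beta> h" "b \<in> maximizers \<beta> h"
  shows "lattice_norm \<beta> h b 1 n * exp (- log_edge b / 2) = lattice_norm \<beta> h a 1 n * exp (- log_edge a / 2)"
proof -
  have "four_A \<beta> h a = four_A \<beta> h b" using assms by (force simp: maximizers_def intro: antisym)
  then have "peak_scale \<beta> h b n * exp (log_edge b / 2) = peak_scale \<beta> h a n * exp (log_edge a / 2)"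
    unfolding peak_scale_def exp_add[symmetric] by simp
  then show ?thesis
    using peak_scale_pos[of \<beta> h a n] peak_scale_pos[of \<beta> h b n] by (simp add: lattice_norm_def exp_minus field_simps)
qed

text \<open>As \<open>y\<close> is not an atom of the limit, the windows can be taken so narrow that
  each lies entirely on one side of \<open>y\<close>. The sum then consists of whole peaks and an
  off-window remainder that vanishes in the limit.\<close>

lemma partial_mass_limit:
  fixes y :: real
  assumes fin: "finite (maximizers \<beta> h)" and fp: "\<And>a. a \<in> maximizers \<beta> h \<Longrightarrow> flat_peak \<beta> h a 1 1"
    and a0: "a0 \<in> maximizers \<beta> h" and y: "\<And>a. a \<in> maximizers \<beta> h \<Longrightarrow> y \<noteq> 2 * a - 1"
  shows "(\<lambda>n. lattice_norm \<beta> h a0 1 n * exp (- log_edge a0 / 2) *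
      (\<Sum>k | k \<le> n \<and> (2 * real k - real n) / real n \<le> y. spin_weight \<beta> h n k))
    \<longlonglongrightarrow> (\<Sum>a\<in>{a \<in> maximizers \<beta> h. 2 * a - 1 \<le> y}. 2 * maximizer_weight \<beta> h a)"
proof -
  let ?S = "maximizers \<beta> h" and ?c = "\<lambda>n. lattice_norm \<beta> h a0 1 n * exp (- log_edge a0 / 2)"
  let ?T = "{a \<in> ?S. 2 * a - 1 \<le> y}"
  have "\<forall>\<^sub>F \<delta> in at_right 0. \<delta> < e" if "e > 0" for e :: real
    using eventually_at_right_real[OF that] by eventually_elim auto
  note less = this
  \<comment> \<open>Finitely many smallness conditions on \<open>\<delta>\<close>, one family per
    requirement: the Laplace estimate, avoiding \<open>y\<close>, and disjoint windows. All hold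
    eventually at 0, so one \<open>\<delta>\<close> meets them together.\<close>
  have "\<forall>\<^sub>F \<delta> in at_right 0. \<forall>a\<in>?S. \<exists>C. \<forall>\<^sub>F n in sequentially.
      laplace_close (peak_rate \<beta> h a 1) 1 (lattice_norm \<beta> h a 1 n) (window n a \<delta>)
        (lattice_pt a 1 n) (spin_weight \<beta> h n) (C * (1 / root_scale 1 n ^ 1))"
    using fp by (intro eventually_ball_finite fin ballI window_laplace_eventually) auto
  moreover have "\<forall>\<^sub>F \<delta> in at_right 0. \<forall>a\<in>?S. \<delta> < \<bar>y - (2 * a - 1)\<bar>"
    using y by (intro eventually_ball_finite fin ballI less) auto
  \<comment> \<open>This separation makes the windows disjoint: in terms of \<open>k / n\<close>
    each has half-width \<open>\<delta> / 2\<close>.\<close>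
  moreover have "\<forall>\<^sub>F \<delta> in at_right 0. \<forall>a\<in>?S. \<forall>b\<in>?S. a \<noteq> b \<longrightarrow> \<delta> < \<bar>a - b\<bar>"
    by (intro eventually_ball_finite fin ballI) (auto intro!: eventually_mono[OF less[of "\<bar>_ - _\<bar>"]])
  moreover have "\<forall>\<^sub>F \<delta> in at_right (0::real). 0 < \<delta>" by (rule eventually_at_right_less)
  ultimately have "\<forall>\<^sub>F \<delta> in at_right 0. (\<forall>a\<in>?S. \<exists>C. \<forall>\<^sub>F n in sequentially.
      laplace_close (peak_rate \<beta> h a 1) 1 (lattice_norm \<beta> h a 1 n) (window n a \<delta>)
        (lattice_pt a 1 n) (spin_weight \<beta> h n) (C * (1 / root_scale 1 n ^ 1))) \<and>
      (\<forall>a\<in>?S. \<delta> < \<bar>y - (2 * a - 1)\<bar>) \<and> (\<forall>a\<in>?S. \<forall>b\<in>?S. a \<noteq> b \<longrightarrow> \<delta> < \<bar>a - b\<bar>) \<and> 0 < \<delta>"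
    by eventually_elim blast
  from eventually_happens'[OF trivial_limit_at_right_real this]
  obtain \<delta> where C: "\<And>a. a \<in> ?S \<Longrightarrow> \<exists>C. \<forall>\<^sub>F n in sequentially.
      laplace_close (peak_rate \<beta> h a 1) 1 (lattice_norm \<beta> h a 1 n) (window n a \<delta>)
        (lattice_pt a 1 n) (spin_weight \<beta> h n) (C * (1 / root_scale 1 n ^ 1))"
    and \<delta>y: "\<And>a. a \<in> ?S \<Longrightarrow> \<delta> < \<bar>y - (2 * a - 1)\<bar>"
    and \<delta>s: "\<And>a b. a \<in> ?S \<Longrightarrow> b \<in> ?S \<Longrightarrow> a \<noteq> b \<Longrightarrow> \<delta> < \<bar>a - b\<bar>" and \<delta>: "0 < \<delta>"
    by blast
  let ?P = "\<lambda>n k. (2 * real k - real n) / real n \<le> y"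
  have win: "(\<lambda>n. ?c n * (\<Sum>k\<in>window n a \<delta>. spin_weight \<beta> h n k)) \<longlonglongrightarrow> 2 * maximizer_weight \<beta> h a" if a: "a \<in> ?S" for a
  proof -
    obtain C where "\<forall>\<^sub>F n in sequentially. laplace_close (peak_rate \<beta> h a 1) 1 (lattice_norm \<beta> h a 1 n) (window n a \<delta>)
        (lattice_pt a 1 n) (spin_weight \<beta> h n) (C * (1 / root_scale 1 n ^ 1))" using C[OF a] ..
    from tendsto_mult[OF tendsto_const window_mass_limit[OF fp[OF a] this], of "exp (- log_edge a / 2)"]
    show ?thesis
      unfolding maximizer_weight_eq(1)[OF fp[OF a]] lattice_norm_maximizers[OF a a0] by (simp add: mult_ac)
  qed
  have off: "(\<lambda>n. ?c n * (\<Sum>k\<in>{k \<in> off_window n ?S \<delta>. ?P n k}. spin_weight \<beta> h n k)) \<longlonglongrightarrow> 0"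
  proof (rule tendsto_sandwich[OF _ _ tendsto_const])
    show "\<forall>\<^sub>F n in sequentially. 0 \<le> ?c n * (\<Sum>k\<in>{k \<in> off_window n ?S \<delta>. ?P n k}. spin_weight \<beta> h n k)"
      using eventually_ge_at_top[of 1]
      by eventually_elim (intro mult_nonneg_nonneg sum_nonneg spin_weight_nonneg less_imp_le[OF lattice_norm_pos], auto)
    show "\<forall>\<^sub>F n in sequentially. ?c n * (\<Sum>k\<in>{k \<in> off_window n ?S \<delta>. ?P n k}. spin_weight \<beta> h n k)
        \<le> exp (- log_edge a0 / 2) * (lattice_norm \<beta> h a0 1 n * (\<Sum>k\<in>off_window n ?S \<delta>. spin_weight \<beta> h n k))"
      using eventually_ge_at_top[of 1]
    proof eventually_elim
      case (elim n)
      have "(\<Sum>k\<in>{k \<in> off_window n ?S \<delta>. ?P n k}. spin_weight \<beta> h n k) \<le> (\<Sum>k\<in>off_window n ?S \<delta>. spin_weight \<beta> h n k)"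
        by (rule sum_mono2) (auto simp: spin_weight_nonneg)
      then have "?c n * (\<Sum>k\<in>{k \<in> off_window n ?S \<delta>. ?P n k}. spin_weight \<beta> h n k) \<le> ?c n * (\<Sum>k\<in>off_window n ?S \<delta>. spin_weight \<beta> h n k)"
        using lattice_norm_pos[OF elim, of \<beta> h a0 1] by (intro mult_left_mono) auto
      then show ?case by (simp only: mult_ac)
    qed
    from tendsto_mult[OF tendsto_const off_window_mass_limit[OF a0 \<delta>], of "exp (- log_edge a0 / 2)"]
    show "(\<lambda>n. exp (- log_edge a0 / 2) * (lattice_norm \<beta> h a0 1 n * (\<Sum>k\<in>off_window n ?S \<delta>. spin_weight \<beta> h n k))) \<longlonglongrightarrow> 0"
      by simp
  qed
  have split: "(\<Sum>k | k \<le> n \<and> ?P n k. spin_weight \<beta> h n k)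
      = (\<Sum>a\<in>?T. \<Sum>k\<in>window n a \<delta>. spin_weight \<beta> h n k) + (\<Sum>k\<in>{k \<in> off_window n ?S \<delta>. ?P n k}. spin_weight \<beta> h n k)"
    if n: "n \<ge> 1" for n
  proof -
    have side: "?P n k \<longleftrightarrow> 2 * a - 1 \<le> y" if "a \<in> ?S" "k \<in> window n a \<delta>" for a k
    proof -
      have "\<bar>(2 * real k - real n) / real n - (2 * a - 1)\<bar> \<le> \<delta>"
        using that(2) unfolding magnetization_window[OF n] by (simp add: window_def)
      then show ?thesis using \<delta>y[OF that(1)] by linarith
    qed
    have near: "\<bar>a - b\<bar> \<le> \<delta>" if "k \<in> window n a \<delta>" "k \<in> window n b \<delta>" for a b k
    proof -
      have "\<bar>a - b\<bar> \<le> \<delta>" if "\<bar>2 * (x - a)\<bar> \<le> \<delta>" "\<bar>2 * (x - b)\<bar> \<le> \<delta>" for x :: real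
        using that by (auto simp: abs_le_iff)
      then show ?thesis using that by (auto simp: window_def)
    qed
    have eq: "{k. k \<le> n \<and> ?P n k} = (\<Union>a\<in>?T. window n a \<delta>) \<union> {k \<in> off_window n ?S \<delta>. ?P n k}"
    proof (intro set_eqI iffI)
      fix k assume k: "k \<in> {k. k \<le> n \<and> ?P n k}"
      show "k \<in> (\<Union>a\<in>?T. window n a \<delta>) \<union> {k \<in> off_window n ?S \<delta>. ?P n k}"
      proof (cases "k \<in> off_window n ?S \<delta>")
        case False
        then obtain a where "a \<in> ?S" "k \<in> window n a \<delta>" using k by (auto simp: off_window_def window_def not_less)
        then show ?thesis using k side by blast
      qed (use k in auto)
    next
      fix k assume "k \<in> (\<Union>a\<in>?T. window n a \<delta>) \<union> {k \<in> off_window n ?S \<delta>. ?P n k}"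
      then show "k \<in> {k. k \<le> n \<and> ?P n k}"
      proof
        assume "k \<in> (\<Union>a\<in>?T. window n a \<delta>)"
        then obtain a where "a \<in> ?S" "2 * a - 1 \<le> y" "k \<in> window n a \<delta>" by auto
        then show ?thesis using side by (auto simp: window_def)
      qed (simp add: off_window_def)
    qed
    have "(\<Sum>k | k \<le> n \<and> ?P n k. spin_weight \<beta> h n k)
        = (\<Sum>k\<in>(\<Union>a\<in>?T. window n a \<delta>). spin_weight \<beta> h n k) + (\<Sum>k\<in>{k \<in> off_window n ?S \<delta>. ?P n k}. spin_weight \<beta> h n k)"
      unfolding eq using fin by (intro sum.union_disjoint) (auto simp: off_window_def window_def not_less)
    also have "(\<Sum>k\<in>(\<Union>a\<in>?T. window n a \<delta>). spin_weight \<beta> h n k) = (\<Sum>a\<in>?T. \<Sum>k\<in>window n a \<delta>. spin_weight \<beta> h n k)"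
    proof (rule sum.UNION_disjoint)
      show "\<forall>a\<in>?T. \<forall>b\<in>?T. a \<noteq> b \<longrightarrow> window n a \<delta> \<inter> window n b \<delta> = {}"
        using near \<delta>s by (force simp: not_le[symmetric])
    qed (use fin in auto)
    finally show ?thesis .
  qed
  have "(\<lambda>n. (\<Sum>a\<in>?T. ?c n * (\<Sum>k\<in>window n a \<delta>. spin_weight \<beta> h n k)) + ?c n * (\<Sum>k\<in>{k \<in> off_window n ?S \<delta>. ?P n k}. spin_weight \<beta> h n k))
      \<longlonglongrightarrow> (\<Sum>a\<in>?T. 2 * maximizer_weight \<beta> h a) + 0"
    by (intro tendsto_add tendsto_sum win off) auto
  then have "(\<lambda>n. (\<Sum>a\<in>?T. ?c n * (\<Sum>k\<in>window n a \<delta>. spin_weight \<beta> h n k)) + ?c n * (\<Sum>k\<in>{k \<in> off_window n ?S \<delta>. ?P n k}. spin_weight \<beta> h n k))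
      \<longlonglongrightarrow> (\<Sum>a\<in>?T. 2 * maximizer_weight \<beta> h a)" by simp
  then show ?thesis
  proof (rule Lim_transform_eventually)
    show "\<forall>\<^sub>F n in sequentially. (\<Sum>a\<in>?T. ?c n * (\<Sum>k\<in>window n a \<delta>. spin_weight \<beta> h n k)) + ?c n * (\<Sum>k\<in>{k \<in> off_window n ?S \<delta>. ?P n k}. spin_weight \<beta> h n k)
        = ?c n * (\<Sum>k | k \<le> n \<and> ?P n k. spin_weight \<beta> h n k)"
      using eventually_ge_at_top[of 1]
      by eventually_elim (simp only: split distrib_left sum_distrib_left)
  qed
qed

lemma cdf_magnetization_law:
  "cdf (magnetization_law \<beta> h n s) y
    = (\<Sum>k | k \<le> n \<and> (2 * real k - real n) / s \<le> y. spin_weight \<beta> h n k) / partition_sum \<beta> h n"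
proof -
  have "cdf (magnetization_law \<beta> h n s) y = \<P>(\<omega> in four_spin_measure \<beta> h n. magnetization n \<omega> / s \<le> y)"
    unfolding cdf_def magnetization_law_def
    by (subst measure_distr) (auto intro!: arg_cong[where f = "measure _"])
  then show ?thesis using prob_four_spin_measure[where P = "\<lambda>x. x / s \<le> y"] by simp
qed

lemma measure_limit_mixture:
  assumes fin: "finite S" and w: "\<And>a. a \<in> S \<Longrightarrow> maximizer_weight \<beta> h a > 0" and B: "B \<in> sets borel"
  shows "measure (limit_mixture \<beta> h S) B
    = (\<Sum>a\<in>{a \<in> S. 2 * a - 1 \<in> B}. maximizer_weight \<beta> h a) / (\<Sum>a\<in>S. maximizer_weight \<beta> h a)"
proof -
  let ?W = "\<Sum>a\<in>S. maximizer_weight \<beta> h a"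
  let ?p = "\<lambda>a. maximizer_weight \<beta> h a / ?W"
  have p: "0 \<le> ?p a" if "a \<in> S" for a
    using that w by (intro divide_nonneg_nonneg sum_nonneg) (auto intro: less_imp_le)
  have "measure (limit_mixture \<beta> h S) B = measure (point_measure S (\<lambda>a. ennreal (?p a))) {a \<in> S. 2 * a - 1 \<in> B}"
    unfolding limit_mixture_def using B
    by (subst measure_distr) (auto simp: space_point_measure intro!: arg_cong[where f = "measure _"])
  also have "\<dots> = (\<Sum>a\<in>{a \<in> S. 2 * a - 1 \<in> B}. ?p a)"
    by (subst measure_point_measure_finite_if[OF fin p]) auto
  finally show ?thesis by (simp add: sum_divide_distrib)
qed

text \<open>Distribution functions are compared at continuity points of the limit. Numerator and
  partition sum are both partial masses, so \<open>partial_mass_limit\<close> is applied twice and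
  the common normalization cancels in the quotient.\<close>

lemma magnetization_weak_limit:
  assumes fin: "finite (maximizers \<beta> h)" and fp: "\<And>a. a \<in> maximizers \<beta> h \<Longrightarrow> flat_peak \<beta> h a 1 1"
    and a0: "a0 \<in> maximizers \<beta> h"
  shows "weak_conv_m (\<lambda>n. magnetization_law \<beta> h n (real n)) (limit_mixture \<beta> h (maximizers \<beta> h))"
  unfolding weak_conv_m_def weak_conv_def
proof (intro allI impI)
  fix y assume y: "isCont (cdf (limit_mixture \<beta> h (maximizers \<beta> h))) y"
  let ?S = "maximizers \<beta> h" and ?L = "limit_mixture \<beta> h (maximizers \<beta> h)"
  let ?c = "\<lambda>n. lattice_norm \<beta> h a0 1 n * exp (- log_edge a0 / 2)"
  have w: "\<And>a. a \<in> ?S \<Longrightarrow> maximizer_weight \<beta> h a > 0" using fp maximizer_weight_eq(2) by blast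
  have W: "0 < (\<Sum>a\<in>?S. maximizer_weight \<beta> h a)" using fin w a0 by (intro sum_pos) auto
  note mL = measure_limit_mixture[OF fin w]
  have s: "sets ?L = sets borel" "space ?L = UNIV" by (simp_all add: limit_mixture_def)
  have "measure ?L (space ?L) = 1" unfolding s(2) using mL[of UNIV] W by simp
  then have "prob_space ?L" by (intro prob_spaceI) (metis emeasure_eq_ennreal_measure ennreal_1 measure_def enn2real_top zero_neq_one)
  then interpret L: real_distribution ?L by (intro real_distribution.intro real_distribution_axioms.intro) (auto simp: s)
  \<comment> \<open>Every maximizer has positive weight, so an atom at \<open>y\<close> would
    contradict continuity of the distribution function.\<close>
  have "y \<noteq> 2 * a - 1" if a: "a \<in> ?S" for a
  proof
    assume "y = 2 * a - 1"
    then have "{b \<in> ?S. 2 * b - 1 \<in> {y}} = {a}" using a by auto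
    then have "measure ?L {y} > 0" using mL[of "{y}"] W w[OF a] by simp
    then show False using y L.isCont_cdf[of y] by simp
  qed
  note lim1 = partial_mass_limit[OF fin fp a0 this]
  \<comment> \<open>The level 2 lies above every value of \<open>M / n\<close>, so the partial mass
    there is the whole partition sum.\<close>
  have "2 \<noteq> 2 * a - 1" "2 * a - 1 \<le> 2" if "a \<in> ?S" for a using fp[OF that] by (auto simp: flat_peak_def)
  then have S2: "{a \<in> ?S. 2 * a - 1 \<le> 2} = ?S" by auto
  have lim2: "(\<lambda>n. ?c n * (\<Sum>k | k \<le> n \<and> (2 * real k - real n) / real n \<le> 2. spin_weight \<beta> h n k))
      \<longlonglongrightarrow> (\<Sum>a\<in>?S. 2 * maximizer_weight \<beta> h a)"
    using partial_mass_limit[OF fin fp a0, of 2] \<open>\<And>a. a \<in> ?S \<Longrightarrow> 2 \<noteq> 2 * a - 1\<close> unfolding S2 by blast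
  have "(\<lambda>n. (?c n * (\<Sum>k | k \<le> n \<and> (2 * real k - real n) / real n \<le> y. spin_weight \<beta> h n k))
        / (?c n * (\<Sum>k | k \<le> n \<and> (2 * real k - real n) / real n \<le> 2. spin_weight \<beta> h n k)))
      \<longlonglongrightarrow> (\<Sum>a\<in>{a \<in> ?S. 2 * a - 1 \<le> y}. 2 * maximizer_weight \<beta> h a) / (\<Sum>a\<in>?S. 2 * maximizer_weight \<beta> h a)"
    using W by (intro tendsto_divide lim1 lim2) (auto simp flip: sum_distrib_left)
  moreover have "(\<Sum>a\<in>{a \<in> ?S. 2 * a - 1 \<le> y}. 2 * maximizer_weight \<beta> h a) / (\<Sum>a\<in>?S. 2 * maximizer_weight \<beta> h a) = cdf ?L y"
    unfolding cdf_def using mL[of "{..y}"] by (simp flip: sum_distrib_left)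
  ultimately have "(\<lambda>n. (?c n * (\<Sum>k | k \<le> n \<and> (2 * real k - real n) / real n \<le> y. spin_weight \<beta> h n k))
        / (?c n * (\<Sum>k | k \<le> n \<and> (2 * real k - real n) / real n \<le> 2. spin_weight \<beta> h n k))) \<longlonglongrightarrow> cdf ?L y"
    by simp
  then show "(\<lambda>n. cdf (magnetization_law \<beta> h n (real n)) y) \<longlonglongrightarrow> cdf ?L y"
  proof (rule Lim_transform_eventually)
    show "\<forall>\<^sub>F n in sequentially. (?c n * (\<Sum>k | k \<le> n \<and> (2 * real k - real n) / real n \<le> y. spin_weight \<beta> h n k))
        / (?c n * (\<Sum>k | k \<le> n \<and> (2 * real k - real n) / real n \<le> 2. spin_weight \<beta> h n k))
        = cdf (magnetization_law \<beta> h n (real n)) y"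
      using eventually_ge_at_top[of 1]
    proof eventually_elim
      case (elim n)
      have "{k. k \<le> n \<and> (2 * real k - real n) / real n \<le> 2} = {..n}"
        using elim by (auto simp: divide_le_eq)
      then show ?case
        using lattice_norm_pos[OF elim, of \<beta> h a0 1] by (simp add: cdf_magnetization_law partition_sum_def)
    qed
  qed
qed

text \<open>With one maximizer the normalized weight is 1. Weak convergence depends on the limit
  only through its distribution function, so equality of these is enough.\<close>

lemma limit_mixture_singleton:
  assumes "maximizer_weight \<beta> h a > 0"
  shows "cdf (limit_mixture \<beta> h {a}) = cdf (return borel (2 * a - 1))"
proof
  fix y
  have "measure (limit_mixture \<beta> h {a}) {..y} = indicator {..y} (2 * a - 1)"
  proof -
    have "{b \<in> {a}. 2 * b - 1 \<in> {..y}} = (if 2 * a - 1 \<le> y then {a} else {})" by auto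
    then show ?thesis using assms by (subst measure_limit_mixture) (auto simp: indicator_def)
  qed
  then show "cdf (limit_mixture \<beta> h {a}) y = cdf (return borel (2 * a - 1)) y"
    by (simp add: cdf_def measure_return)
qed

lemma root_scale_quotient:
  assumes "n \<ge> 1"
  shows "real n / root_scale m n = real n powr (1 - 1 / real (2 * m))"
  using assms by (simp add: root_scale_def powr_diff)

lemma magnetization_weak_limit_half:
  assumes "maximizers \<beta> h = {1 / 2}" "flat_peak \<beta> h (1 / 2) 1 1"
  shows "weak_conv_m (\<lambda>n. magnetization_law \<beta> h n (real n)) (return borel 0)"
proof -
  have "weak_conv_m (\<lambda>n. magnetization_law \<beta> h n (real n)) (limit_mixture \<beta> h {1 / 2})"
    using magnetization_weak_limit[of \<beta> h "1 / 2", unfolded assms(1)] assms(2) by blast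
  then show ?thesis
    unfolding weak_conv_m_def limit_mixture_singleton[OF maximizer_weight_eq(2)[OF assms(2)]] by simp
qed

text \<open>The regions act through the parameters \<open>(m, q)\<close> of
  \<open>flat_peak\<close>: \<open>(1, 1)\<close> on R1, R2 and R3, \<open>(2, 1)\<close> on R4,
  \<open>(3, 2)\<close> at the tricritical point. The scale \<open>n^(1 - 1/(2m))\<close> then gives
  the exponents 1/2, 3/4 and 5/6, and \<open>n^(-q/(2m))\<close> the rates.\<close>

theorem theorem5p6:
  fixes g :: "real \<Rightarrow> real" and \<beta> h :: real
  assumes "phase_boundary g" and "\<beta> > 0"
  shows
    "((\<beta>, h) \<in> R1 g \<longrightarrow>
        weak_conv_m (\<lambda>n. magnetization_law \<beta> h n (real n)) (return borel 0) \<and>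
        (\<forall>\<^sub>F \<delta> in at_right (0::real). \<exists>c>0. \<forall>\<^sub>F n in sequentially.
           \<P>(\<omega> in four_spin_measure \<beta> h n. \<bar>magnetization n \<omega> / real n\<bar> > \<delta>) \<le> exp (- c * real n)) \<and>
        ennreal_bigo
          (\<lambda>n. wasserstein (magnetization_law \<beta> h n (sqrt (real n)))
                           (normal_law (4 / \<bar>four_A_deriv 2 \<beta> h (1 / 2)\<bar>)))
          (\<lambda>n. real n powr (- 1 / 2)))
     \<and>
     ((\<beta>, h) \<in> R2 g \<union> R3 g \<longrightarrow>
        exponentially_concentrated \<beta> h (maximizers \<beta> h) \<and>
        weak_conv_m (\<lambda>n. magnetization_law \<beta> h n (real n)) (limit_mixture \<beta> h (maximizers \<beta> h)) \<and>
        (\<forall>a\<in>maximizers \<beta> h. \<forall>\<^sub>F \<delta> in at_right (0::real).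
           ennreal_bigo
             (\<lambda>n. wasserstein (conditional_fluctuation_law \<beta> h a \<delta> n)
                              (normal_law (4 / \<bar>four_A_deriv 2 \<beta> h a\<bar>)))
             (\<lambda>n. real n powr (- 1 / 2))))
     \<and>
     ((\<beta>, h) \<in> R4 \<longrightarrow>
        ennreal_bigo
          (\<lambda>n. wasserstein (magnetization_law \<beta> h n (real n powr (3 / 4)))
                           (law_proportional_to
                              (\<lambda>x. exp (four_A_deriv 4 \<beta> h (1 / 2) * x ^ 4 / (2 ^ 4 * fact 4)))))
          (\<lambda>n. real n powr (- 1 / 4)))
     \<and>
     ((\<beta>, h) = (1 / 12, 1 / 2) \<longrightarrow>
        ennreal_bigo
          (\<lambda>n. wasserstein (magnetization_law \<beta> h n (real n powr (5 / 6)))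
                           (law_proportional_to
                              (\<lambda>x. exp (four_A_deriv 6 \<beta> h (1 / 2) * x ^ 6 / (2 ^ 6 * fact 6)))))
          (\<lambda>n. real n powr (- 1 / 4)))"
proof (intro conjI impI)
  assume R: "(\<beta>, h) \<in> R1 g"
  then have mx: "maximizers \<beta> h = {1 / 2}" and "regular_maximizer 1 \<beta> h (1 / 2)"
    using assms(1) by (auto simp: phase_boundary_def)
  then have fp: "flat_peak \<beta> h (1 / 2) 1 1" by (intro flat_peak_1) auto
  show "weak_conv_m (\<lambda>n. magnetization_law \<beta> h n (real n)) (return borel 0)"
    by (rule magnetization_weak_limit_half[OF mx fp])
  show "\<forall>\<^sub>F \<delta> in at_right (0::real). \<exists>c>0. \<forall>\<^sub>F n in sequentially.
           \<P>(\<omega> in four_spin_measure \<beta> h n. \<bar>magnetization n \<omega> / real n\<bar> > \<delta>) \<le> exp (- c * real n)"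
    using maximizers_concentrated[OF _ fp] by (simp add: mx exponentially_concentrated_def)
  show "ennreal_bigo
          (\<lambda>n. wasserstein (magnetization_law \<beta> h n (sqrt (real n)))
                           (normal_law (4 / \<bar>four_A_deriv 2 \<beta> h (1 / 2)\<bar>)))
          (\<lambda>n. real n powr (- 1 / 2))"
    unfolding normal_law_peak[OF fp]
  proof (rule ennreal_bigo_cong[OF magnetization_wasserstein[OF fp mx]])
    show "\<forall>\<^sub>F n in sequentially. wasserstein (magnetization_law \<beta> h n (sqrt (real n)))
          (law_proportional_to (\<lambda>x. exp (- peak_rate \<beta> h (1 / 2) 1 * x ^ (2 * 1))))
        = wasserstein (magnetization_law \<beta> h n (real n / root_scale 1 n))
          (law_proportional_to (\<lambda>x. exp (- peak_rate \<beta> h (1 / 2) 1 * x ^ (2 * 1))))"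
      using eventually_ge_at_top[of 1] by eventually_elim (simp add: root_scale_quotient powr_half_sqrt)
    show "\<forall>\<^sub>F n in sequentially. 1 / root_scale 1 n ^ 1 \<le> real n powr (- 1 / 2)"
      using eventually_ge_at_top[of 1] by eventually_elim (simp only: root_scale_inverse_power, simp)
    show "\<forall>\<^sub>F n in sequentially. 0 \<le> 1 / root_scale 1 n ^ 1"
      using eventually_ge_at_top[of 1] by eventually_elim (simp add: less_imp_le root_scale_pos)
  qed
next
  assume R: "(\<beta>, h) \<in> R2 g \<union> R3 g"
  then obtain S where S: "finite S" "S \<noteq> {}" "maximizers \<beta> h = S" "\<And>a. a \<in> S \<Longrightarrow> 0 < a \<and> a < 1 \<and> regular_maximizer 1 \<beta> h a"
  proof
    assume "(\<beta>, h) \<in> R2 g"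
    with assms(1) obtain am ap where "0 < am" "am < 1 / 2" "1 / 2 < ap" "ap < 1"
        "maximizers \<beta> h = {am, ap}" "\<forall>a\<in>{am, ap}. regular_maximizer 1 \<beta> h a"
      unfolding phase_boundary_def by blast
    then show ?thesis by (intro that[of "{am, ap}"]) auto
  next
    assume "(\<beta>, h) \<in> R3 g"
    with assms(1) obtain am ap where "0 < am" "am < 1 / 2" "1 / 2 < ap" "ap < 1"
        "maximizers \<beta> h = {am, 1 / 2, ap}" "\<forall>a\<in>{am, 1 / 2, ap}. regular_maximizer 1 \<beta> h a"
      unfolding phase_boundary_def by blast
    then show ?thesis by (intro that[of "{am, 1 / 2, ap}"]) auto
  qed
  have fp: "flat_peak \<beta> h a 1 1" if "a \<in> maximizers \<beta> h" for a using S that by (intro flat_peak_1) auto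
  obtain a0 where a0: "a0 \<in> maximizers \<beta> h" using S by auto
  show "exponentially_concentrated \<beta> h (maximizers \<beta> h)" by (rule maximizers_concentrated[OF a0 fp[OF a0]])
  show "weak_conv_m (\<lambda>n. magnetization_law \<beta> h n (real n)) (limit_mixture \<beta> h (maximizers \<beta> h))"
    using S by (intro magnetization_weak_limit[OF _ fp a0]) auto
  show "\<forall>a\<in>maximizers \<beta> h. \<forall>\<^sub>F \<delta> in at_right (0::real).
           ennreal_bigo
             (\<lambda>n. wasserstein (conditional_fluctuation_law \<beta> h a \<delta> n)
                              (normal_law (4 / \<bar>four_A_deriv 2 \<beta> h a\<bar>)))
             (\<lambda>n. real n powr (- 1 / 2))"
  proof
    fix a assume "a \<in> maximizers \<beta> h"
    from conditional_wasserstein[OF fp[OF this]]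
    show "\<forall>\<^sub>F \<delta> in at_right (0::real).
           ennreal_bigo
             (\<lambda>n. wasserstein (conditional_fluctuation_law \<beta> h a \<delta> n)
                              (normal_law (4 / \<bar>four_A_deriv 2 \<beta> h a\<bar>)))
             (\<lambda>n. real n powr (- 1 / 2))"
    proof eventually_elim
      case (elim \<delta>)
      show ?case
      proof (rule ennreal_bigo_cong[OF elim])
        show "\<forall>\<^sub>F n in sequentially. 1 / root_scale 1 n ^ 1 \<le> real n powr (- 1 / 2)"
          using eventually_ge_at_top[of 1] by eventually_elim (simp only: root_scale_inverse_power, simp)
        show "\<forall>\<^sub>F n in sequentially. 0 \<le> 1 / root_scale 1 n ^ 1"
          using eventually_ge_at_top[of 1] by eventually_elim (simp add: less_imp_le root_scale_pos)
      qed simp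
    qed
  qed
next
  assume R: "(\<beta>, h) \<in> R4"
  then have mx: "maximizers \<beta> h = {1 / 2}" and "regular_maximizer 2 \<beta> h (1 / 2)"
    using assms(1) by (auto simp: phase_boundary_def)
  then have fp: "flat_peak \<beta> h (1 / 2) 2 1" by (intro flat_peak_2)
  have law: "(\<lambda>x. exp (four_A_deriv 4 \<beta> h (1 / 2) * x ^ 4 / (2 ^ 4 * fact 4)))
      = (\<lambda>x. exp (- peak_rate \<beta> h (1 / 2) 2 * x ^ (2 * 2)))"
    by (simp add: peak_rate_def)
  show "ennreal_bigo
          (\<lambda>n. wasserstein (magnetization_law \<beta> h n (real n powr (3 / 4)))
                           (law_proportional_to
                              (\<lambda>x. exp (four_A_deriv 4 \<beta> h (1 / 2) * x ^ 4 / (2 ^ 4 * fact 4)))))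
          (\<lambda>n. real n powr (- 1 / 4))"
    unfolding law
  proof (rule ennreal_bigo_cong[OF magnetization_wasserstein[OF fp mx]])
    show "\<forall>\<^sub>F n in sequentially. wasserstein (magnetization_law \<beta> h n (real n powr (3 / 4)))
          (law_proportional_to (\<lambda>x. exp (- peak_rate \<beta> h (1 / 2) 2 * x ^ (2 * 2))))
        = wasserstein (magnetization_law \<beta> h n (real n / root_scale 2 n))
          (law_proportional_to (\<lambda>x. exp (- peak_rate \<beta> h (1 / 2) 2 * x ^ (2 * 2))))"
      using eventually_ge_at_top[of 1] by eventually_elim (simp add: root_scale_quotient)
    show "\<forall>\<^sub>F n in sequentially. 1 / root_scale 2 n ^ 1 \<le> real n powr (- 1 / 4)"
      using eventually_ge_at_top[of 1] by eventually_elim (simp only: root_scale_inverse_power, simp)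
    show "\<forall>\<^sub>F n in sequentially. 0 \<le> 1 / root_scale 2 n ^ 1"
      using eventually_ge_at_top[of 1] by eventually_elim (simp add: less_imp_le root_scale_pos)
  qed
next
  assume R: "(\<beta>, h) = (1 / 12, 1 / 2)"
  then have mx: "maximizers \<beta> h = {1 / 2}" and "regular_maximizer 3 \<beta> h (1 / 2)"
    using assms(1) unfolding phase_boundary_def prod.inject by blast+
  then have fp: "flat_peak \<beta> h (1 / 2) 3 2" by (intro flat_peak_3)
  have law: "(\<lambda>x. exp (four_A_deriv 6 \<beta> h (1 / 2) * x ^ 6 / (2 ^ 6 * fact 6)))
      = (\<lambda>x. exp (- peak_rate \<beta> h (1 / 2) 3 * x ^ (2 * 3)))"
    by (simp add: peak_rate_def)
  show "ennreal_bigo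
          (\<lambda>n. wasserstein (magnetization_law \<beta> h n (real n powr (5 / 6)))
                           (law_proportional_to
                              (\<lambda>x. exp (four_A_deriv 6 \<beta> h (1 / 2) * x ^ 6 / (2 ^ 6 * fact 6)))))
          (\<lambda>n. real n powr (- 1 / 4))"
    unfolding law
  proof (rule ennreal_bigo_cong[OF magnetization_wasserstein[OF fp mx]])
    show "\<forall>\<^sub>F n in sequentially. wasserstein (magnetization_law \<beta> h n (real n powr (5 / 6)))
          (law_proportional_to (\<lambda>x. exp (- peak_rate \<beta> h (1 / 2) 3 * x ^ (2 * 3))))
        = wasserstein (magnetization_law \<beta> h n (real n / root_scale 3 n))
          (law_proportional_to (\<lambda>x. exp (- peak_rate \<beta> h (1 / 2) 3 * x ^ (2 * 3))))"
      using eventually_ge_at_top[of 1] by eventually_elim (simp add: root_scale_quotient)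
    \<comment> \<open>The error obtained is of order \<open>n^(-1/3)\<close>, which is below the
      claimed \<open>n^(-1/4)\<close>.\<close>
    show "\<forall>\<^sub>F n in sequentially. 1 / root_scale 3 n ^ 2 \<le> real n powr (- 1 / 4)"
      using eventually_ge_at_top[of 1]
      by eventually_elim (simp only: root_scale_inverse_power, intro powr_mono, auto)
    show "\<forall>\<^sub>F n in sequentially. 0 \<le> 1 / root_scale 3 n ^ 2"
      using eventually_ge_at_top[of 1] by eventually_elim simp
  qed
qed

end
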